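(* Let $\iota_X\colon A\to X$ and $A\to B$ be maps of $\mathcal M$, and let $S$ be their homotopy pushout, with structure maps $X\to S$ and $\kappa_S\colon B\to S$. Then $$\mathrm{Relcat}(\kappa_S)\leq\mathrm{Relcat}(\iota_X)\quad\text{and}\quad \mathrm{relcat}(\kappa_S)\leq\mathrm{relcat}(\iota_X).$$
   Context: Setting. $\mathcal M$ is a closed model category satisfying the Cube axiom: in any homotopy commutative cube whose bottom face is a homotopy pushout and whose four vertical faces are homotopy pullbacks, the top face is a homotopy pushout. (Main example: the category of well-pointed topological spaces, i.e. pointed spaces whose base point inclusion is a closed cofibration.) Objects are taken cofibrant-fibrant (replacing them if necessary), and $\simeq$ denotes homotopy of maps. A homotopy commutative diagram includes a choice of mutually compatible homotopies. The whisker map is the map (unique up to homotopy once homotopies are fixed) induced out of a homotopy pushout, or into a homotopy pullback, by a homotopy commutative square. Ganea construction. For a map $\iota_X\colon A\to X$, put $G_0=A$, $g_0=\iota_X$, $\alpha_0=\mathrm{id}_A$. Given $g_i\colon G_i\to X$, let $F_i$ be the homotopy pullback of $\iota_X\colon A\to X$ and $g_i\colon G_i\to X$, with maps $\eta_i\colon F_i\to A$, $\beta_i\colon F_i\to G_i$; let $G_{i+1}$ be the homotopy pushout of $\eta_i$ and $\beta_i$, with maps $\alpha_{i+1}\colon A\to G_{i+1}$, $\gamma_i\colon G_i\to G_{i+1}$; and let $g_{i+1}\colon G_{i+1}\to X$ be the whisker map induced by $\iota_X$ and $g_i$. Write $G_i=G_i(\iota_X)$. $\mathrm{relcat}(\iota_X)$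 (relative category) is the least $n\ge0$ such that $g_n\colon G_n(\iota_X)\to X$ has a homotopy section $\sigma$ (i.e. $g_n\circ\sigma\simeq\mathrm{id}_X$) with $\sigma\circ\iota_X\simeq\alpha_n$ ($\infty$ if no such $n$ exists). $\mathrm{Relcat}(\iota_X)$ (strong relative category) is the least $n\ge0$ (or $\infty$) such that there are objects $X_0,\dots,X_n=X$ and maps $\iota_i\colon A\to X_i$ with: $\iota_0$ has a homotopy inverse; for each $0\le i<n$ there are maps $\rho_i\colon Z_i\to A$ and $\tau_i\colon Z_i\to X_i$ whose homotopy pushout is $X_{i+1}$ with structure maps $\iota_{i+1}\colon A\to X_{i+1}$ and $\chi_i\colon X_i\to X_{i+1}$, and a map $\sigma_i\colon A\to Z_i$ with $\rho_i\circ\sigma_i\simeq\mathrm{id}_A$ and $\tau_i\circ\sigma_i\simeq\iota_i$ (the whole diagram being homotopy commutative); and $\iota_n\simeq\iota_X$. *)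

theory Defs
  imports Main "HOL-Library.Extended_Nat"
begin

section \<open>Categories\<close>

record ('o, 'm) cat =
  Ob :: "'o set"
  Arr :: "'m set"
  Dom :: "'m \<Rightarrow> 'o"
  Cod :: "'m \<Rightarrow> 'o"
  Id :: "'o \<Rightarrow> 'm"
  Comp :: "'m \<Rightarrow> 'm \<Rightarrow> 'm"  (infixr "\<cdot>\<index>" 70)

definition Hom where
  "Hom M X Y = {f \<in> Arr M. Dom M f = X \<and> Cod M f = Y}"

locale category =
  fixes M (structure)
  assumes dom_ob: "f \<in> Arr M \<Longrightarrow> Dom M f \<in> Ob M"
    and cod_ob: "f \<in> Arr M \<Longrightarrow> Cod M f \<in> Ob M"
    and id_hom: "X \<in> Ob M \<Longrightarrow> Id M X \<in> Hom M X X"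
    and comp_hom: "\<lbrakk>f \<in> Hom M X Y; g \<in> Hom M Y Z\<rbrakk> \<Longrightarrow> g \<cdot> f \<in> Hom M X Z"
    and comp_id_right: "f \<in> Hom M X Y \<Longrightarrow> f \<cdot> Id M X = f"
    and comp_id_left: "f \<in> Hom M X Y \<Longrightarrow> Id M Y \<cdot> f = f"
    and comp_assoc: "\<lbrakk>f \<in> Hom M W X; g \<in> Hom M X Y; h \<in> Hom M Y Z\<rbrakk>
      \<Longrightarrow> (h \<cdot> g) \<cdot> f = h \<cdot> (g \<cdot> f)"

text \<open>A finite diagram is a finite graph with nodes \<open>N\<close>, labelled by objects \<open>D i\<close>, and edges
  \<open>(i, j, e)\<close> labelled by arrows \<open>e\<close> from \<open>D i\<close> to \<open>D j\<close>.\<close>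

definition finite_diagram where
  "finite_diagram M N D E \<longleftrightarrow>
     finite (N :: nat set) \<and> finite E \<and> (\<forall>i\<in>N. D i \<in> Ob M) \<and>
     (\<forall>(i, j, e)\<in>E. i \<in> N \<and> j \<in> N \<and> e \<in> Hom M (D i) (D j))"

definition is_cone where
  "is_cone M N D E L p \<longleftrightarrow>
     L \<in> Ob M \<and> (\<forall>i\<in>N. p i \<in> Hom M L (D i)) \<and> (\<forall>(i, j, e)\<in>E. e \<cdot>\<^bsub>M\<^esub> p i = p j)"

definition is_limit where
  "is_limit M N D E L p \<longleftrightarrow>
     is_cone M N D E L p \<and>
     (\<forall>T t. is_cone M N D E T t \<longrightarrow> (\<exists>!m. m \<in> Hom M T L \<and> (\<forall>i\<in>N. p i \<cdot>\<^bsub>M\<^esub> m = t i)))"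

definition is_cocone where
  "is_cocone M N D E L q \<longleftrightarrow>
     L \<in> Ob M \<and> (\<forall>i\<in>N. q i \<in> Hom M (D i) L) \<and> (\<forall>(i, j, e)\<in>E. q j \<cdot>\<^bsub>M\<^esub> e = q i)"

definition is_colimit where
  "is_colimit M N D E L q \<longleftrightarrow>
     is_cocone M N D E L q \<and>
     (\<forall>T t. is_cocone M N D E T t \<longrightarrow> (\<exists>!m. m \<in> Hom M L T \<and> (\<forall>i\<in>N. m \<cdot>\<^bsub>M\<^esub> q i = t i)))"

definition is_initial where
  "is_initial M I \<longleftrightarrow> I \<in> Ob M \<and> (\<forall>X\<in>Ob M. \<exists>!f. f \<in> Hom M I X)"

definition is_terminal where
  "is_terminal M T \<longleftrightarrow> T \<in> Ob M \<and> (\<forall>X\<in>Ob M. \<exists>!f. f \<in> Hom M X T)"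

definition is_coproduct where
  "is_coproduct M A B Q a b \<longleftrightarrow>
     a \<in> Hom M A Q \<and> b \<in> Hom M B Q \<and>
     (\<forall>T. \<forall>x\<in>Hom M A T. \<forall>y\<in>Hom M B T.
        \<exists>!m. m \<in> Hom M Q T \<and> m \<cdot>\<^bsub>M\<^esub> a = x \<and> m \<cdot>\<^bsub>M\<^esub> b = y)"

definition is_product where
  "is_product M A B Q a b \<longleftrightarrow>
     a \<in> Hom M Q A \<and> b \<in> Hom M Q B \<and>
     (\<forall>T. \<forall>x\<in>Hom M T A. \<forall>y\<in>Hom M T B.
        \<exists>!m. m \<in> Hom M T Q \<and> a \<cdot>\<^bsub>M\<^esub> m = x \<and> b \<cdot>\<^bsub>M\<^esub> m = y)"

definition is_retract where
  \<comment> \<open>in the category of arrows\<close>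
  "is_retract M f g \<longleftrightarrow>
     (\<exists>i r j s. i \<in> Hom M (Dom M f) (Dom M g) \<and> r \<in> Hom M (Dom M g) (Dom M f) \<and>
        j \<in> Hom M (Cod M f) (Cod M g) \<and> s \<in> Hom M (Cod M g) (Cod M f) \<and>
        r \<cdot>\<^bsub>M\<^esub> i = Id M (Dom M f) \<and> s \<cdot>\<^bsub>M\<^esub> j = Id M (Cod M f) \<and>
        g \<cdot>\<^bsub>M\<^esub> i = j \<cdot>\<^bsub>M\<^esub> f \<and> f \<cdot>\<^bsub>M\<^esub> r = s \<cdot>\<^bsub>M\<^esub> g)"


section \<open>Closed model categories\<close>

record ('o, 'm) model_cat = "('o, 'm) cat" +
  Weq :: "'m set"
  Fib :: "'m set"
  Cof :: "'m set"

text \<open>Quillen's axioms CM1--CM5.\<close>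

locale closed_model_category = category M for M :: "('o, 'm) model_cat" (structure) +
  assumes weq_arr: "Weq M \<subseteq> Arr M" and fib_arr: "Fib M \<subseteq> Arr M" and cof_arr: "Cof M \<subseteq> Arr M"
    and CM1_limits: "finite_diagram M N D E \<Longrightarrow> \<exists>L p. is_limit M N D E L p"
    and CM1_colimits: "finite_diagram M N D E \<Longrightarrow> \<exists>L q. is_colimit M N D E L q"
    and CM2: "\<lbrakk>f \<in> Hom M X Y; g \<in> Hom M Y Z\<rbrakk> \<Longrightarrow>
        (f \<in> Weq M \<and> g \<in> Weq M \<longrightarrow> g \<cdot> f \<in> Weq M) \<and>
        (f \<in> Weq M \<and> g \<cdot> f \<in> Weq M \<longrightarrow> g \<in> Weq M) \<and>
        (g \<in> Weq M \<and> g \<cdot> f \<in> Weq M \<longrightarrow> f \<in> Weq M)"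
    and CM3: "\<lbrakk>f \<in> Arr M; g \<in> Arr M; is_retract M f g\<rbrakk> \<Longrightarrow>
        (g \<in> Weq M \<longrightarrow> f \<in> Weq M) \<and> (g \<in> Fib M \<longrightarrow> f \<in> Fib M) \<and> (g \<in> Cof M \<longrightarrow> f \<in> Cof M)"
    and CM4: "\<lbrakk>i \<in> Hom M A B; p \<in> Hom M X Y; x \<in> Hom M A X; y \<in> Hom M B Y; p \<cdot> x = y \<cdot> i;
        i \<in> Cof M; p \<in> Fib M; i \<in> Weq M \<or> p \<in> Weq M\<rbrakk> \<Longrightarrow>
        \<exists>l \<in> Hom M B X. l \<cdot> i = x \<and> p \<cdot> l = y"
    and CM5_cof_tfib: "f \<in> Hom M X Y \<Longrightarrow>
        \<exists>Z. \<exists>i \<in> Hom M X Z. \<exists>p \<in> Hom M Z Y. f = p \<cdot> i \<and> i \<in> Cof M \<and> p \<in> Fib M \<and> p \<in> Weq M"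
    and CM5_tcof_fib: "f \<in> Hom M X Y \<Longrightarrow>
        \<exists>Z. \<exists>i \<in> Hom M X Z. \<exists>p \<in> Hom M Z Y. f = p \<cdot> i \<and> i \<in> Cof M \<and> i \<in> Weq M \<and> p \<in> Fib M"

definition cofibrant :: "('o, 'm) model_cat \<Rightarrow> 'o \<Rightarrow> bool" where
  "cofibrant M X \<longleftrightarrow> (\<exists>I i. is_initial M I \<and> i \<in> Hom M I X \<and> i \<in> Cof M)"

definition fibrant :: "('o, 'm) model_cat \<Rightarrow> 'o \<Rightarrow> bool" where
  "fibrant M X \<longleftrightarrow> (\<exists>T t. is_terminal M T \<and> t \<in> Hom M X T \<and> t \<in> Fib M)"

definition bifibrant :: "('o, 'm) model_cat \<Rightarrow> 'o \<Rightarrow> bool" where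
  "bifibrant M X \<longleftrightarrow> cofibrant M X \<and> fibrant M X"


section \<open>Homotopies\<close>

text \<open>Cylinder and path objects are the ``very good'' ones: the fold map factors as a cofibration
  followed by an acyclic fibration, the diagonal as an acyclic cofibration followed by a fibration.
  For maps from a cofibrant to a fibrant object this restriction does not affect the homotopy
  relation, and these are the only maps it is applied to below.\<close>

record 'm cylinder =
  inc0 :: 'm
  inc1 :: 'm
  proj :: 'm

abbreviation cyl_ob where
  "cyl_ob M c \<equiv> Dom M (proj c)"

definition is_cylinder :: "('o, 'm) model_cat \<Rightarrow> 'o \<Rightarrow> 'm cylinder \<Rightarrow> bool" where
  "is_cylinder M A c \<longleftrightarrow>
     inc0 c \<in> Hom M A (cyl_ob M c) \<and> inc1 c \<in> Hom M A (cyl_ob M c) \<and> proj c \<in> Hom M (cyl_ob M c) A \<and>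
     proj c \<cdot>\<^bsub>M\<^esub> inc0 c = Id M A \<and> proj c \<cdot>\<^bsub>M\<^esub> inc1 c = Id M A \<and>
     proj c \<in> Fib M \<and> proj c \<in> Weq M \<and>
     (\<exists>Q a b m. is_coproduct M A A Q a b \<and> m \<in> Hom M Q (cyl_ob M c) \<and>
        m \<cdot>\<^bsub>M\<^esub> a = inc0 c \<and> m \<cdot>\<^bsub>M\<^esub> b = inc1 c \<and> m \<in> Cof M)"

record 'm path_ob =
  cnst :: 'm
  ev0 :: 'm
  ev1 :: 'm

abbreviation path_space where
  "path_space M p \<equiv> Cod M (cnst p)"

definition is_path_ob :: "('o, 'm) model_cat \<Rightarrow> 'o \<Rightarrow> 'm path_ob \<Rightarrow> bool" where
  "is_path_ob M B p \<longleftrightarrow>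
     cnst p \<in> Hom M B (path_space M p) \<and>
     ev0 p \<in> Hom M (path_space M p) B \<and> ev1 p \<in> Hom M (path_space M p) B \<and>
     ev0 p \<cdot>\<^bsub>M\<^esub> cnst p = Id M B \<and> ev1 p \<cdot>\<^bsub>M\<^esub> cnst p = Id M B \<and>
     cnst p \<in> Cof M \<and> cnst p \<in> Weq M \<and>
     (\<exists>Q a b m. is_product M B B Q a b \<and> m \<in> Hom M (path_space M p) Q \<and>
        a \<cdot>\<^bsub>M\<^esub> m = ev0 p \<and> b \<cdot>\<^bsub>M\<^esub> m = ev1 p \<and> m \<in> Fib M)"

definition is_homotopy :: "('o, 'm) model_cat \<Rightarrow> 'm cylinder \<Rightarrow> 'm \<Rightarrow> 'm \<Rightarrow> 'm \<Rightarrow> bool" where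
  "is_homotopy M c h f g \<longleftrightarrow>
     (\<exists>A B. f \<in> Hom M A B \<and> g \<in> Hom M A B \<and> is_cylinder M A c \<and>
        h \<in> Hom M (cyl_ob M c) B \<and> h \<cdot>\<^bsub>M\<^esub> inc0 c = f \<and> h \<cdot>\<^bsub>M\<^esub> inc1 c = g)"

definition homotopic :: "('o, 'm) model_cat \<Rightarrow> 'm \<Rightarrow> 'm \<Rightarrow> bool" where
  "homotopic M f g \<longleftrightarrow> (\<exists>c h. is_homotopy M c h f g)"

definition has_homotopy_inverse :: "('o, 'm) model_cat \<Rightarrow> 'm \<Rightarrow> bool" where
  "has_homotopy_inverse M f \<longleftrightarrow>
     (\<exists>r \<in> Hom M (Cod M f) (Dom M f).
        homotopic M (r \<cdot>\<^bsub>M\<^esub> f) (Id M (Dom M f)) \<and> homotopic M (f \<cdot>\<^bsub>M\<^esub> r) (Id M (Cod M f)))"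

text \<open>Quillen's correspondence between a homotopy \<open>h\<close> from \<open>f\<close> to \<open>g\<close> on a cylinder and a
  homotopy \<open>k\<close> from \<open>f\<close> to \<open>g\<close> into a path object: they are two adjacent sides of a square
  \<open>H\<close> of homotopies whose other two sides are constant at \<open>g\<close>.\<close>

definition corresponds :: "('o, 'm) model_cat \<Rightarrow> 'm cylinder \<Rightarrow> 'm \<Rightarrow> 'm path_ob \<Rightarrow> 'm \<Rightarrow> 'm \<Rightarrow> bool" where
  "corresponds M c h p k g \<longleftrightarrow>
     (\<exists>H \<in> Hom M (cyl_ob M c) (path_space M p).
        H \<cdot>\<^bsub>M\<^esub> inc0 c = k \<and> H \<cdot>\<^bsub>M\<^esub> inc1 c = cnst p \<cdot>\<^bsub>M\<^esub> g \<and>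
        ev0 p \<cdot>\<^bsub>M\<^esub> H = h \<and> ev1 p \<cdot>\<^bsub>M\<^esub> H = g \<cdot>\<^bsub>M\<^esub> proj c)"


section \<open>Homotopy pushouts and homotopy pullbacks\<close>

text \<open>A homotopy commutative square consists of \<open>f : A \<rightarrow> B\<close>, \<open>g : A \<rightarrow> C\<close>, \<open>u : B \<rightarrow> D\<close>,
  \<open>v : C \<rightarrow> D\<close> and a chosen homotopy \<open>h\<close> from \<open>u \<cdot> f\<close> to \<open>v \<cdot> g\<close>, on the cylinder \<open>c\<close> of \<open>A\<close>.\<close>

definition hcomm_square where
  "hcomm_square M c f g u v h \<longleftrightarrow>
     (\<exists>A B C D. bifibrant M A \<and> bifibrant M B \<and> bifibrant M C \<and> bifibrant M D \<and>
        f \<in> Hom M A B \<and> g \<in> Hom M A C \<and> u \<in> Hom M B D \<and> v \<in> Hom M C D) \<and>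
     is_homotopy M c h (u \<cdot>\<^bsub>M\<^esub> f) (v \<cdot>\<^bsub>M\<^esub> g)"

text \<open>The double mapping cylinder \<open>Z\<close> of \<open>f\<close> and \<open>g\<close>: the colimit of
  \<open>B \<leftarrow> A \<rightarrow> Cyl A \<leftarrow> A \<rightarrow> C\<close>.\<close>

definition double_cylinder :: "('o, 'm) model_cat \<Rightarrow> 'm cylinder \<Rightarrow> 'm \<Rightarrow> 'm \<Rightarrow> 'o \<Rightarrow> 'm \<Rightarrow> 'm \<Rightarrow> 'm \<Rightarrow> bool" where
  "double_cylinder M c f g Z zb zi zc \<longleftrightarrow>
     zb \<in> Hom M (Cod M f) Z \<and> zi \<in> Hom M (cyl_ob M c) Z \<and> zc \<in> Hom M (Cod M g) Z \<and>
     zi \<cdot>\<^bsub>M\<^esub> inc0 c = zb \<cdot>\<^bsub>M\<^esub> f \<and> zi \<cdot>\<^bsub>M\<^esub> inc1 c = zc \<cdot>\<^bsub>M\<^esub> g \<and>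
     (\<forall>T. \<forall>b \<in> Hom M (Cod M f) T. \<forall>i \<in> Hom M (cyl_ob M c) T. \<forall>x \<in> Hom M (Cod M g) T.
        i \<cdot>\<^bsub>M\<^esub> inc0 c = b \<cdot>\<^bsub>M\<^esub> f \<and> i \<cdot>\<^bsub>M\<^esub> inc1 c = x \<cdot>\<^bsub>M\<^esub> g \<longrightarrow>
        (\<exists>!m. m \<in> Hom M Z T \<and> m \<cdot>\<^bsub>M\<^esub> zb = b \<and> m \<cdot>\<^bsub>M\<^esub> zi = i \<and> m \<cdot>\<^bsub>M\<^esub> zc = x))"

text \<open>The double path space \<open>E\<close> of \<open>u : B \<rightarrow> D\<close> and \<open>v : C \<rightarrow> D\<close>: the limit of
  \<open>B \<rightarrow> D \<leftarrow> Path D \<rightarrow> D \<leftarrow> C\<close>.\<close>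

definition double_path_space :: "('o, 'm) model_cat \<Rightarrow> 'm path_ob \<Rightarrow> 'm \<Rightarrow> 'm \<Rightarrow> 'o \<Rightarrow> 'm \<Rightarrow> 'm \<Rightarrow> 'm \<Rightarrow> bool" where
  "double_path_space M p u v E eb ep ec \<longleftrightarrow>
     eb \<in> Hom M E (Dom M u) \<and> ep \<in> Hom M E (path_space M p) \<and> ec \<in> Hom M E (Dom M v) \<and>
     ev0 p \<cdot>\<^bsub>M\<^esub> ep = u \<cdot>\<^bsub>M\<^esub> eb \<and> ev1 p \<cdot>\<^bsub>M\<^esub> ep = v \<cdot>\<^bsub>M\<^esub> ec \<and>
     (\<forall>T. \<forall>b \<in> Hom M T (Dom M u). \<forall>k \<in> Hom M T (path_space M p). \<forall>x \<in> Hom M T (Dom M v).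
        ev0 p \<cdot>\<^bsub>M\<^esub> k = u \<cdot>\<^bsub>M\<^esub> b \<and> ev1 p \<cdot>\<^bsub>M\<^esub> k = v \<cdot>\<^bsub>M\<^esub> x \<longrightarrow>
        (\<exists>!m. m \<in> Hom M T E \<and> eb \<cdot>\<^bsub>M\<^esub> m = b \<and> ep \<cdot>\<^bsub>M\<^esub> m = k \<and> ec \<cdot>\<^bsub>M\<^esub> m = x))"

definition homotopy_pushout where
  "homotopy_pushout M c f g u v h \<longleftrightarrow>
     hcomm_square M c f g u v h \<and>
     (\<exists>Z zb zi zc w. double_cylinder M c f g Z zb zi zc \<and> w \<in> Hom M Z (Cod M u) \<and>
        w \<cdot>\<^bsub>M\<^esub> zb = u \<and> w \<cdot>\<^bsub>M\<^esub> zi = h \<and> w \<cdot>\<^bsub>M\<^esub> zc = v \<and> w \<in> Weq M)"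

definition homotopy_pullback where
  "homotopy_pullback M c f g u v h \<longleftrightarrow>
     hcomm_square M c f g u v h \<and>
     (\<exists>p k E eb ep ec w. is_path_ob M (Cod M u) p \<and> corresponds M c h p k (v \<cdot>\<^bsub>M\<^esub> g) \<and>
        double_path_space M p u v E eb ep ec \<and> w \<in> Hom M (Dom M f) E \<and>
        eb \<cdot>\<^bsub>M\<^esub> w = f \<and> ep \<cdot>\<^bsub>M\<^esub> w = k \<and> ec \<cdot>\<^bsub>M\<^esub> w = g \<and> w \<in> Weq M)"

text \<open>\<open>t : D \<rightarrow> T\<close> is the whisker map out of the homotopy pushout \<open>(c, f, g, u, v, h)\<close> induced by
  \<open>b : B \<rightarrow> T\<close>, \<open>x : C \<rightarrow> T\<close> and a homotopy \<open>k\<close> from \<open>b \<cdot> f\<close> to \<open>x \<cdot> g\<close>. Asking for the homotopy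
  on the whole double mapping cylinder makes the homotopies \<open>t \<cdot> u \<simeq> b\<close> and \<open>t \<cdot> v \<simeq> x\<close>
  compatible with \<open>h\<close> and \<open>k\<close>, and determines \<open>t\<close> up to homotopy.\<close>

definition is_whisker where
  "is_whisker M c f g u v h b x k t \<longleftrightarrow>
     hcomm_square M c f g b x k \<and> t \<in> Hom M (Cod M u) (Cod M b) \<and>
     (\<exists>Z zb zi zc w m. double_cylinder M c f g Z zb zi zc \<and>
        w \<in> Hom M Z (Cod M u) \<and> w \<cdot>\<^bsub>M\<^esub> zb = u \<and> w \<cdot>\<^bsub>M\<^esub> zi = h \<and> w \<cdot>\<^bsub>M\<^esub> zc = v \<and>
        m \<in> Hom M Z (Cod M b) \<and> m \<cdot>\<^bsub>M\<^esub> zb = b \<and> m \<cdot>\<^bsub>M\<^esub> zi = k \<and> m \<cdot>\<^bsub>M\<^esub> zc = x \<and>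
        homotopic M (t \<cdot>\<^bsub>M\<^esub> w) m)"


section \<open>The Cube axiom\<close>

text \<open>An edge \<open>(m, n, c, h)\<close> stands for a homotopy \<open>h\<close>, on the cylinder \<open>c\<close> of \<open>A\<close>, from the
  \<open>m\<close>-th to the \<open>n\<close>-th of a family of maps \<open>A \<rightarrow> D\<close>. The homotopies are mutually compatible if
  the map to \<open>D\<close> they define on the union of the cylinders, glued along their common ends,
  extends over an object \<open>K\<close> weakly equivalent to \<open>A\<close>, i.e. if all closed loops of homotopies
  are trivial.\<close>

definition mutually_compatible :: "('o, 'm) model_cat \<Rightarrow> 'o \<Rightarrow> 'o \<Rightarrow> (nat \<times> nat \<times> 'm cylinder \<times> 'm) set \<Rightarrow> bool" where
  "mutually_compatible M A D E \<longleftrightarrow>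
     (\<exists>K q H k. q \<in> Hom M K A \<and> q \<in> Weq M \<and> H \<in> Hom M K D \<and>
        (\<forall>(m, n, c, h)\<in>E. \<exists>j \<in> Hom M (cyl_ob M c) K.
           q \<cdot>\<^bsub>M\<^esub> j = proj c \<and> j \<cdot>\<^bsub>M\<^esub> inc0 c = k m \<and> j \<cdot>\<^bsub>M\<^esub> inc1 c = k n \<and> H \<cdot>\<^bsub>M\<^esub> j = h))"

text \<open>\<open>h'\<close> is a precomposite, on the cylinder \<open>c'\<close> of \<open>A'\<close>, of the homotopy \<open>h\<close> on the cylinder
  \<open>c\<close> of \<open>A\<close> with \<open>f : A' \<rightarrow> A\<close>.\<close>

definition is_precomposite :: "('o, 'm) model_cat \<Rightarrow> 'm \<Rightarrow> 'm cylinder \<Rightarrow> 'm \<Rightarrow> 'm cylinder \<Rightarrow> 'm \<Rightarrow> bool" where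
  "is_precomposite M f c h c' h' \<longleftrightarrow>
     is_cylinder M (Dom M f) c' \<and>
     (\<exists>l \<in> Hom M (cyl_ob M c') (cyl_ob M c).
        l \<cdot>\<^bsub>M\<^esub> inc0 c' = inc0 c \<cdot>\<^bsub>M\<^esub> f \<and> l \<cdot>\<^bsub>M\<^esub> inc1 c' = inc1 c \<cdot>\<^bsub>M\<^esub> f \<and>
        proj c \<cdot>\<^bsub>M\<^esub> l = f \<cdot>\<^bsub>M\<^esub> proj c' \<and> h' = h \<cdot>\<^bsub>M\<^esub> l)"

text \<open>The cube has top face \<open>A', B', C', D'\<close> (maps \<open>f', g', u', v'\<close>), bottom face \<open>A, B, C, D\<close>
  (maps \<open>f, g, u, v\<close>) and vertical maps \<open>a, b, c, d\<close>. The six faces give homotopies between the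
  six composites \<open>A' \<rightarrow> D\<close>, which are numbered
  \<open>0: d u' f'\<close>, \<open>1: u b f'\<close>, \<open>2: u f a\<close>, \<open>3: v g a\<close>, \<open>4: v c g'\<close>, \<open>5: d v' g'\<close>.\<close>

definition hcomm_cube where
  "hcomm_cube M f' g' u' v' f g u v a b c d ct ht cb hb c1 h1 c2 h2 c3 h3 c4 h4 \<longleftrightarrow>
     hcomm_square M ct f' g' u' v' ht \<and>
     hcomm_square M cb f g u v hb \<and>
     hcomm_square M c1 f' a b f h1 \<and>
     hcomm_square M c2 g' a c g h2 \<and>
     hcomm_square M c3 u' b d u h3 \<and>
     hcomm_square M c4 v' c d v h4 \<and>
     (\<exists>cb' hb' c3' h3' c4' h4'.
        is_precomposite M a cb hb cb' hb' \<and>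
        is_precomposite M f' c3 h3 c3' h3' \<and>
        is_precomposite M g' c4 h4 c4' h4' \<and>
        mutually_compatible M (Dom M f') (Cod M u)
          {(0, 5, ct, d \<cdot>\<^bsub>M\<^esub> ht),
           (0, 1, c3', h3'),
           (1, 2, c1, u \<cdot>\<^bsub>M\<^esub> h1),
           (2, 3, cb', hb'),
           (4, 3, c2, v \<cdot>\<^bsub>M\<^esub> h2),
           (5, 4, c4', h4')})"

definition cube_axiom :: "('o, 'm) model_cat \<Rightarrow> bool" where
  "cube_axiom M \<longleftrightarrow>
     (\<forall>f' g' u' v' f g u v a b c d ct ht cb hb c1 h1 c2 h2 c3 h3 c4 h4.
        hcomm_cube M f' g' u' v' f g u v a b c d ct ht cb hb c1 h1 c2 h2 c3 h3 c4 h4 \<and>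
        homotopy_pushout M cb f g u v hb \<and>
        homotopy_pullback M c1 f' a b f h1 \<and>
        homotopy_pullback M c2 g' a c g h2 \<and>
        homotopy_pullback M c3 u' b d u h3 \<and>
        homotopy_pullback M c4 v' c d v h4 \<longrightarrow>
        homotopy_pushout M ct f' g' u' v' ht)"


section \<open>Relative category and strong relative category\<close>

text \<open>\<open>ganea M \<iota> n g \<alpha>\<close>: the maps \<open>g : G\<^sub>n \<rightarrow> X\<close> and \<open>\<alpha> : A \<rightarrow> G\<^sub>n\<close> are those of an \<open>n\<close>-th stage of
  the Ganea construction on \<open>\<iota> : A \<rightarrow> X\<close>. The construction is a relation because it depends, up to
  homotopy equivalence, on the choice of homotopy pullbacks, homotopy pushouts and whisker maps.\<close>

inductive ganea for M :: "('o, 'm) model_cat" and \<iota> :: 'm where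
  base: "ganea M \<iota> 0 \<iota> (Id M (Dom M \<iota>))"
| step: "\<lbrakk>ganea M \<iota> n g \<alpha>;
    homotopy_pullback M c \<eta> \<beta> \<iota> g h;
    homotopy_pushout M c \<eta> \<beta> \<alpha>' \<gamma> h';
    is_whisker M c \<eta> \<beta> \<alpha>' \<gamma> h' \<iota> g h g'\<rbrakk>
   \<Longrightarrow> ganea M \<iota> (Suc n) g' \<alpha>'"

definition relcat :: "('o, 'm) model_cat \<Rightarrow> 'm \<Rightarrow> enat" where
  "relcat M \<iota> = Inf {enat n | n. \<exists>g \<alpha> \<sigma>. ganea M \<iota> n g \<alpha> \<and> \<sigma> \<in> Hom M (Cod M \<iota>) (Dom M g) \<and>
     homotopic M (g \<cdot>\<^bsub>M\<^esub> \<sigma>) (Id M (Cod M \<iota>)) \<and> homotopic M (\<sigma> \<cdot>\<^bsub>M\<^esub> \<iota>) \<alpha>}"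

text \<open>The two triangles and the square below share no closed loop of homotopies, so a homotopy for
  each of them is all the coherence there is; \<open>\<chi> \<cdot> j i \<simeq> j (Suc i)\<close> is their pasting.\<close>

definition strong_relcat_seq :: "('o, 'm) model_cat \<Rightarrow> 'm \<Rightarrow> nat \<Rightarrow> bool" where
  "strong_relcat_seq M \<iota> n \<longleftrightarrow>
     (\<exists>X j. X n = Cod M \<iota> \<and>
        (\<forall>i\<le>n. bifibrant M (X i) \<and> j i \<in> Hom M (Dom M \<iota>) (X i)) \<and>
        has_homotopy_inverse M (j 0) \<and>
        (\<forall>i<n. \<exists>Z \<rho> \<tau> \<chi> \<sigma> c h.
           \<rho> \<in> Hom M Z (Dom M \<iota>) \<and> \<tau> \<in> Hom M Z (X i) \<and>
           homotopy_pushout M c \<rho> \<tau> (j (Suc i)) \<chi> h \<and>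
           \<sigma> \<in> Hom M (Dom M \<iota>) Z \<and>
           homotopic M (\<rho> \<cdot>\<^bsub>M\<^esub> \<sigma>) (Id M (Dom M \<iota>)) \<and>
           homotopic M (\<tau> \<cdot>\<^bsub>M\<^esub> \<sigma>) (j i)) \<and>
        homotopic M (j n) \<iota>)"

definition strong_relcat :: "('o, 'm) model_cat \<Rightarrow> 'm \<Rightarrow> enat" where
  "strong_relcat M \<iota> = Inf {enat n | n. strong_relcat_seq M \<iota> n}"

end

theory Submission imports Defs begin

text \<open>
  Both inequalities are formal consequences of the universal property of homotopy pushouts in its
  two-dimensional form, where homotopies are taken up to homotopy relative to their ends.
  Bifibrant objects, maps, and such classes of homotopies (two-cells) form a track category: a
  category enriched in groupoids. A homotopy commutative square is a homotopy pushout if and only if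
  it is a weak pushout there (\<open>homotopy_pushout_po\<close>, \<open>wpo_homotopy_pushout\<close>): cocones extend to the
  corner, and two-cells between maps out of the corner can be prescribed on the two legs whenever
  they agree on the source of the span. The rest is pasting of two-cells.

  For \<open>Relcat\<close>, push the given sequence \<open>X\<^sub>i\<close> forward along \<open>f : A \<rightarrow> B\<close>. With
  \<open>S\<^sub>i = X\<^sub>i \<union>\<^sub>A B\<close> and \<open>W\<^sub>i = Z\<^sub>i \<union>\<^sub>A B\<close>, glued along the section \<open>\<sigma>\<^sub>i : A \<rightarrow> Z\<^sub>i\<close>, the pasting laws
  give \<open>S\<^sub>i = X\<^sub>i \<union>\<^bsub>Z\<^sub>i\<^esub> W\<^sub>i\<close>, and hence
  \<open>B \<union>\<^bsub>W\<^sub>i\<^esub> S\<^sub>i = B \<union>\<^bsub>Z\<^sub>i\<^esub> X\<^sub>i = B \<union>\<^sub>A X\<^bsub>i+1\<^esub> = S\<^bsub>i+1\<^esub>\<close> (\<open>pushout_of_step\<close>); the map \<open>B \<rightarrow> W\<^sub>i\<close> is the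
  required section.

  For \<open>relcat\<close>, the Ganea construction is natural: an induction on the stage gives maps
  \<open>\<phi> : G\<^sub>n(\<iota>) \<rightarrow> G\<^sub>n(\<kappa>)\<close> over \<open>j : X \<rightarrow> S\<close> and under \<open>f : A \<rightarrow> B\<close>, together with the coherence of these two
  compatibilities (\<open>ganea_comparison\<close>). Out of the pushout \<open>S\<close>, the maps \<open>\<phi> \<cdot> \<sigma>\<close> on \<open>X\<close> and \<open>\<alpha>\<close> on \<open>B\<close>
  then define \<open>s : S \<rightarrow> G\<^sub>n(\<kappa>)\<close>. The composite of \<open>s\<close> with \<open>g\<^sub>n(\<kappa>)\<close> is homotopic to the structure maps on
  \<open>X\<close> and on \<open>B\<close>, but it need not be homotopic to the identity: \<open>g \<cdot> \<sigma> \<simeq> Id\<close> and \<open>\<sigma> \<cdot> \<iota> \<simeq> \<alpha>\<close> are unrelated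
  homotopies, and they differ by a self-homotopy of \<open>\<iota>\<close>. Twisting \<open>S\<close> by the inverse of that loop
  repairs this without changing the restriction to \<open>B\<close> (\<open>section_over_pushout\<close>).

  The technical part is the construction of the track category from the model structure. A two-cell
  between maps \<open>A \<rightarrow> Y\<close> is represented by a map from \<open>A\<close> to a path object of \<open>Y\<close>. A two-cell with
  given ends is determined by its restriction along an acyclic cofibration (\<open>two_cell_unique\<close>), and the constant
  paths \<open>Y \<rightarrow> paths Y\<close> are one; so every law for two-cells needs to be checked only for
  identity two-cells (path induction).
\<close>

section \<open>Arrows, finite limits and colimits\<close>

context category begin

lemma in_Hom [simp]: "f \<in> Hom M X Y \<longleftrightarrow> f \<in> Arr M \<and> Dom M f = X \<and> Cod M f = Y"
  by (simp add: Hom_def)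

lemma comp_arr [simp]:
  assumes "f \<in> Arr M" "g \<in> Arr M" "Cod M f = Dom M g"
  shows "g \<cdot> f \<in> Arr M" "Dom M (g \<cdot> f) = Dom M f" "Cod M (g \<cdot> f) = Cod M g"
  using comp_hom[of f "Dom M f" "Cod M f" g "Cod M g"] assms by simp_all

lemma assoc [simp]:
  assumes "f \<in> Arr M" "g \<in> Arr M" "h \<in> Arr M" "Cod M f = Dom M g" "Cod M g = Dom M h"
  shows "(h \<cdot> g) \<cdot> f = h \<cdot> (g \<cdot> f)"
  using comp_assoc[of f "Dom M f" "Cod M f" g "Cod M g" h "Cod M h"] assms by simp

lemma id_arr [simp]:
  assumes "X \<in> Ob M"
  shows "Id M X \<in> Arr M" "Dom M (Id M X) = X" "Cod M (Id M X) = X"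
  using id_hom[OF assms] by simp_all

lemma comp_id [simp]:
  shows "f \<in> Arr M \<Longrightarrow> Dom M f = X \<Longrightarrow> f \<cdot> Id M X = f"
    and "f \<in> Arr M \<Longrightarrow> Cod M f = Y \<Longrightarrow> Id M Y \<cdot> f = f"
  using comp_id_right[of f X "Cod M f"] comp_id_left[of f "Dom M f" Y] by simp_all

lemma Ob_Dom [simp]: "f \<in> Arr M \<Longrightarrow> Dom M f \<in> Ob M"
  and Ob_Cod [simp]: "f \<in> Arr M \<Longrightarrow> Cod M f \<in> Ob M"
  by (auto intro: dom_ob cod_ob)

lemma Hom_Ob: "f \<in> Hom M X Y \<Longrightarrow> X \<in> Ob M \<and> Y \<in> Ob M"
  using dom_ob cod_ob by auto

lemma comp_cong:
  assumes "g \<cdot> f = e" "f \<in> Arr M" "g \<in> Arr M" "x \<in> Arr M" "Cod M x = Dom M f" "Cod M f = Dom M g"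
  shows "g \<cdot> (f \<cdot> x) = e \<cdot> x"
  using assoc[of x f g] assms by simp

end

context closed_model_category begin

lemma coproduct_exists:
  assumes "A \<in> Ob M" "B \<in> Ob M"
  obtains Q a b where "is_coproduct M A B Q a b"
proof -
  have "finite_diagram M {0, 1} (\<lambda>i. [A, B] ! i) {}"
    using assms by (simp add: finite_diagram_def)
  from CM1_colimits[OF this] obtain Q q where q: "is_colimit M {0, 1} (\<lambda>i. [A, B] ! i) {} Q q"
    by blast
  have "is_coproduct M A B Q (q 0) (q 1)"
    unfolding is_coproduct_def
  proof (intro conjI allI ballI)
    show "q 0 \<in> Hom M A Q" "q 1 \<in> Hom M B Q"
      using q by (auto simp: is_colimit_def is_cocone_def)
    fix T x y assume xy: "x \<in> Hom M A T" "y \<in> Hom M B T"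
    then have "is_cocone M {0, 1} (\<lambda>i. [A, B] ! i) {} T (\<lambda>i. [x, y] ! i)"
      using Hom_Ob[OF xy(1)] by (simp add: is_cocone_def)
    with q have "\<exists>!m. m \<in> Hom M Q T \<and> (\<forall>i\<in>{0, 1}. m \<cdot> q i = [x, y] ! i)"
      unfolding is_colimit_def by blast
    then show "\<exists>!m. m \<in> Hom M Q T \<and> m \<cdot> q 0 = x \<and> m \<cdot> q 1 = y"
      by simp
  qed
  with that show ?thesis by blast
qed

lemma product_exists:
  assumes "A \<in> Ob M" "B \<in> Ob M"
  obtains Q a b where "is_product M A B Q a b"
proof -
  have "finite_diagram M {0, 1} (\<lambda>i. [A, B] ! i) {}"
    using assms by (simp add: finite_diagram_def)
  from CM1_limits[OF this] obtain Q q where q: "is_limit M {0, 1} (\<lambda>i. [A, B] ! i) {} Q q"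
    by blast
  have "is_product M A B Q (q 0) (q 1)"
    unfolding is_product_def
  proof (intro conjI allI ballI)
    show "q 0 \<in> Hom M Q A" "q 1 \<in> Hom M Q B"
      using q by (auto simp: is_limit_def is_cone_def)
    fix T x y assume xy: "x \<in> Hom M T A" "y \<in> Hom M T B"
    then have "is_cone M {0, 1} (\<lambda>i. [A, B] ! i) {} T (\<lambda>i. [x, y] ! i)"
      using Hom_Ob[OF xy(1)] by (simp add: is_cone_def)
    with q have "\<exists>!m. m \<in> Hom M T Q \<and> (\<forall>i\<in>{0, 1}. q i \<cdot> m = [x, y] ! i)"
      unfolding is_limit_def by blast
    then show "\<exists>!m. m \<in> Hom M T Q \<and> q 0 \<cdot> m = x \<and> q 1 \<cdot> m = y"
      by simp
  qed
  with that show ?thesis by blast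
qed

lemma double_cylinder_exists:
  assumes f: "f \<in> Hom M A B" and g: "g \<in> Hom M A C" and c: "is_cylinder M A c"
  obtains Z zb zi zc where "double_cylinder M c f g Z zb zi zc"
proof -
  \<comment> \<open>The node of \<open>A\<close> is doubled: otherwise a cocone would identify the two ends of the cylinder.\<close>
  let ?K = "cyl_ob M c"
  let ?N = "{0, 1, 2, 3, 4 :: nat}" and ?D = "\<lambda>i. [A, A, B, C, ?K] ! i"
  let ?E = "{(0, 2, f), (0, 4, inc0 c), (1, 4, inc1 c), (1, 3, g)}"
  have c': "inc0 c \<in> Hom M A ?K" "inc1 c \<in> Hom M A ?K"
    using c by (simp_all add: is_cylinder_def)
  have "finite_diagram M ?N ?D ?E"
    using f g c' Hom_Ob[OF f] Hom_Ob[OF g] Hom_Ob[OF c'(1)] by (simp add: finite_diagram_def)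
  from CM1_colimits[OF this] obtain Z q where q: "is_colimit M ?N ?D ?E Z q"
    by blast
  then have e: "q 2 \<cdot> f = q 0" "q 4 \<cdot> inc0 c = q 0" "q 4 \<cdot> inc1 c = q 1" "q 3 \<cdot> g = q 1"
    and a: "q 2 \<in> Hom M B Z" "q 3 \<in> Hom M C Z" "q 4 \<in> Hom M ?K Z"
    by (simp_all add: is_colimit_def is_cocone_def)
  have "double_cylinder M c f g Z (q 2) (q 4) (q 3)"
    unfolding double_cylinder_def
  proof (intro conjI allI ballI impI)
    show "q 2 \<in> Hom M (Cod M f) Z" "q 4 \<in> Hom M ?K Z" "q 3 \<in> Hom M (Cod M g) Z"
      using a f g by auto
    show "q 4 \<cdot> inc0 c = q 2 \<cdot> f" "q 4 \<cdot> inc1 c = q 3 \<cdot> g"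
      using e by simp_all
    fix T b i x assume H: "b \<in> Hom M (Cod M f) T" "i \<in> Hom M ?K T" "x \<in> Hom M (Cod M g) T"
      "i \<cdot> inc0 c = b \<cdot> f \<and> i \<cdot> inc1 c = x \<cdot> g"
    then have "is_cocone M ?N ?D ?E T (\<lambda>n. [b \<cdot> f, x \<cdot> g, b, x, i] ! n)"
      using f g c' Hom_Ob[OF H(1)] by (simp add: is_cocone_def)
    with q have "\<exists>!m. m \<in> Hom M Z T \<and> (\<forall>n\<in>?N. m \<cdot> q n = [b \<cdot> f, x \<cdot> g, b, x, i] ! n)"
      unfolding is_colimit_def by blast
    moreover have "(\<forall>n\<in>?N. m \<cdot> q n = [b \<cdot> f, x \<cdot> g, b, x, i] ! n) \<longleftrightarrow>
        m \<cdot> q 2 = b \<and> m \<cdot> q 4 = i \<and> m \<cdot> q 3 = x" if "m \<in> Hom M Z T" for m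
    proof -
      have "m \<cdot> q 0 = (m \<cdot> q 2) \<cdot> f" "m \<cdot> q 1 = (m \<cdot> q 3) \<cdot> g"
        using that a f g e by simp_all
      then show ?thesis by auto
    qed
    ultimately show "\<exists>!m. m \<in> Hom M Z T \<and> m \<cdot> q 2 = b \<and> m \<cdot> q 4 = i \<and> m \<cdot> q 3 = x"
      by (metis (no_types, lifting))
  qed
  with that show ?thesis by blast
qed

lemma double_path_space_exists:
  assumes u: "u \<in> Hom M B D" and v: "v \<in> Hom M C D" and p: "is_path_ob M D p"
  obtains E eb ep ec where "double_path_space M p u v E eb ep ec"
proof -
  let ?K = "path_space M p"
  let ?N = "{0, 1, 2, 3, 4 :: nat}" and ?D = "\<lambda>i. [D, D, B, C, ?K] ! i"
  let ?E = "{(2, 0, u), (4, 0, ev0 p), (4, 1, ev1 p), (3, 1, v)}"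
  have p': "ev0 p \<in> Hom M ?K D" "ev1 p \<in> Hom M ?K D"
    using p by (simp_all add: is_path_ob_def)
  have "finite_diagram M ?N ?D ?E"
    using u v p' Hom_Ob[OF u] Hom_Ob[OF v] Hom_Ob[OF p'(1)] by (simp add: finite_diagram_def)
  from CM1_limits[OF this] obtain E q where q: "is_limit M ?N ?D ?E E q"
    by blast
  then have e: "u \<cdot> q 2 = q 0" "ev0 p \<cdot> q 4 = q 0" "ev1 p \<cdot> q 4 = q 1" "v \<cdot> q 3 = q 1"
    and a: "q 2 \<in> Hom M E B" "q 3 \<in> Hom M E C" "q 4 \<in> Hom M E ?K"
    by (simp_all add: is_limit_def is_cone_def)
  have "double_path_space M p u v E (q 2) (q 4) (q 3)"
    unfolding double_path_space_def
  proof (intro conjI allI ballI impI)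
    show "q 2 \<in> Hom M E (Dom M u)" "q 4 \<in> Hom M E ?K" "q 3 \<in> Hom M E (Dom M v)"
      using a u v by auto
    show "ev0 p \<cdot> q 4 = u \<cdot> q 2" "ev1 p \<cdot> q 4 = v \<cdot> q 3"
      using e by simp_all
    fix T b k x assume H: "b \<in> Hom M T (Dom M u)" "k \<in> Hom M T ?K" "x \<in> Hom M T (Dom M v)"
      "ev0 p \<cdot> k = u \<cdot> b \<and> ev1 p \<cdot> k = v \<cdot> x"
    then have "is_cone M ?N ?D ?E T (\<lambda>n. [u \<cdot> b, v \<cdot> x, b, x, k] ! n)"
      using u v p' Hom_Ob[OF H(1)] by (simp add: is_cone_def)
    with q have "\<exists>!m. m \<in> Hom M T E \<and> (\<forall>n\<in>?N. q n \<cdot> m = [u \<cdot> b, v \<cdot> x, b, x, k] ! n)"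
      unfolding is_limit_def by blast
    moreover have "(\<forall>n\<in>?N. q n \<cdot> m = [u \<cdot> b, v \<cdot> x, b, x, k] ! n) \<longleftrightarrow>
        q 2 \<cdot> m = b \<and> q 4 \<cdot> m = k \<and> q 3 \<cdot> m = x" if "m \<in> Hom M T E" for m
    proof -
      have "q 0 \<cdot> m = u \<cdot> (q 2 \<cdot> m)" "q 1 \<cdot> m = v \<cdot> (q 3 \<cdot> m)"
        using that a u v e assoc[of m "q 2" u] assoc[of m "q 3" v] by simp_all
      then show ?thesis by auto
    qed
    ultimately show "\<exists>!m. m \<in> Hom M T E \<and> q 2 \<cdot> m = b \<and> q 4 \<cdot> m = k \<and> q 3 \<cdot> m = x"
      by (metis (no_types, lifting))
  qed
  with that show ?thesis by blast
qed

lemma initial_exists: obtains I where "is_initial M I"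
proof -
  have "finite_diagram M ({} :: nat set) (\<lambda>i. undefined) {}"
    by (simp add: finite_diagram_def)
  from CM1_colimits[OF this] obtain I q where "is_colimit M ({} :: nat set) (\<lambda>i. undefined) {} I q"
    by blast
  then have "is_initial M I"
    by (simp add: is_colimit_def is_cocone_def is_initial_def)
  with that show ?thesis .
qed

lemma initial_arrow: "is_initial M I \<Longrightarrow> X \<in> Ob M \<Longrightarrow> \<exists>!f. f \<in> Hom M I X"
  by (simp add: is_initial_def)

lemma terminal_arrow: "is_terminal M T \<Longrightarrow> X \<in> Ob M \<Longrightarrow> \<exists>!f. f \<in> Hom M X T"
  by (simp add: is_terminal_def)

lemma terminal_exists: obtains T where "is_terminal M T"
proof -
  have "finite_diagram M ({} :: nat set) (\<lambda>i. undefined) {}"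
    by (simp add: finite_diagram_def)
  from CM1_limits[OF this] obtain T q where "is_limit M ({} :: nat set) (\<lambda>i. undefined) {} T q"
    by blast
  then have "is_terminal M T"
    by (simp add: is_limit_def is_cone_def is_terminal_def)
  with that show ?thesis .
qed

section \<open>Lifting properties\<close>

text \<open>The retract argument: factor the map through the other class of the factorization system;
  the lift exhibits it as a retract of the good factor.\<close>

lemma cof_by_lifting:
  assumes i: "i \<in> Hom M A B"
    and lift: "\<And>E T p x y. \<lbrakk>p \<in> Hom M E T; p \<in> Fib M; p \<in> Weq M; x \<in> Hom M A E; y \<in> Hom M B T;
      p \<cdot> x = y \<cdot> i\<rbrakk> \<Longrightarrow> \<exists>l\<in>Hom M B E. l \<cdot> i = x \<and> p \<cdot> l = y"
  shows "i \<in> Cof M"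
proof -
  obtain Z k p where k: "k \<in> Hom M A Z" "p \<in> Hom M Z B" "i = p \<cdot> k" "k \<in> Cof M" "p \<in> Fib M" "p \<in> Weq M"
    using CM5_cof_tfib[OF i] by blast
  have "Id M B \<in> Hom M B B" using id_hom Hom_Ob[OF i] by blast
  moreover have "p \<cdot> k = Id M B \<cdot> i" using k i by simp
  ultimately obtain l where l: "l \<in> Hom M B Z" "l \<cdot> i = k" "p \<cdot> l = Id M B"
    using lift[OF k(2,5,6,1)] by blast
  have "is_retract M i k"
    unfolding is_retract_def
    using k l i Hom_Ob[OF i]
    by (intro exI[of _ "Id M A"] exI[of _ l] exI[of _ p]) auto
  then show ?thesis using CM3[of i k] i k by simp
qed

lemma tcof_by_lifting:
  assumes i: "i \<in> Hom M A B"
    and lift: "\<And>E T p x y. \<lbrakk>p \<in> Hom M E T; p \<in> Fib M; x \<in> Hom M A E; y \<in> Hom M B T;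
      p \<cdot> x = y \<cdot> i\<rbrakk> \<Longrightarrow> \<exists>l\<in>Hom M B E. l \<cdot> i = x \<and> p \<cdot> l = y"
  shows "i \<in> Cof M \<and> i \<in> Weq M"
proof -
  obtain Z k p where k: "k \<in> Hom M A Z" "p \<in> Hom M Z B" "i = p \<cdot> k" "k \<in> Cof M" "k \<in> Weq M" "p \<in> Fib M"
    using CM5_tcof_fib[OF i] by blast
  have "Id M B \<in> Hom M B B" using id_hom Hom_Ob[OF i] by blast
  moreover have "p \<cdot> k = Id M B \<cdot> i" using k i by simp
  ultimately obtain l where l: "l \<in> Hom M B Z" "l \<cdot> i = k" "p \<cdot> l = Id M B"
    using lift[OF k(2,6,1)] by blast
  have "is_retract M i k"
    unfolding is_retract_def
    using k l i Hom_Ob[OF i]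
    by (intro exI[of _ "Id M A"] exI[of _ l] exI[of _ p]) auto
  then show ?thesis using CM3[of i k] i k by simp
qed

lemma fib_by_lifting:
  assumes p: "p \<in> Hom M E T"
    and lift: "\<And>A B i x y. \<lbrakk>i \<in> Hom M A B; i \<in> Cof M; i \<in> Weq M; x \<in> Hom M A E; y \<in> Hom M B T;
      p \<cdot> x = y \<cdot> i\<rbrakk> \<Longrightarrow> \<exists>l\<in>Hom M B E. l \<cdot> i = x \<and> p \<cdot> l = y"
  shows "p \<in> Fib M"
proof -
  obtain Z k q where k: "k \<in> Hom M E Z" "q \<in> Hom M Z T" "p = q \<cdot> k" "k \<in> Cof M" "k \<in> Weq M" "q \<in> Fib M"
    using CM5_tcof_fib[OF p] by blast
  have "Id M E \<in> Hom M E E" using id_hom Hom_Ob[OF p] by blast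
  moreover have "p \<cdot> Id M E = q \<cdot> k" using k p by simp
  ultimately obtain l where l: "l \<in> Hom M Z E" "l \<cdot> k = Id M E" "p \<cdot> l = q"
    using lift[OF k(1,4,5) _ k(2)] by blast
  have "is_retract M p q"
    unfolding is_retract_def
    using k l p Hom_Ob[OF p]
    by (intro exI[of _ k] exI[of _ l] exI[of _ "Id M T"]) auto
  then show ?thesis using CM3[of p q] p k by simp
qed

lemma tfib_by_lifting:
  assumes p: "p \<in> Hom M E T"
    and lift: "\<And>A B i x y. \<lbrakk>i \<in> Hom M A B; i \<in> Cof M; x \<in> Hom M A E; y \<in> Hom M B T;
      p \<cdot> x = y \<cdot> i\<rbrakk> \<Longrightarrow> \<exists>l\<in>Hom M B E. l \<cdot> i = x \<and> p \<cdot> l = y"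
  shows "p \<in> Fib M \<and> p \<in> Weq M"
proof -
  obtain Z k q where k: "k \<in> Hom M E Z" "q \<in> Hom M Z T" "p = q \<cdot> k" "k \<in> Cof M" "q \<in> Fib M" "q \<in> Weq M"
    using CM5_cof_tfib[OF p] by blast
  have "Id M E \<in> Hom M E E" using id_hom Hom_Ob[OF p] by blast
  moreover have "p \<cdot> Id M E = q \<cdot> k" using k p by simp
  ultimately obtain l where l: "l \<in> Hom M Z E" "l \<cdot> k = Id M E" "p \<cdot> l = q"
    using lift[OF k(1,4) _ k(2)] by blast
  have "is_retract M p q"
    unfolding is_retract_def
    using k l p Hom_Ob[OF p]
    by (intro exI[of _ k] exI[of _ l] exI[of _ "Id M T"]) auto
  then show ?thesis using CM3[of p q] p k by simp
qed

lemma lift_tfib: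
  assumes "i \<in> Cof M" "p \<in> Fib M" "p \<in> Weq M"
    and "i \<in> Hom M A B" "p \<in> Hom M E T" "x \<in> Hom M A E" "y \<in> Hom M B T" "p \<cdot> x = y \<cdot> i"
  obtains l where "l \<in> Hom M B E" "l \<cdot> i = x" "p \<cdot> l = y"
  using CM4[OF assms(4-8)] assms that by blast

lemma lift_tcof:
  assumes "i \<in> Cof M" "i \<in> Weq M" "p \<in> Fib M"
    and "i \<in> Hom M A B" "p \<in> Hom M E T" "x \<in> Hom M A E" "y \<in> Hom M B T" "p \<cdot> x = y \<cdot> i"
  obtains l where "l \<in> Hom M B E" "l \<cdot> i = x" "p \<cdot> l = y"
  using CM4[OF assms(4-8)] assms that by blast

lemma id_weq: assumes "X \<in> Ob M" shows "Id M X \<in> Weq M" "Id M X \<in> Cof M"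
  using tcof_by_lifting[of "Id M X" X X] assms by auto

lemma weq_comp: "\<lbrakk>f \<in> Weq M; g \<in> Weq M; f \<in> Hom M X Y; g \<in> Hom M Y Z\<rbrakk> \<Longrightarrow> g \<cdot> f \<in> Weq M"
  and weq_right: "\<lbrakk>g \<in> Weq M; g \<cdot> f \<in> Weq M; f \<in> Hom M X Y; g \<in> Hom M Y Z\<rbrakk> \<Longrightarrow> f \<in> Weq M"
  and weq_left: "\<lbrakk>f \<in> Weq M; g \<cdot> f \<in> Weq M; f \<in> Hom M X Y; g \<in> Hom M Y Z\<rbrakk> \<Longrightarrow> g \<in> Weq M"
  using CM2 by blast+

subsection \<open>Cofibrant and fibrant objects\<close>

lemma cofibrant_Ob [simp]: "cofibrant M X \<Longrightarrow> X \<in> Ob M"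
  and fibrant_Ob [simp]: "fibrant M X \<Longrightarrow> X \<in> Ob M"
  using Hom_Ob by (fastforce simp: cofibrant_def fibrant_def)+

lemma bifibrantI: "cofibrant M X \<Longrightarrow> fibrant M X \<Longrightarrow> bifibrant M X"
  by (simp add: bifibrant_def)

lemma bifibrantD [simp]: "bifibrant M X \<Longrightarrow> cofibrant M X" "bifibrant M X \<Longrightarrow> fibrant M X"
  by (simp_all add: bifibrant_def)

text \<open>A map from the initial object to \<open>X\<close> is a cofibration exactly when \<open>X\<close> itself lifts against
  acyclic fibrations, since the condition on the initial object is vacuous. Cofibrancy and, dually,
  fibrancy are used below only in this form.\<close>

lemma cofibrant_lift:
  assumes X: "cofibrant M X" and p: "p \<in> Hom M E T" "p \<in> Fib M" "p \<in> Weq M" and y: "y \<in> Hom M X T"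
  obtains l where "l \<in> Hom M X E" "p \<cdot> l = y"
proof -
  obtain I i where I: "is_initial M I" "i \<in> Hom M I X" "i \<in> Cof M"
    using X by (auto simp: cofibrant_def)
  have "\<exists>!f. f \<in> Hom M I E" and u: "\<exists>!f. f \<in> Hom M I T"
    using initial_arrow[OF I(1)] Hom_Ob[OF p(1)] by blast+
  then obtain x where x: "x \<in> Hom M I E" by blast
  have "p \<cdot> x \<in> Hom M I T" "y \<cdot> i \<in> Hom M I T" using x p I y by simp_all
  then have "p \<cdot> x = y \<cdot> i" using u by blast
  from lift_tfib[OF I(3) p(2,3) I(2) p(1) x y this] that show ?thesis by blast
qed

lemma cofibrant_by_lifting:
  assumes X: "X \<in> Ob M"
    and lift: "\<And>E T p y. \<lbrakk>p \<in> Hom M E T; p \<in> Fib M; p \<in> Weq M; y \<in> Hom M X T\<rbrakk> \<Longrightarrow>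
      \<exists>l\<in>Hom M X E. p \<cdot> l = y"
  shows "cofibrant M X"
proof -
  obtain I where I: "is_initial M I" using initial_exists .
  then obtain i where i: "i \<in> Hom M I X" using initial_arrow[OF I X] by blast
  have "i \<in> Cof M"
  proof (rule cof_by_lifting[OF i])
    fix E T p x y assume p: "p \<in> Hom M E T" "p \<in> Fib M" "p \<in> Weq M"
      and x: "x \<in> Hom M I E" and y: "y \<in> Hom M X T"
    obtain l where l: "l \<in> Hom M X E" "p \<cdot> l = y" using lift[OF p y] by blast
    have "\<exists>!f. f \<in> Hom M I E" using initial_arrow[OF I] Hom_Ob[OF p(1)] by blast
    moreover have "l \<cdot> i \<in> Hom M I E" using l i by simp
    ultimately have "l \<cdot> i = x" using x by blast
    with l show "\<exists>l\<in>Hom M X E. l \<cdot> i = x \<and> p \<cdot> l = y" by blast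
  qed
  with I i show ?thesis unfolding cofibrant_def by blast
qed

lemma fibrant_extend:
  assumes X: "fibrant M X" and i: "i \<in> Hom M A B" "i \<in> Cof M" "i \<in> Weq M" and x: "x \<in> Hom M A X"
  obtains l where "l \<in> Hom M B X" "l \<cdot> i = x"
proof -
  obtain T t where T: "is_terminal M T" "t \<in> Hom M X T" "t \<in> Fib M"
    using X by (auto simp: fibrant_def)
  have "\<exists>!f. f \<in> Hom M B T" and u: "\<exists>!f. f \<in> Hom M A T"
    using terminal_arrow[OF T(1)] Hom_Ob[OF i(1)] by blast+
  then obtain y where y: "y \<in> Hom M B T" by blast
  have "t \<cdot> x \<in> Hom M A T" "y \<cdot> i \<in> Hom M A T" using x y i T by simp_all
  then have "t \<cdot> x = y \<cdot> i" using u by blast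
  from lift_tcof[OF i(2,3) T(3) i(1) T(2) x y this] that show ?thesis by blast
qed

lemma fibrant_by_extension:
  assumes X: "X \<in> Ob M"
    and ext: "\<And>A B i x. \<lbrakk>i \<in> Hom M A B; i \<in> Cof M; i \<in> Weq M; x \<in> Hom M A X\<rbrakk> \<Longrightarrow>
      \<exists>l\<in>Hom M B X. l \<cdot> i = x"
  shows "fibrant M X"
proof -
  obtain T where T: "is_terminal M T" using terminal_exists .
  then obtain t where t: "t \<in> Hom M X T" using terminal_arrow[OF T X] by blast
  have "t \<in> Fib M"
  proof (rule fib_by_lifting[OF t])
    fix A B i x y assume i: "i \<in> Hom M A B" "i \<in> Cof M" "i \<in> Weq M"
      and x: "x \<in> Hom M A X" and y: "y \<in> Hom M B T"
    obtain l where l: "l \<in> Hom M B X" "l \<cdot> i = x" using ext[OF i x] by blast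
    have "\<exists>!f. f \<in> Hom M B T" using terminal_arrow[OF T] Hom_Ob[OF i(1)] by blast
    moreover have "t \<cdot> l \<in> Hom M B T" using l t by simp
    ultimately have "t \<cdot> l = y" using y by blast
    with l show "\<exists>l\<in>Hom M B X. l \<cdot> i = x \<and> t \<cdot> l = y" by blast
  qed
  with T t show ?thesis unfolding fibrant_def by blast
qed

lemma cofibrant_cof:
  assumes "cofibrant M A" "i \<in> Hom M A B" "i \<in> Cof M"
  shows "cofibrant M B"
proof (rule cofibrant_by_lifting)
  show "B \<in> Ob M" using Hom_Ob[OF assms(2)] by simp
  fix E T p y assume p: "p \<in> Hom M E T" "p \<in> Fib M" "p \<in> Weq M" and y: "y \<in> Hom M B T"
  obtain x where x: "x \<in> Hom M A E" "p \<cdot> x = y \<cdot> i"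
    using cofibrant_lift[OF assms(1) p, of "y \<cdot> i"] y assms by auto
  from lift_tfib[OF assms(3) p(2,3) assms(2) p(1) x(1) y x(2)]
  show "\<exists>l\<in>Hom M B E. p \<cdot> l = y" by blast
qed

lemma fibrant_fib:
  assumes "fibrant M Y" "q \<in> Hom M X Y" "q \<in> Fib M"
  shows "fibrant M X"
proof (rule fibrant_by_extension)
  show "X \<in> Ob M" using Hom_Ob[OF assms(2)] by simp
  fix A B i x assume i: "i \<in> Hom M A B" "i \<in> Cof M" "i \<in> Weq M" and x: "x \<in> Hom M A X"
  obtain y where y: "y \<in> Hom M B Y" "y \<cdot> i = q \<cdot> x"
    using fibrant_extend[OF assms(1) i, of "q \<cdot> x"] x assms by auto
  from lift_tcof[OF i(2,3) assms(3) i(1) assms(2) x y(1) y(2)[symmetric]]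
  show "\<exists>l\<in>Hom M B X. l \<cdot> i = x" by blast
qed

text \<open>Factoring the map from the initial, or to the terminal, object through an acyclic fibration,
  or an acyclic cofibration, keeps the half of bifibrancy that the object already has.\<close>

lemma cofibrant_replacement:
  assumes "fibrant M X"
  obtains F q where "bifibrant M F" "q \<in> Hom M F X" "q \<in> Fib M" "q \<in> Weq M"
proof -
  obtain I where I: "is_initial M I" using initial_exists .
  then obtain i where i: "i \<in> Hom M I X" using initial_arrow[OF I fibrant_Ob[OF assms]] by blast
  obtain F k q where F: "k \<in> Hom M I F" "q \<in> Hom M F X" "k \<in> Cof M" "q \<in> Fib M" "q \<in> Weq M"
    using CM5_cof_tfib[OF i] by blast
  have "cofibrant M F" unfolding cofibrant_def using I F(1,3) by blast
  moreover have "fibrant M F" using fibrant_fib[OF assms F(2,4)] .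
  ultimately show ?thesis using that[OF bifibrantI F(2,4,5)] by blast
qed

lemma fibrant_replacement:
  assumes "cofibrant M X"
  obtains R i where "bifibrant M R" "i \<in> Hom M X R" "i \<in> Cof M" "i \<in> Weq M"
proof -
  obtain T where T: "is_terminal M T" using terminal_exists .
  then obtain t where t: "t \<in> Hom M X T" using terminal_arrow[OF T cofibrant_Ob[OF assms]] by blast
  obtain R k q where R: "k \<in> Hom M X R" "q \<in> Hom M R T" "k \<in> Cof M" "k \<in> Weq M" "q \<in> Fib M"
    using CM5_tcof_fib[OF t] by blast
  have "fibrant M R" unfolding fibrant_def using T R(2,5) by blast
  moreover have "cofibrant M R" using cofibrant_cof[OF assms R(1,3)] .
  ultimately show ?thesis using that[OF bifibrantI R(1,3,4)] by blast
qed

end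

context closed_model_category begin

section \<open>Cylinders and path objects\<close>

lemma cylinder_arr:
  assumes "is_cylinder M A c"
  shows "inc0 c \<in> Hom M A (cyl_ob M c)" "inc1 c \<in> Hom M A (cyl_ob M c)" "proj c \<in> Hom M (cyl_ob M c) A"
    and "proj c \<cdot> inc0 c = Id M A" "proj c \<cdot> inc1 c = Id M A"
  using assms by (simp_all add: is_cylinder_def)

lemma cylinder_exists:
  assumes "A \<in> Ob M"
  obtains c where "is_cylinder M A c"
proof -
  obtain Q a b where Q: "is_coproduct M A A Q a b" using coproduct_exists assms by blast
  then have "\<forall>T. \<forall>x\<in>Hom M A T. \<forall>y\<in>Hom M A T. \<exists>!m. m \<in> Hom M Q T \<and> m \<cdot> a = x \<and> m \<cdot> b = y"
    unfolding is_coproduct_def by blast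
  moreover have "Id M A \<in> Hom M A A" using id_hom[OF assms] .
  ultimately obtain m where m: "m \<in> Hom M Q A" "m \<cdot> a = Id M A" "m \<cdot> b = Id M A" by blast
  obtain K i p where K: "i \<in> Hom M Q K" "p \<in> Hom M K A" "m = p \<cdot> i" "i \<in> Cof M" "p \<in> Fib M" "p \<in> Weq M"
    using CM5_cof_tfib[OF m(1)] by blast
  have ab: "a \<in> Hom M A Q" "b \<in> Hom M A Q" using Q by (simp_all add: is_coproduct_def)
  have "is_cylinder M A \<lparr>inc0 = i \<cdot> a, inc1 = i \<cdot> b, proj = p\<rparr>"
    unfolding is_cylinder_def
    using K m ab Q assoc[of a i p] assoc[of b i p] by simp blast
  with that show ?thesis by blast
qed

text \<open>The two ends of a cylinder jointly form a cofibration, so maps out of it with prescribed ends lift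
  against acyclic fibrations. Dually, maps into a path object with prescribed ends extend along
  acyclic cofibrations (\<open>path_lift\<close>). Almost every homotopy below is built by one of these two
  principles.\<close>

lemma cylinder_lift:
  assumes c: "is_cylinder M A c" and q: "q \<in> Hom M K W" "q \<in> Fib M" "q \<in> Weq M"
    and k: "k0 \<in> Hom M A K" "k1 \<in> Hom M A K" and z: "z \<in> Hom M (cyl_ob M c) W"
    and e: "q \<cdot> k0 = z \<cdot> inc0 c" "q \<cdot> k1 = z \<cdot> inc1 c"
  obtains H where "H \<in> Hom M (cyl_ob M c) K" "H \<cdot> inc0 c = k0" "H \<cdot> inc1 c = k1" "q \<cdot> H = z"
proof -
  obtain Q a b m where Q: "is_coproduct M A A Q a b" "m \<in> Hom M Q (cyl_ob M c)"
      "m \<cdot> a = inc0 c" "m \<cdot> b = inc1 c" "m \<in> Cof M"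
    using c unfolding is_cylinder_def by blast
  have ab: "a \<in> Hom M A Q" "b \<in> Hom M A Q" using Q(1) by (simp_all add: is_coproduct_def)
  obtain n where n: "n \<in> Hom M Q K" "n \<cdot> a = k0" "n \<cdot> b = k1"
    using Q(1) k unfolding is_coproduct_def by blast
  have "\<forall>x\<in>Hom M A W. \<forall>y\<in>Hom M A W. \<exists>!m. m \<in> Hom M Q W \<and> m \<cdot> a = x \<and> m \<cdot> b = y"
    using Q(1) unfolding is_coproduct_def by blast
  moreover have "q \<cdot> k0 \<in> Hom M A W" "q \<cdot> k1 \<in> Hom M A W" using q k by simp_all
  ultimately have "\<exists>!m. m \<in> Hom M Q W \<and> m \<cdot> a = q \<cdot> k0 \<and> m \<cdot> b = q \<cdot> k1" by blast
  moreover have "q \<cdot> n \<in> Hom M Q W \<and> (q \<cdot> n) \<cdot> a = q \<cdot> k0 \<and> (q \<cdot> n) \<cdot> b = q \<cdot> k1"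
    using q n ab by simp
  moreover have "z \<cdot> m \<in> Hom M Q W \<and> (z \<cdot> m) \<cdot> a = q \<cdot> k0 \<and> (z \<cdot> m) \<cdot> b = q \<cdot> k1"
    using q z Q ab e by simp
  ultimately have "q \<cdot> n = z \<cdot> m" by blast
  from lift_tfib[OF Q(5) q(2,3) Q(2) q(1) n(1) z this]
  obtain l where l: "l \<in> Hom M (cyl_ob M c) K" "l \<cdot> m = n" "q \<cdot> l = z" by blast
  have "l \<cdot> inc0 c = k0" "l \<cdot> inc1 c = k1"
    using assoc[of a m l] assoc[of b m l] l Q n ab by auto
  with l that show ?thesis by blast
qed

lemma inc_tcof:
  assumes A: "cofibrant M A" and c: "is_cylinder M A c"
  shows "inc0 c \<in> Cof M" "inc0 c \<in> Weq M" "inc1 c \<in> Cof M" "inc1 c \<in> Weq M"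
proof -
  note ca = cylinder_arr[OF c]
  have w: "proj c \<in> Weq M" using c by (simp add: is_cylinder_def)
  have i: "Id M A \<in> Weq M" using id_weq A by simp
  show "inc0 c \<in> Weq M" "inc1 c \<in> Weq M"
    using weq_right[OF w _ ca(1,3)] weq_right[OF w _ ca(2,3)] ca i by auto
  show "inc0 c \<in> Cof M"
  proof (rule cof_by_lifting[OF ca(1)])
    fix E T p x y assume p: "p \<in> Hom M E T" "p \<in> Fib M" "p \<in> Weq M"
      and x: "x \<in> Hom M A E" and y: "y \<in> Hom M (cyl_ob M c) T" and e: "p \<cdot> x = y \<cdot> inc0 c"
    obtain x' where "x' \<in> Hom M A E" "p \<cdot> x' = y \<cdot> inc1 c"
      using cofibrant_lift[OF A p, of "y \<cdot> inc1 c"] y ca by auto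
    with cylinder_lift[OF c p x _ y e]
    show "\<exists>l\<in>Hom M (cyl_ob M c) E. l \<cdot> inc0 c = x \<and> p \<cdot> l = y" by metis
  qed
  show "inc1 c \<in> Cof M"
  proof (rule cof_by_lifting[OF ca(2)])
    fix E T p x y assume p: "p \<in> Hom M E T" "p \<in> Fib M" "p \<in> Weq M"
      and x: "x \<in> Hom M A E" and y: "y \<in> Hom M (cyl_ob M c) T" and e: "p \<cdot> x = y \<cdot> inc1 c"
    obtain x' where "x' \<in> Hom M A E" "p \<cdot> x' = y \<cdot> inc0 c"
      using cofibrant_lift[OF A p, of "y \<cdot> inc0 c"] y ca by auto
    with cylinder_lift[OF c p _ x y _ e]
    show "\<exists>l\<in>Hom M (cyl_ob M c) E. l \<cdot> inc1 c = x \<and> p \<cdot> l = y" by metis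
  qed
qed

lemma path_ob_exists:
  assumes "B \<in> Ob M"
  obtains p where "is_path_ob M B p"
proof -
  obtain Q a b where Q: "is_product M B B Q a b" using product_exists assms by blast
  then have "\<forall>T. \<forall>x\<in>Hom M T B. \<forall>y\<in>Hom M T B. \<exists>!m. m \<in> Hom M T Q \<and> a \<cdot> m = x \<and> b \<cdot> m = y"
    unfolding is_product_def by blast
  moreover have "Id M B \<in> Hom M B B" using id_hom[OF assms] .
  ultimately obtain m where m: "m \<in> Hom M B Q" "a \<cdot> m = Id M B" "b \<cdot> m = Id M B" by blast
  obtain K i p where K: "i \<in> Hom M B K" "p \<in> Hom M K Q" "m = p \<cdot> i" "i \<in> Cof M" "i \<in> Weq M" "p \<in> Fib M"
    using CM5_tcof_fib[OF m(1)] by blast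
  have ab: "a \<in> Hom M Q B" "b \<in> Hom M Q B" using Q by (simp_all add: is_product_def)
  have "is_path_ob M B \<lparr>cnst = i, ev0 = a \<cdot> p, ev1 = b \<cdot> p\<rparr>"
    unfolding is_path_ob_def
    using K m ab Q assoc[of i p a] assoc[of i p b] by simp blast
  with that show ?thesis by blast
qed

text \<open>Fixing one path object for each object makes two-cells into classes of honest maps.\<close>

definition path_object where "path_object Y = (SOME p. is_path_ob M Y p)"
definition paths where "paths Y = path_space M (path_object Y)"
definition const_path where "const_path Y = cnst (path_object Y)"
definition start where "start Y = ev0 (path_object Y)"
definition finish where "finish Y = ev1 (path_object Y)"

lemma path_object: "Y \<in> Ob M \<Longrightarrow> is_path_ob M Y (path_object Y)"
  unfolding path_object_def using path_ob_exists by (metis someI_ex)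

lemma path_arr [simp]:
  assumes "Y \<in> Ob M"
  shows "const_path Y \<in> Arr M" "Dom M (const_path Y) = Y" "Cod M (const_path Y) = paths Y"
    and "start Y \<in> Arr M" "Dom M (start Y) = paths Y" "Cod M (start Y) = Y"
    and "finish Y \<in> Arr M" "Dom M (finish Y) = paths Y" "Cod M (finish Y) = Y"
    and "start Y \<cdot> const_path Y = Id M Y" "finish Y \<cdot> const_path Y = Id M Y"
    and "const_path Y \<in> Cof M" "const_path Y \<in> Weq M"
  using path_object[OF assms]
  by (simp_all add: is_path_ob_def const_path_def start_def finish_def paths_def)

lemma ev_const [simp]:
  assumes "f \<in> Arr M" "Cod M f = Y"
  shows "start Y \<cdot> (const_path Y \<cdot> f) = f" "finish Y \<cdot> (const_path Y \<cdot> f) = f"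
  using assms Ob_Cod[OF assms(1)]
    assoc[of f "const_path Y" "start Y"] assoc[of f "const_path Y" "finish Y"] by simp_all

lemma path_lift:
  assumes Y: "Y \<in> Ob M" and i: "i \<in> Hom M U W" "i \<in> Cof M" "i \<in> Weq M"
    and k: "k \<in> Hom M U (paths Y)" and y: "y0 \<in> Hom M W Y" "y1 \<in> Hom M W Y"
    and e: "start Y \<cdot> k = y0 \<cdot> i" "finish Y \<cdot> k = y1 \<cdot> i"
  obtains L where "L \<in> Hom M W (paths Y)" "L \<cdot> i = k" "start Y \<cdot> L = y0" "finish Y \<cdot> L = y1"
proof -
  obtain Q a b m where Q: "is_product M Y Y Q a b" "m \<in> Hom M (paths Y) Q"
      "a \<cdot> m = start Y" "b \<cdot> m = finish Y" "m \<in> Fib M"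
    using path_object[OF Y] unfolding is_path_ob_def start_def finish_def paths_def by blast
  have ab: "a \<in> Hom M Q Y" "b \<in> Hom M Q Y" using Q(1) by (simp_all add: is_product_def)
  obtain n where n: "n \<in> Hom M W Q" "a \<cdot> n = y0" "b \<cdot> n = y1"
    using Q(1) y unfolding is_product_def by blast
  have "\<forall>x\<in>Hom M U Y. \<forall>y\<in>Hom M U Y. \<exists>!m. m \<in> Hom M U Q \<and> a \<cdot> m = x \<and> b \<cdot> m = y"
    using Q(1) unfolding is_product_def by blast
  moreover have "start Y \<cdot> k \<in> Hom M U Y" "finish Y \<cdot> k \<in> Hom M U Y" using Y k by simp_all
  ultimately have "\<exists>!m. m \<in> Hom M U Q \<and> a \<cdot> m = start Y \<cdot> k \<and> b \<cdot> m = finish Y \<cdot> k" by blast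
  moreover have "n \<cdot> i \<in> Hom M U Q \<and> a \<cdot> (n \<cdot> i) = start Y \<cdot> k \<and> b \<cdot> (n \<cdot> i) = finish Y \<cdot> k"
    using i n ab e assoc[of i n a] assoc[of i n b] by simp
  moreover have "m \<cdot> k \<in> Hom M U Q \<and> a \<cdot> (m \<cdot> k) = start Y \<cdot> k \<and> b \<cdot> (m \<cdot> k) = finish Y \<cdot> k"
    using k Q ab assoc[of k m a] assoc[of k m b] by simp
  ultimately have "m \<cdot> k = n \<cdot> i" by blast
  from lift_tcof[OF i(2,3) Q(5) i(1) Q(2) k n(1) this]
  obtain l where l: "l \<in> Hom M W (paths Y)" "l \<cdot> i = k" "m \<cdot> l = n" by blast
  have "start Y \<cdot> l = y0" "finish Y \<cdot> l = y1"
    using assoc[of l m a] assoc[of l m b] l Q n ab by auto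
  with l that show ?thesis by blast
qed

lemma ev_tfib:
  assumes Y: "fibrant M Y"
  shows "start Y \<in> Fib M" "start Y \<in> Weq M" "finish Y \<in> Fib M" "finish Y \<in> Weq M"
proof -
  have Y': "Y \<in> Ob M" using Y by simp
  have i: "Id M Y \<in> Weq M" using id_weq Y' by simp
  show "start Y \<in> Weq M" "finish Y \<in> Weq M"
    using weq_left[of "const_path Y" "start Y" Y "paths Y" Y]
      weq_left[of "const_path Y" "finish Y" Y "paths Y" Y] i Y' by simp_all
  show "start Y \<in> Fib M"
  proof (rule fib_by_lifting[of _ "paths Y" Y])
    show "start Y \<in> Hom M (paths Y) Y" using Y' by simp
    fix A B i x y assume i: "i \<in> Hom M A B" "i \<in> Cof M" "i \<in> Weq M"
      and x: "x \<in> Hom M A (paths Y)" and y: "y \<in> Hom M B Y" and e: "start Y \<cdot> x = y \<cdot> i"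
    obtain y' where y': "y' \<in> Hom M B Y" "y' \<cdot> i = finish Y \<cdot> x"
      using fibrant_extend[OF Y i, of "finish Y \<cdot> x"] x Y' by auto
    from path_lift[OF Y' i x y y'(1) e y'(2)[symmetric]]
    show "\<exists>l\<in>Hom M B (paths Y). l \<cdot> i = x \<and> start Y \<cdot> l = y" by metis
  qed
  show "finish Y \<in> Fib M"
  proof (rule fib_by_lifting[of _ "paths Y" Y])
    show "finish Y \<in> Hom M (paths Y) Y" using Y' by simp
    fix A B i x y assume i: "i \<in> Hom M A B" "i \<in> Cof M" "i \<in> Weq M"
      and x: "x \<in> Hom M A (paths Y)" and y: "y \<in> Hom M B Y" and e: "finish Y \<cdot> x = y \<cdot> i"
    obtain y' where y': "y' \<in> Hom M B Y" "y' \<cdot> i = start Y \<cdot> x"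
      using fibrant_extend[OF Y i, of "start Y \<cdot> x"] x Y' by auto
    from path_lift[OF Y' i x y'(1) y y'(2)[symmetric] e]
    show "\<exists>l\<in>Hom M B (paths Y). l \<cdot> i = x \<and> finish Y \<cdot> l = y" by metis
  qed
qed

lemma paths_cofibrant [simp]: "cofibrant M Y \<Longrightarrow> cofibrant M (paths Y)"
  using cofibrant_cof[of Y "const_path Y" "paths Y"] by simp

subsection \<open>Double mapping cylinders\<close>

lemma double_cylinder_arr:
  assumes "double_cylinder M c f g Z zb zi zc" "f \<in> Hom M A B" "g \<in> Hom M A C"
  shows "zb \<in> Hom M B Z" "zi \<in> Hom M (cyl_ob M c) Z" "zc \<in> Hom M C Z"
    and "zi \<cdot> inc0 c = zb \<cdot> f" "zi \<cdot> inc1 c = zc \<cdot> g"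
  using assms by (simp_all add: double_cylinder_def)

lemma double_cylinder_map:
  assumes "double_cylinder M c f g Z zb zi zc" "f \<in> Hom M A B" "g \<in> Hom M A C"
    and "b \<in> Hom M B T" "i \<in> Hom M (cyl_ob M c) T" "x \<in> Hom M C T"
    and "i \<cdot> inc0 c = b \<cdot> f" "i \<cdot> inc1 c = x \<cdot> g"
  obtains m where "m \<in> Hom M Z T" "m \<cdot> zb = b" "m \<cdot> zi = i" "m \<cdot> zc = x"
proof -
  have "\<forall>T. \<forall>b \<in> Hom M B T. \<forall>i \<in> Hom M (cyl_ob M c) T. \<forall>x \<in> Hom M C T.
        i \<cdot> inc0 c = b \<cdot> f \<and> i \<cdot> inc1 c = x \<cdot> g \<longrightarrow>
        (\<exists>!m. m \<in> Hom M Z T \<and> m \<cdot> zb = b \<and> m \<cdot> zi = i \<and> m \<cdot> zc = x)"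
    using assms(1-3) by (simp add: double_cylinder_def)
  then show ?thesis using assms(4-) that by blast
qed

lemma double_cylinder_unique:
  assumes "double_cylinder M c f g Z zb zi zc" "is_cylinder M A c" "f \<in> Hom M A B" "g \<in> Hom M A C"
    and "m \<in> Hom M Z T" "m' \<in> Hom M Z T"
    and "m \<cdot> zb = m' \<cdot> zb" "m \<cdot> zi = m' \<cdot> zi" "m \<cdot> zc = m' \<cdot> zc"
  shows "m = m'"
proof -
  note a = double_cylinder_arr[OF assms(1,3,4)] cylinder_arr[OF assms(2)]
  have u: "\<forall>T. \<forall>b \<in> Hom M B T. \<forall>i \<in> Hom M (cyl_ob M c) T. \<forall>x \<in> Hom M C T.
        i \<cdot> inc0 c = b \<cdot> f \<and> i \<cdot> inc1 c = x \<cdot> g \<longrightarrow>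
        (\<exists>!m. m \<in> Hom M Z T \<and> m \<cdot> zb = b \<and> m \<cdot> zi = i \<and> m \<cdot> zc = x)"
    using assms(1,3,4) by (simp add: double_cylinder_def)
  have "m \<cdot> zb \<in> Hom M B T" "m \<cdot> zi \<in> Hom M (cyl_ob M c) T" "m \<cdot> zc \<in> Hom M C T"
    "(m \<cdot> zi) \<cdot> inc0 c = (m \<cdot> zb) \<cdot> f" "(m \<cdot> zi) \<cdot> inc1 c = (m \<cdot> zc) \<cdot> g"
    using a assms by simp_all
  then have "\<exists>!n. n \<in> Hom M Z T \<and> n \<cdot> zb = m \<cdot> zb \<and> n \<cdot> zi = m \<cdot> zi \<and> n \<cdot> zc = m \<cdot> zc"
    using u by blast
  then show ?thesis using assms by metis
qed

text \<open>A lifting problem for the double mapping cylinder is solved on its pieces: first on the two ends,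
  then on the cylinder between them.\<close>

lemma double_cylinder_cofibrant:
  assumes Z: "double_cylinder M c f g Z zb zi zc" and c: "is_cylinder M A c"
    and f: "f \<in> Hom M A B" and g: "g \<in> Hom M A C" and B: "cofibrant M B" and C: "cofibrant M C"
  shows "cofibrant M Z"
proof (rule cofibrant_by_lifting)
  note a = double_cylinder_arr[OF Z f g] cylinder_arr[OF c]
  show "Z \<in> Ob M" using Hom_Ob[OF a(1)] by simp
  fix E T p y assume p: "p \<in> Hom M E T" "p \<in> Fib M" "p \<in> Weq M" and y: "y \<in> Hom M Z T"
  obtain b where b: "b \<in> Hom M B E" "p \<cdot> b = y \<cdot> zb"
    using cofibrant_lift[OF B p, of "y \<cdot> zb"] y a by auto
  obtain x where x: "x \<in> Hom M C E" "p \<cdot> x = y \<cdot> zc"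
    using cofibrant_lift[OF C p, of "y \<cdot> zc"] y a by auto
  have "p \<cdot> (b \<cdot> f) = (y \<cdot> zi) \<cdot> inc0 c" "p \<cdot> (x \<cdot> g) = (y \<cdot> zi) \<cdot> inc1 c"
    using comp_cong[OF b(2)] comp_cong[OF x(2)] b x y a f g p by simp_all
  then obtain i where i: "i \<in> Hom M (cyl_ob M c) E" "i \<cdot> inc0 c = b \<cdot> f" "i \<cdot> inc1 c = x \<cdot> g" "p \<cdot> i = y \<cdot> zi"
    using cylinder_lift[OF c p, of "b \<cdot> f" "x \<cdot> g" "y \<cdot> zi"] b x f g a y by auto
  obtain m where m: "m \<in> Hom M Z E" "m \<cdot> zb = b" "m \<cdot> zi = i" "m \<cdot> zc = x"
    using double_cylinder_map[OF Z f g b(1) i(1) x(1) i(2,3)] .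
  have "p \<cdot> m = y"
    using double_cylinder_unique[OF Z c f g, of "p \<cdot> m" T y] m b i x a y p by simp
  with m show "\<exists>l\<in>Hom M Z E. p \<cdot> l = y" by blast
qed

text \<open>If one leg is an acyclic cofibration, a lift given on the other end extends first over the
  cylinder, whose inclusion of an end is acyclic, and then along that leg.\<close>

lemma double_cylinder_tcof:
  assumes Z: "double_cylinder M c f g Z zb zi zc" and c: "is_cylinder M A c" and A: "cofibrant M A"
    and f: "f \<in> Hom M A B" and g: "g \<in> Hom M A C" "g \<in> Cof M" "g \<in> Weq M"
  shows "zb \<in> Cof M \<and> zb \<in> Weq M"
proof (rule tcof_by_lifting)
  note a = double_cylinder_arr[OF Z f g(1)] cylinder_arr[OF c]
  show "zb \<in> Hom M B Z" by (fact a)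
  fix E T p x y assume p: "p \<in> Hom M E T" "p \<in> Fib M"
    and x: "x \<in> Hom M B E" and y: "y \<in> Hom M Z T" and e: "p \<cdot> x = y \<cdot> zb"
  have "p \<cdot> (x \<cdot> f) = (y \<cdot> zi) \<cdot> inc0 c"
    using comp_cong[OF e] x y a f p by simp
  then obtain i where i: "i \<in> Hom M (cyl_ob M c) E" "i \<cdot> inc0 c = x \<cdot> f" "p \<cdot> i = y \<cdot> zi"
    using lift_tcof[OF inc_tcof(1,2)[OF A c] p(2) a(6) p(1), of "x \<cdot> f" "y \<cdot> zi"] x y f a by auto
  have "p \<cdot> (i \<cdot> inc1 c) = (y \<cdot> zc) \<cdot> g"
    using comp_cong[OF i(3)] i y a g p by simp
  then obtain x' where x': "x' \<in> Hom M C E" "x' \<cdot> g = i \<cdot> inc1 c" "p \<cdot> x' = y \<cdot> zc"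
    using lift_tcof[OF g(2,3) p(2) g(1) p(1), of "i \<cdot> inc1 c" "y \<cdot> zc"] i y a by auto
  obtain m where m: "m \<in> Hom M Z E" "m \<cdot> zb = x" "m \<cdot> zi = i" "m \<cdot> zc = x'"
    using double_cylinder_map[OF Z f g(1) x i(1) x'(1) i(2) x'(2)[symmetric]] .
  have "p \<cdot> m = y"
    using double_cylinder_unique[OF Z c f g(1), of "p \<cdot> m" T y] m e i x' a y p by simp
  with m show "\<exists>l\<in>Hom M Z E. l \<cdot> zb = x \<and> p \<cdot> l = y" by blast
qed

section \<open>Vertical homotopies of paths\<close>

text \<open>Homotopy, relative to the ends, between two paths in \<open>Y\<close> parametrized by \<open>A\<close>.\<close>

definition vertical where
  "vertical Y k k' \<longleftrightarrow> (\<exists>A c V. cofibrant M A \<and> is_cylinder M A c \<and>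
     k \<in> Hom M A (paths Y) \<and> k' \<in> Hom M A (paths Y) \<and> V \<in> Hom M (cyl_ob M c) (paths Y) \<and>
     V \<cdot> inc0 c = k \<and> V \<cdot> inc1 c = k' \<and>
     start Y \<cdot> V = (start Y \<cdot> k) \<cdot> proj c \<and> finish Y \<cdot> V = (finish Y \<cdot> k) \<cdot> proj c)"

text \<open>Since \<open>s\<close> is a weak equivalence, so is its retraction \<open>r\<close>. Factoring \<open>r\<close> as a cofibration
  followed by an acyclic fibration, the family of paths \<open>N\<close> extends along the now acyclic cofibration,
  and any two points of \<open>Z\<close> over the same point of \<open>W\<close> are joined along the acyclic fibration. This
  turns data given on a glued object, such as a double mapping cylinder, into homotopies.\<close>

lemma section_homotopy:
  assumes Y: "Y \<in> Ob M" and s: "s \<in> Hom M W Z" "s \<in> Weq M" and r: "r \<in> Hom M Z W" "r \<cdot> s = Id M W"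
    and N: "N \<in> Hom M Z (paths Y)" and y: "y0 \<in> Hom M W Y" "y1 \<in> Hom M W Y"
    and e: "start Y \<cdot> N = y0 \<cdot> r" "finish Y \<cdot> N = y1 \<cdot> r"
    and c: "is_cylinder M A c" and b: "b0 \<in> Hom M A Z" "b1 \<in> Hom M A Z"
    and z: "z \<in> Hom M (cyl_ob M c) W" "r \<cdot> b0 = z \<cdot> inc0 c" "r \<cdot> b1 = z \<cdot> inc1 c"
  obtains H where "H \<in> Hom M (cyl_ob M c) (paths Y)" "H \<cdot> inc0 c = N \<cdot> b0" "H \<cdot> inc1 c = N \<cdot> b1"
    "start Y \<cdot> H = y0 \<cdot> z" "finish Y \<cdot> H = y1 \<cdot> z"
proof -
  note ca = cylinder_arr[OF c]
  obtain K i q where K: "i \<in> Hom M Z K" "q \<in> Hom M K W" "r = q \<cdot> i" "i \<in> Cof M" "q \<in> Fib M" "q \<in> Weq M"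
    using CM5_cof_tfib[OF r(1)] by blast
  have "r \<in> Weq M"
    using weq_left[OF s(2) _ s(1) r(1)] r id_weq Hom_Ob[OF s(1)] by simp
  then have iw: "i \<in> Weq M" using weq_right[OF K(6) _ K(1,2)] K by simp
  obtain N' where N': "N' \<in> Hom M K (paths Y)" "N' \<cdot> i = N" "start Y \<cdot> N' = y0 \<cdot> q" "finish Y \<cdot> N' = y1 \<cdot> q"
    using path_lift[OF Y K(1,4) iw N, of "y0 \<cdot> q" "y1 \<cdot> q"] y K e by auto
  obtain H where H: "H \<in> Hom M (cyl_ob M c) K" "H \<cdot> inc0 c = i \<cdot> b0" "H \<cdot> inc1 c = i \<cdot> b1" "q \<cdot> H = z"
    using cylinder_lift[OF c K(2,5,6) _ _ z(1), of "i \<cdot> b0" "i \<cdot> b1"] K b z by auto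
  show ?thesis
  proof (rule that[of "N' \<cdot> H"])
    show "N' \<cdot> H \<in> Hom M (cyl_ob M c) (paths Y)" using N' H by simp
    show "(N' \<cdot> H) \<cdot> inc0 c = N \<cdot> b0" "(N' \<cdot> H) \<cdot> inc1 c = N \<cdot> b1"
      using N' H ca K b comp_cong[OF N'(2)] by simp_all
    show "start Y \<cdot> (N' \<cdot> H) = y0 \<cdot> z" "finish Y \<cdot> (N' \<cdot> H) = y1 \<cdot> z"
      using N' H K Y y comp_cong[OF N'(3)] comp_cong[OF N'(4)] by simp_all
  qed
qed

text \<open>Vertical homotopies extend along acyclic cofibrations: glue \<open>m\<close>, the given homotopy and \<open>m'\<close>
  on the double mapping cylinder of \<open>i\<close> with itself, which retracts to \<open>Q\<close> by a weak equivalence,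
  and join its two ends.\<close>

lemma vertical_extend:
  assumes Y: "Y \<in> Ob M" and A: "cofibrant M A" and i: "i \<in> Hom M A Q" "i \<in> Cof M" "i \<in> Weq M"
    and m: "m \<in> Hom M Q (paths Y)" "m' \<in> Hom M Q (paths Y)"
    and e: "start Y \<cdot> m = start Y \<cdot> m'" "finish Y \<cdot> m = finish Y \<cdot> m'"
    and v: "vertical Y (m \<cdot> i) (m' \<cdot> i)"
  shows "vertical Y m m'"
proof -
  have Q: "cofibrant M Q" using cofibrant_cof[OF A i(1,2)] .
  obtain A' c V where V: "is_cylinder M A' c" "m \<cdot> i \<in> Hom M A' (paths Y)"
      "V \<in> Hom M (cyl_ob M c) (paths Y)" "V \<cdot> inc0 c = m \<cdot> i" "V \<cdot> inc1 c = m' \<cdot> i"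
      "start Y \<cdot> V = (start Y \<cdot> (m \<cdot> i)) \<cdot> proj c" "finish Y \<cdot> V = (finish Y \<cdot> (m \<cdot> i)) \<cdot> proj c"
    using v unfolding vertical_def by auto
  have [simp]: "A' = A" using V(2) m i by simp
  have c: "is_cylinder M A c" using V(1) by simp
  note ca = cylinder_arr[OF c]
  obtain Z zb zi zc where Z: "double_cylinder M c i i Z zb zi zc"
    using double_cylinder_exists[OF i(1) i(1) c] .
  note za = double_cylinder_arr[OF Z i(1) i(1)]
  have zb: "zb \<in> Weq M" using double_cylinder_tcof[OF Z c A i(1) i] by simp
  have idQ: "Id M Q \<in> Hom M Q Q" using id_hom Q by simp
  obtain r where r: "r \<in> Hom M Z Q" "r \<cdot> zb = Id M Q" "r \<cdot> zi = i \<cdot> proj c" "r \<cdot> zc = Id M Q"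
    by (rule double_cylinder_map[OF Z i(1) i(1) idQ _ idQ, of "i \<cdot> proj c"]) (use i ca Q in simp_all)
  obtain N where N: "N \<in> Hom M Z (paths Y)" "N \<cdot> zb = m" "N \<cdot> zi = V" "N \<cdot> zc = m'"
    using double_cylinder_map[OF Z i(1) i(1) m(1) V(3) m(2) V(4,5)] .
  have y: "start Y \<cdot> m \<in> Hom M Q Y" "finish Y \<cdot> m \<in> Hom M Q Y" using m Y by simp_all
  have e0: "start Y \<cdot> N = (start Y \<cdot> m) \<cdot> r"
    by (rule double_cylinder_unique[OF Z c i(1) i(1)])
      (use N r za m e comp_cong[OF e(1)] comp_cong[OF e(2)] V i ca Y in simp_all)
  have e1: "finish Y \<cdot> N = (finish Y \<cdot> m) \<cdot> r"
    by (rule double_cylinder_unique[OF Z c i(1) i(1)])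
      (use N r za m e comp_cong[OF e(1)] comp_cong[OF e(2)] V i ca Y in simp_all)
  obtain c' where c': "is_cylinder M Q c'" using cylinder_exists cofibrant_Ob[OF Q] by blast
  note ca' = cylinder_arr[OF c']
  obtain H where H: "H \<in> Hom M (cyl_ob M c') (paths Y)" "H \<cdot> inc0 c' = N \<cdot> zb" "H \<cdot> inc1 c' = N \<cdot> zc"
    "start Y \<cdot> H = (start Y \<cdot> m) \<cdot> proj c'" "finish Y \<cdot> H = (finish Y \<cdot> m) \<cdot> proj c'"
    by (rule section_homotopy[OF Y za(1) zb r(1,2) N(1) y e0 e1 c' za(1,3) ca'(3)])
      (use r ca' in simp_all)
  then show ?thesis unfolding vertical_def using Q c' m N by blast
qed

lemma vertical_refl:
  assumes "cofibrant M A" "Y \<in> Ob M" "k \<in> Hom M A (paths Y)"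
  shows "vertical Y k k"
proof -
  obtain c where c: "is_cylinder M A c" using cylinder_exists cofibrant_Ob[OF assms(1)] by blast
  note ca = cylinder_arr[OF c]
  show ?thesis unfolding vertical_def
    by (rule exI[of _ A], rule exI[of _ c], rule exI[of _ "k \<cdot> proj c"]) (use assms ca c in simp)
qed

lemma vertical_ends:
  assumes "vertical Y k k'" "Y \<in> Ob M"
  shows "start Y \<cdot> k = start Y \<cdot> k'" "finish Y \<cdot> k = finish Y \<cdot> k'"
proof -
  obtain A c V where V: "cofibrant M A" "is_cylinder M A c" "k \<in> Hom M A (paths Y)" "k' \<in> Hom M A (paths Y)"
      "V \<in> Hom M (cyl_ob M c) (paths Y)" "V \<cdot> inc0 c = k" "V \<cdot> inc1 c = k'"
      "start Y \<cdot> V = (start Y \<cdot> k) \<cdot> proj c" "finish Y \<cdot> V = (finish Y \<cdot> k) \<cdot> proj c"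
    using assms(1) unfolding vertical_def by blast
  note ca = cylinder_arr[OF V(2)]
  show "start Y \<cdot> k = start Y \<cdot> k'" "finish Y \<cdot> k = finish Y \<cdot> k'"
    using comp_cong[OF V(8), of "inc1 c"] comp_cong[OF V(9), of "inc1 c"] V ca assms(2) by simp_all
qed

lemma vertical_sym:
  assumes v: "vertical Y k k'" and Y: "Y \<in> Ob M"
  shows "vertical Y k' k"
proof -
  obtain A c V where V: "cofibrant M A" "is_cylinder M A c" "k \<in> Hom M A (paths Y)" "k' \<in> Hom M A (paths Y)"
      "V \<in> Hom M (cyl_ob M c) (paths Y)" "V \<cdot> inc0 c = k" "V \<cdot> inc1 c = k'"
      "start Y \<cdot> V = (start Y \<cdot> k) \<cdot> proj c" "finish Y \<cdot> V = (finish Y \<cdot> k) \<cdot> proj c"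
    using v unfolding vertical_def by blast
  note ca = cylinder_arr[OF V(2)]
  have p: "proj c \<in> Fib M" "proj c \<in> Weq M" using V(2) by (simp_all add: is_cylinder_def)
  obtain H where H: "H \<in> Hom M (cyl_ob M c) (cyl_ob M c)" "H \<cdot> inc0 c = inc1 c" "H \<cdot> inc1 c = inc0 c"
      "proj c \<cdot> H = proj c"
    by (rule cylinder_lift[OF V(2) ca(3) p ca(2,1,3)]) (use ca in simp_all)
  show ?thesis unfolding vertical_def
    by (rule exI[of _ A], rule exI[of _ c], rule exI[of _ "V \<cdot> H"])
      (use V H ca Y vertical_ends[OF v Y] comp_cong[OF V(8)] comp_cong[OF V(9)] in simp)
qed

lemma cylinder_map:
  assumes c: "is_cylinder M A c" and c': "is_cylinder M A' c'" and a: "a \<in> Hom M A' A"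
  obtains l where "l \<in> Hom M (cyl_ob M c') (cyl_ob M c)" "l \<cdot> inc0 c' = inc0 c \<cdot> a"
    "l \<cdot> inc1 c' = inc1 c \<cdot> a" "proj c \<cdot> l = a \<cdot> proj c'"
proof -
  note ca = cylinder_arr[OF c] cylinder_arr[OF c']
  have p: "proj c \<in> Fib M" "proj c \<in> Weq M" using c by (simp_all add: is_cylinder_def)
  show ?thesis
    by (rule cylinder_lift[OF c' ca(3) p, of "inc0 c \<cdot> a" "inc1 c \<cdot> a" "a \<cdot> proj c'"])
      (use ca a that comp_cong[OF ca(4)] comp_cong[OF ca(5)] in simp_all)
qed

lemma vertical_precomp_on:
  assumes v: "vertical Y k k'" and Y: "Y \<in> Ob M" and a: "a \<in> Hom M A' (Dom M k)"
    and c': "is_cylinder M A' c'"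
  obtains V where "V \<in> Hom M (cyl_ob M c') (paths Y)" "V \<cdot> inc0 c' = k \<cdot> a" "V \<cdot> inc1 c' = k' \<cdot> a"
    "start Y \<cdot> V = (start Y \<cdot> (k \<cdot> a)) \<cdot> proj c'" "finish Y \<cdot> V = (finish Y \<cdot> (k \<cdot> a)) \<cdot> proj c'"
proof -
  obtain A c V where V: "cofibrant M A" "is_cylinder M A c" "k \<in> Hom M A (paths Y)" "k' \<in> Hom M A (paths Y)"
      "V \<in> Hom M (cyl_ob M c) (paths Y)" "V \<cdot> inc0 c = k" "V \<cdot> inc1 c = k'"
      "start Y \<cdot> V = (start Y \<cdot> k) \<cdot> proj c" "finish Y \<cdot> V = (finish Y \<cdot> k) \<cdot> proj c"
    using v unfolding vertical_def by blast
  note ca = cylinder_arr[OF V(2)] cylinder_arr[OF c']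
  have a': "a \<in> Hom M A' A" using a V by simp
  obtain l where l: "l \<in> Hom M (cyl_ob M c') (cyl_ob M c)" "l \<cdot> inc0 c' = inc0 c \<cdot> a"
    "l \<cdot> inc1 c' = inc1 c \<cdot> a" "proj c \<cdot> l = a \<cdot> proj c'"
    using cylinder_map[OF V(2) c' a'] .
  show ?thesis
    by (rule that[of "V \<cdot> l"])
      (use V l a' ca Y comp_cong[OF V(6)] comp_cong[OF V(7)] comp_cong[OF V(8)] comp_cong[OF V(9)] in simp_all)
qed

lemma vertical_precomp:
  assumes v: "vertical Y k k'" and Y: "Y \<in> Ob M" and A': "cofibrant M A'" and a: "a \<in> Hom M A' (Dom M k)"
  shows "vertical Y (k \<cdot> a) (k' \<cdot> a)"
proof -
  obtain c' where c': "is_cylinder M A' c'" using cylinder_exists cofibrant_Ob[OF A'] by blast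
  obtain V where V: "V \<in> Hom M (cyl_ob M c') (paths Y)" "V \<cdot> inc0 c' = k \<cdot> a" "V \<cdot> inc1 c' = k' \<cdot> a"
    "start Y \<cdot> V = (start Y \<cdot> (k \<cdot> a)) \<cdot> proj c'" "finish Y \<cdot> V = (finish Y \<cdot> (k \<cdot> a)) \<cdot> proj c'"
    using vertical_precomp_on[OF v Y a c'] .
  have "k \<cdot> a \<in> Hom M A' (paths Y)" "k' \<cdot> a \<in> Hom M A' (paths Y)"
    using v a unfolding vertical_def by auto
  with V c' A' show ?thesis unfolding vertical_def by blast
qed

lemma vertical_trans:
  assumes v: "vertical Y k k'" and v': "vertical Y k' k''" and Y: "Y \<in> Ob M"
  shows "vertical Y k k''"
proof -
  obtain A c V where V: "cofibrant M A" "is_cylinder M A c" "k' \<in> Hom M A (paths Y)" "k \<in> Hom M A (paths Y)"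
      "V \<in> Hom M (cyl_ob M c) (paths Y)" "V \<cdot> inc0 c = k'" "V \<cdot> inc1 c = k"
      "start Y \<cdot> V = (start Y \<cdot> k') \<cdot> proj c" "finish Y \<cdot> V = (finish Y \<cdot> k') \<cdot> proj c"
    using vertical_sym[OF v Y] unfolding vertical_def by blast
  note ca = cylinder_arr[OF V(2)]
  have k'': "k'' \<in> Hom M A (paths Y)" using v' V(3) unfolding vertical_def by auto
  \<comment> \<open>Both sides agree up to vertical homotopy at the end where \<open>V\<close> is \<open>k'\<close>; compare the other ends.\<close>
  have "vertical Y V (k'' \<cdot> proj c)"
    by (rule vertical_extend[OF Y V(1) ca(1) inc_tcof(1,2)[OF V(1,2)] V(5)])
      (use V k'' ca Y vertical_ends[OF v' Y] v' comp_cong[OF vertical_ends(1)[OF v' Y]]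
         comp_cong[OF vertical_ends(2)[OF v' Y]] in simp_all)
  from vertical_precomp[OF this Y V(1), of "inc1 c"] show ?thesis
    using V k'' ca by simp
qed

section \<open>Two-cells\<close>

text \<open>A two-cell is the class of a path up to vertical homotopy. The ends are recorded as well, since the
  path alone does not determine in which object its ends are taken.\<close>

definition cell where "cell Y k = (start Y \<cdot> k, finish Y \<cdot> k, {k'. vertical Y k k'})"

definition cells where
  "cells A Y = {cell Y k | k. cofibrant M A \<and> bifibrant M Y \<and> k \<in> Hom M A (paths Y)}"

end

abbreviation src where "src \<equiv> fst"
abbreviation tgt where "tgt \<alpha> \<equiv> fst (snd \<alpha>)"

context closed_model_category begin

lemma cell_ends [simp]: "src (cell Y k) = start Y \<cdot> k" "tgt (cell Y k) = finish Y \<cdot> k"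
  by (simp_all add: cell_def)

lemma cell_eq_iff:
  assumes "cofibrant M A" "Y \<in> Ob M" "k \<in> Hom M A (paths Y)"
  shows "cell Y k = cell Y k' \<longleftrightarrow> vertical Y k k'"
proof
  assume "cell Y k = cell Y k'"
  then have "{l. vertical Y k l} = {l. vertical Y k' l}" by (simp add: cell_def)
  then have "vertical Y k' k" using vertical_refl[OF assms] by blast
  then show "vertical Y k k'" using vertical_sym assms(2) by blast
next
  assume v: "vertical Y k k'"
  then have "{l. vertical Y k l} = {l. vertical Y k' l}"
    using vertical_sym vertical_trans assms(2) by blast
  then show "cell Y k = cell Y k'" using vertical_ends[OF v assms(2)] by (simp add: cell_def)
qed

lemma cellsI: "\<lbrakk>cofibrant M A; bifibrant M Y; k \<in> Hom M A (paths Y)\<rbrakk> \<Longrightarrow> cell Y k \<in> cells A Y"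
  unfolding cells_def by blast

lemma cellsE:
  assumes "\<alpha> \<in> cells A Y"
  obtains k where "cofibrant M A" "bifibrant M Y" "k \<in> Hom M A (paths Y)" "\<alpha> = cell Y k"
  using assms unfolding cells_def by blast

lemma cells_ends:
  assumes "\<alpha> \<in> cells A Y"
  shows "src \<alpha> \<in> Hom M A Y" "tgt \<alpha> \<in> Hom M A Y"
  using assms by (auto elim!: cellsE)

definition rep where
  "rep \<alpha> = (SOME k. k \<in> Hom M (Dom M (src \<alpha>)) (paths (Cod M (src \<alpha>))) \<and> \<alpha> = cell (Cod M (src \<alpha>)) k)"

lemma rep:
  assumes "\<alpha> \<in> cells A Y"
  shows "rep \<alpha> \<in> Hom M A (paths Y)" "cell Y (rep \<alpha>) = \<alpha>"
proof -
  obtain k where k: "bifibrant M Y" "k \<in> Hom M A (paths Y)" "\<alpha> = cell Y k" using cellsE[OF assms] .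
  then have "Dom M (src \<alpha>) = A" "Cod M (src \<alpha>) = Y" by simp_all
  with k have "\<exists>k. k \<in> Hom M (Dom M (src \<alpha>)) (paths (Cod M (src \<alpha>))) \<and> \<alpha> = cell (Cod M (src \<alpha>)) k"
    by (intro exI[of _ k]) simp
  from someI_ex[OF this] show "rep \<alpha> \<in> Hom M A (paths Y)" "cell Y (rep \<alpha>) = \<alpha>"
    using \<open>Dom M (src \<alpha>) = A\<close> \<open>Cod M (src \<alpha>) = Y\<close> unfolding rep_def by simp_all
qed

subsection \<open>Precomposition\<close>

definition precomp (infixl "\<lhd>" 75) where
  "\<alpha> \<lhd> a = cell (Cod M (src \<alpha>)) (rep \<alpha> \<cdot> a)"

lemma precomp_cell:
  assumes "cofibrant M A" "cofibrant M A'" "bifibrant M Y" "k \<in> Hom M A (paths Y)" "a \<in> Hom M A' A"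
  shows "cell Y k \<lhd> a = cell Y (k \<cdot> a)"
proof -
  have c: "cell Y k \<in> cells A Y" using assms cellsI by blast
  have Y: "Y \<in> Ob M" using assms by simp
  have "vertical Y (rep (cell Y k)) k"
    using cell_eq_iff[OF assms(1) Y rep(1)[OF c], of k] rep(2)[OF c] by blast
  then have "vertical Y (rep (cell Y k) \<cdot> a) (k \<cdot> a)"
    using vertical_precomp[OF _ Y assms(2)] rep(1)[OF c] assms by simp
  then show ?thesis
    using cell_eq_iff[OF assms(2) Y, of "rep (cell Y k) \<cdot> a" "k \<cdot> a"] rep(1)[OF c] assms Y
    by (simp add: precomp_def)
qed

lemma precomp_cells:
  assumes "\<alpha> \<in> cells A Y" "cofibrant M A'" "a \<in> Hom M A' A"
  shows "\<alpha> \<lhd> a \<in> cells A' Y" "src (\<alpha> \<lhd> a) = src \<alpha> \<cdot> a" "tgt (\<alpha> \<lhd> a) = tgt \<alpha> \<cdot> a"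
  using assms by (auto elim!: cellsE simp: precomp_cell intro!: cellsI)

lemma precomp_precomp:
  assumes "\<alpha> \<in> cells A Y" "cofibrant M A'" "a \<in> Hom M A' A" "cofibrant M A''" "a' \<in> Hom M A'' A'"
  shows "(\<alpha> \<lhd> a) \<lhd> a' = \<alpha> \<lhd> (a \<cdot> a')"
  using assms by (auto elim!: cellsE simp: precomp_cell)

lemma precomp_Id:
  assumes "\<alpha> \<in> cells A Y"
  shows "\<alpha> \<lhd> Id M A = \<alpha>"
  using assms by (auto elim!: cellsE simp: precomp_cell)

text \<open>The principle of path induction: a two-cell is determined by its ends and by its restriction along
  an acyclic cofibration.\<close>

lemma two_cell_unique:
  assumes \<alpha>: "\<alpha> \<in> cells Q Y" and \<beta>: "\<beta> \<in> cells Q Y" and e: "src \<alpha> = src \<beta>" "tgt \<alpha> = tgt \<beta>"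
    and A: "cofibrant M A" and i: "i \<in> Hom M A Q" "i \<in> Cof M" "i \<in> Weq M"
    and r: "\<alpha> \<lhd> i = \<beta> \<lhd> i"
  shows "\<alpha> = \<beta>"
proof -
  obtain k where k: "cofibrant M Q" "bifibrant M Y" "k \<in> Hom M Q (paths Y)" "\<alpha> = cell Y k" using cellsE[OF \<alpha>] .
  obtain l where l: "l \<in> Hom M Q (paths Y)" "\<beta> = cell Y l" using cellsE[OF \<beta>] .
  have Y: "Y \<in> Ob M" using k by simp
  have "cell Y (k \<cdot> i) = cell Y (l \<cdot> i)" using r k l A i by (simp add: precomp_cell)
  then have "vertical Y (k \<cdot> i) (l \<cdot> i)"
    using cell_eq_iff[OF A Y, of "k \<cdot> i" "l \<cdot> i"] k i by simp
  from vertical_extend[OF Y A i k(3) l(1) _ _ this] e k l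
  have "vertical Y k l" by simp
  then show ?thesis using cell_eq_iff[OF k(1) Y k(3)] k l by simp
qed

lemma two_cell_extend:
  assumes \<gamma>: "\<gamma> \<in> cells A Y" and i: "i \<in> Hom M A Q" "i \<in> Cof M" "i \<in> Weq M"
    and t: "t \<in> Hom M Q Y" "t' \<in> Hom M Q Y" "src \<gamma> = t \<cdot> i" "tgt \<gamma> = t' \<cdot> i"
  obtains \<gamma>' where "\<gamma>' \<in> cells Q Y" "src \<gamma>' = t" "tgt \<gamma>' = t'" "\<gamma>' \<lhd> i = \<gamma>"
proof -
  obtain k where k: "cofibrant M A" "bifibrant M Y" "k \<in> Hom M A (paths Y)" "\<gamma> = cell Y k" using cellsE[OF \<gamma>] .
  have Y: "Y \<in> Ob M" using k by simp
  have Q: "cofibrant M Q" using cofibrant_cof[OF k(1) i(1,2)] .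
  obtain L where L: "L \<in> Hom M Q (paths Y)" "L \<cdot> i = k" "start Y \<cdot> L = t" "finish Y \<cdot> L = t'"
    using path_lift[OF Y i k(3) t(1,2)] t k by auto
  show ?thesis
    by (rule that[of "cell Y L"]) (use L k Q i in \<open>simp_all add: cellsI precomp_cell\<close>)
qed

definition vid where "vid f = cell (Cod M f) (const_path (Cod M f) \<cdot> f)"

lemma vid_cells:
  assumes "f \<in> Hom M A Y" "cofibrant M A" "bifibrant M Y"
  shows "vid f \<in> cells A Y" "src (vid f) = f" "tgt (vid f) = f"
  using assms by (simp_all add: vid_def cellsI)

lemma vid_precomp:
  assumes "f \<in> Hom M A Y" "cofibrant M A" "bifibrant M Y" "cofibrant M A'" "a \<in> Hom M A' A"
  shows "vid f \<lhd> a = vid (f \<cdot> a)"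
  using assms by (simp add: vid_def precomp_cell[of A A' Y])

text \<open>Every two-cell with target object \<open>Y\<close> is a restriction of the tautological one on the path
  object, which is the identity on constant paths. So a natural identity involving a two-cell
  holds if it holds for identity two-cells.\<close>

definition gen where "gen Y = cell Y (Id M (paths Y))"

lemma gen_cells:
  assumes "bifibrant M Y"
  shows "gen Y \<in> cells (paths Y) Y" "src (gen Y) = start Y" "tgt (gen Y) = finish Y"
    and "gen Y \<lhd> const_path Y = vid (Id M Y)"
  using assms by (simp_all add: gen_def cellsI vid_def precomp_cell[of "paths Y" Y])

lemma gen_precomp:
  assumes "bifibrant M Y" "cofibrant M A" "k \<in> Hom M A (paths Y)"
  shows "gen Y \<lhd> k = cell Y k"
  using assms by (simp add: gen_def precomp_cell[of "paths Y" A])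

end

context closed_model_category begin

lemma cells_gen:
  assumes "\<alpha> \<in> cells A Y"
  obtains k where "cofibrant M A" "bifibrant M Y" "k \<in> Hom M A (paths Y)" "\<alpha> = gen Y \<lhd> k"
  using cellsE[OF assms] gen_precomp by metis

lemma gen_unique:
  assumes "\<alpha> \<in> cells (paths B) Y" "\<beta> \<in> cells (paths B) Y" "src \<alpha> = src \<beta>" "tgt \<alpha> = tgt \<beta>"
    and "bifibrant M B" "\<alpha> \<lhd> const_path B = \<beta> \<lhd> const_path B"
  shows "\<alpha> = \<beta>"
  using two_cell_unique[OF assms(1-4), of B "const_path B"] assms(5,6) by simp

subsection \<open>Inverses\<close>

definition reversal where
  "reversal Y = (SOME s. s \<in> Hom M (paths Y) (paths Y) \<and> s \<cdot> const_path Y = const_path Y \<and>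
     start Y \<cdot> s = finish Y \<and> finish Y \<cdot> s = start Y)"

lemma reversal:
  assumes "Y \<in> Ob M"
  shows "reversal Y \<in> Hom M (paths Y) (paths Y)" "reversal Y \<cdot> const_path Y = const_path Y"
    "start Y \<cdot> reversal Y = finish Y" "finish Y \<cdot> reversal Y = start Y"
proof -
  have "\<exists>s. s \<in> Hom M (paths Y) (paths Y) \<and> s \<cdot> const_path Y = const_path Y \<and>
     start Y \<cdot> s = finish Y \<and> finish Y \<cdot> s = start Y"
    by (rule path_lift[OF assms, of "const_path Y" Y "paths Y" "const_path Y" "finish Y" "start Y"])
      (use assms in auto)
  from someI_ex[OF this]
  show "reversal Y \<in> Hom M (paths Y) (paths Y)" "reversal Y \<cdot> const_path Y = const_path Y"
    "start Y \<cdot> reversal Y = finish Y" "finish Y \<cdot> reversal Y = start Y"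
    unfolding reversal_def by blast+
qed

text \<open>Needed for the two kinds of maps between path objects that occur: those induced by \<open>u\<close>, and the
  reversal, which exchanges the ends.\<close>

lemma vertical_postcomp:
  assumes v: "vertical Y k k'" and Y: "Y \<in> Ob M" "Y' \<in> Ob M" and m: "m \<in> Hom M (paths Y) (paths Y')"
    and e: "start Y' \<cdot> m = u \<cdot> s" "finish Y' \<cdot> m = u \<cdot> t" and u: "u \<in> Hom M Y Y'"
    and st: "(s, t) = (start Y, finish Y) \<or> (s, t) = (finish Y, start Y)"
  shows "vertical Y' (m \<cdot> k) (m \<cdot> k')"
proof -
  obtain A c V where V: "cofibrant M A" "is_cylinder M A c" "k \<in> Hom M A (paths Y)" "k' \<in> Hom M A (paths Y)"
      "V \<in> Hom M (cyl_ob M c) (paths Y)" "V \<cdot> inc0 c = k" "V \<cdot> inc1 c = k'"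
      "start Y \<cdot> V = (start Y \<cdot> k) \<cdot> proj c" "finish Y \<cdot> V = (finish Y \<cdot> k) \<cdot> proj c"
    using v unfolding vertical_def by blast
  note ca = cylinder_arr[OF V(2)]
  have "s \<cdot> V = (s \<cdot> k) \<cdot> proj c" "t \<cdot> V = (t \<cdot> k) \<cdot> proj c" "s \<in> Hom M (paths Y) Y" "t \<in> Hom M (paths Y) Y"
    using st V Y by auto
  then show ?thesis unfolding vertical_def
    by (intro exI[of _ A] exI[of _ c] exI[of _ "m \<cdot> V"])
      (use V ca Y m u e comp_cong[OF e(1)] comp_cong[OF e(2)] in simp)
qed

definition inverse_cell where
  "inverse_cell \<alpha> = cell (Cod M (src \<alpha>)) (reversal (Cod M (src \<alpha>)) \<cdot> rep \<alpha>)"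

lemma inverse_cell_cell:
  assumes A: "cofibrant M A" and Y: "bifibrant M Y" and k: "k \<in> Hom M A (paths Y)"
  shows "inverse_cell (cell Y k) = cell Y (reversal Y \<cdot> k)"
proof -
  have c: "cell Y k \<in> cells A Y" using assms cellsI by blast
  have Y': "Y \<in> Ob M" using assms by simp
  note r = rep[OF c]
  have "vertical Y (rep (cell Y k)) k"
    using cell_eq_iff[OF A Y' r(1), of k] r(2) by blast
  from vertical_postcomp[OF this Y' Y' reversal(1)[OF Y'], of "Id M Y" "finish Y" "start Y"]
  have "vertical Y (reversal Y \<cdot> rep (cell Y k)) (reversal Y \<cdot> k)"
    using reversal[OF Y'] Y' by simp
  then show ?thesis
    using cell_eq_iff[OF A Y', of "reversal Y \<cdot> rep (cell Y k)" "reversal Y \<cdot> k"] r(1) assms Y' reversal(1)[OF Y']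
    by (simp add: inverse_cell_def)
qed

lemma inverse_cells:
  assumes "\<alpha> \<in> cells A Y"
  shows "inverse_cell \<alpha> \<in> cells A Y" "src (inverse_cell \<alpha>) = tgt \<alpha>" "tgt (inverse_cell \<alpha>) = src \<alpha>"
proof -
  obtain k where k: "cofibrant M A" "bifibrant M Y" "k \<in> Hom M A (paths Y)" "\<alpha> = cell Y k" using cellsE[OF assms] .
  have Y: "Y \<in> Ob M" using k by simp
  note r = reversal[OF Y]
  show "inverse_cell \<alpha> \<in> cells A Y" "src (inverse_cell \<alpha>) = tgt \<alpha>" "tgt (inverse_cell \<alpha>) = src \<alpha>"
    using k r Y comp_cong[OF r(3)] comp_cong[OF r(4)] by (simp_all add: inverse_cell_cell cellsI)
qed

lemma inverse_precomp:
  assumes "\<alpha> \<in> cells A Y" "cofibrant M A'" "a \<in> Hom M A' A"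
  shows "inverse_cell (\<alpha> \<lhd> a) = inverse_cell \<alpha> \<lhd> a"
proof -
  obtain k where k: "cofibrant M A" "bifibrant M Y" "k \<in> Hom M A (paths Y)" "\<alpha> = cell Y k" using cellsE[OF assms(1)] .
  have Y: "Y \<in> Ob M" using k by simp
  show ?thesis using k assms reversal(1)[OF Y]
    by (simp add: inverse_cell_cell[of A] inverse_cell_cell[of A'] precomp_cell[of A A'])
qed

lemma inverse_vid:
  assumes "f \<in> Hom M A Y" "cofibrant M A" "bifibrant M Y"
  shows "inverse_cell (vid f) = vid f"
proof -
  have Y: "Y \<in> Ob M" using assms by simp
  show ?thesis using assms reversal(1)[OF Y] comp_cong[OF reversal(2)[OF Y]] Y
    by (simp add: vid_def inverse_cell_cell[of A])
qed

subsection \<open>Postcomposition\<close>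

definition path_map where
  "path_map u = (SOME m. m \<in> Hom M (paths (Dom M u)) (paths (Cod M u)) \<and>
     m \<cdot> const_path (Dom M u) = const_path (Cod M u) \<cdot> u \<and>
     start (Cod M u) \<cdot> m = u \<cdot> start (Dom M u) \<and> finish (Cod M u) \<cdot> m = u \<cdot> finish (Dom M u))"

lemma path_map:
  assumes u: "u \<in> Hom M Y Y'"
  shows "path_map u \<in> Hom M (paths Y) (paths Y')" "path_map u \<cdot> const_path Y = const_path Y' \<cdot> u"
    "start Y' \<cdot> path_map u = u \<cdot> start Y" "finish Y' \<cdot> path_map u = u \<cdot> finish Y"
proof -
  have Y: "Y \<in> Ob M" "Y' \<in> Ob M" using Hom_Ob[OF u] by simp_all
  have "\<exists>m. m \<in> Hom M (paths Y) (paths Y') \<and> m \<cdot> const_path Y = const_path Y' \<cdot> u \<and>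
     start Y' \<cdot> m = u \<cdot> start Y \<and> finish Y' \<cdot> m = u \<cdot> finish Y"
    by (rule path_lift[OF Y(2), of "const_path Y" Y "paths Y" "const_path Y' \<cdot> u" "u \<cdot> start Y" "u \<cdot> finish Y"])
      (use Y u in auto)
  from someI_ex[OF this] u
  show "path_map u \<in> Hom M (paths Y) (paths Y')" "path_map u \<cdot> const_path Y = const_path Y' \<cdot> u"
    "start Y' \<cdot> path_map u = u \<cdot> start Y" "finish Y' \<cdot> path_map u = u \<cdot> finish Y"
    unfolding path_map_def by auto
qed

definition postcomp (infixr "\<rhd>" 76) where
  "u \<rhd> \<alpha> = cell (Cod M u) (path_map u \<cdot> rep \<alpha>)"

lemma postcomp_cell:
  assumes A: "cofibrant M A" and Y: "bifibrant M Y" "bifibrant M Y'"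
    and k: "k \<in> Hom M A (paths Y)" and u: "u \<in> Hom M Y Y'"
  shows "u \<rhd> cell Y k = cell Y' (path_map u \<cdot> k)"
proof -
  have c: "cell Y k \<in> cells A Y" using assms cellsI by blast
  have Y': "Y \<in> Ob M" "Y' \<in> Ob M" using assms by simp_all
  note r = rep[OF c] and p = path_map[OF u]
  have "vertical Y (rep (cell Y k)) k"
    using cell_eq_iff[OF A Y'(1) r(1), of k] r(2) by blast
  from vertical_postcomp[OF this Y' p(1,3,4) u]
  have "vertical Y' (path_map u \<cdot> rep (cell Y k)) (path_map u \<cdot> k)" by simp
  then show ?thesis
    using cell_eq_iff[OF A Y'(2), of "path_map u \<cdot> rep (cell Y k)" "path_map u \<cdot> k"] r(1) p(1) u
    by (simp add: postcomp_def)
qed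

lemma postcomp_cells:
  assumes \<alpha>: "\<alpha> \<in> cells A Y" and u: "u \<in> Hom M Y Y'" and Y': "bifibrant M Y'"
  shows "u \<rhd> \<alpha> \<in> cells A Y'" "src (u \<rhd> \<alpha>) = u \<cdot> src \<alpha>" "tgt (u \<rhd> \<alpha>) = u \<cdot> tgt \<alpha>"
proof -
  obtain k where k: "cofibrant M A" "bifibrant M Y" "k \<in> Hom M A (paths Y)" "\<alpha> = cell Y k" using cellsE[OF \<alpha>] .
  note p = path_map[OF u]
  have Y: "Y \<in> Ob M" "Y' \<in> Ob M" using Y' k by simp_all
  show "u \<rhd> \<alpha> \<in> cells A Y'" "src (u \<rhd> \<alpha>) = u \<cdot> src \<alpha>" "tgt (u \<rhd> \<alpha>) = u \<cdot> tgt \<alpha>"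
    using k u Y' p Y comp_cong[OF p(3)] comp_cong[OF p(4)] by (simp_all add: postcomp_cell cellsI)
qed

lemma postcomp_precomp:
  assumes \<alpha>: "\<alpha> \<in> cells A Y" and u: "u \<in> Hom M Y Y'" and Y': "bifibrant M Y'"
    and A': "cofibrant M A'" and a: "a \<in> Hom M A' A"
  shows "(u \<rhd> \<alpha>) \<lhd> a = u \<rhd> (\<alpha> \<lhd> a)"
proof -
  obtain k where k: "cofibrant M A" "bifibrant M Y" "k \<in> Hom M A (paths Y)" "\<alpha> = cell Y k" using cellsE[OF \<alpha>] .
  show ?thesis using k u Y' A' a path_map(1)[OF u]
    by (simp add: postcomp_cell[of A] postcomp_cell[of A'] precomp_cell[of A A'])
qed

lemma postcomp_vid:
  assumes f: "f \<in> Hom M A Y" "cofibrant M A" and Y: "bifibrant M Y" "bifibrant M Y'" and u: "u \<in> Hom M Y Y'"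
  shows "u \<rhd> vid f = vid (u \<cdot> f)"
proof -
  have Y': "Y \<in> Ob M" "Y' \<in> Ob M" using Y by simp_all
  note p = path_map[OF u]
  have "const_path Y \<cdot> f \<in> Hom M A (paths Y)" using f Y' by simp
  from postcomp_cell[OF f(2) Y this u] show ?thesis
    using f u Y' p comp_cong[OF p(2)] by (simp add: vid_def)
qed

lemma postcomp_postcomp:
  assumes \<alpha>: "\<alpha> \<in> cells A Y" and u: "u \<in> Hom M Y Y'" "u' \<in> Hom M Y' Y''" and Y': "bifibrant M Y'" "bifibrant M Y''"
  shows "u' \<rhd> (u \<rhd> \<alpha>) = (u' \<cdot> u) \<rhd> \<alpha>"
proof -
  obtain k where k: "cofibrant M A" "bifibrant M Y" "k \<in> Hom M A (paths Y)" "\<alpha> = gen Y \<lhd> k" using cells_gen[OF \<alpha>] .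
  note g = gen_cells[OF k(2)]
  have uu: "u' \<cdot> u \<in> Hom M Y Y''" using u by simp
  note pc = postcomp_cells[OF g(1) u(1) Y'(1)] 
  note pc2 = postcomp_cells[OF pc(1) u(2) Y'(2)] postcomp_cells[OF g(1) uu Y'(2)]
  have Y: "Y \<in> Ob M" "cofibrant M Y" "cofibrant M (paths Y)" "const_path Y \<in> Hom M Y (paths Y)" "Id M Y \<in> Hom M Y Y"
    using k by simp_all
  have "u' \<rhd> (u \<rhd> gen Y) = (u' \<cdot> u) \<rhd> gen Y"
  proof (rule gen_unique[OF pc2(1,4)])
    show "src (u' \<rhd> u \<rhd> gen Y) = src ((u' \<cdot> u) \<rhd> gen Y)" "tgt (u' \<rhd> u \<rhd> gen Y) = tgt ((u' \<cdot> u) \<rhd> gen Y)"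
      using pc pc2 g u Y by simp_all
    show "(u' \<rhd> u \<rhd> gen Y) \<lhd> const_path Y = ((u' \<cdot> u) \<rhd> gen Y) \<lhd> const_path Y"
      unfolding postcomp_precomp[OF pc(1) u(2) Y'(2) Y(2,4)] postcomp_precomp[OF g(1) u(1) Y'(1) Y(2,4)]
        postcomp_precomp[OF g(1) uu Y'(2) Y(2,4)] g(4)
      using postcomp_vid[OF Y(5,2) k(2) Y'(1) u(1)] postcomp_vid[OF Y(5,2) k(2) Y'(2) uu]
        postcomp_vid[of u Y Y' Y'' u'] Y Y' u by simp
  qed (use k in simp)
  then show ?thesis
    unfolding k(4) postcomp_precomp[OF g(1) u(1) Y'(1) k(1,3), symmetric]
      postcomp_precomp[OF pc(1) u(2) Y'(2) k(1,3), symmetric]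
      postcomp_precomp[OF g(1) uu Y'(2) k(1,3), symmetric] by simp
qed

lemma postcomp_Id:
  assumes \<alpha>: "\<alpha> \<in> cells A Y"
  shows "Id M Y \<rhd> \<alpha> = \<alpha>"
proof -
  obtain k where k: "cofibrant M A" "bifibrant M Y" "k \<in> Hom M A (paths Y)" "\<alpha> = gen Y \<lhd> k" using cells_gen[OF \<alpha>] .
  note g = gen_cells[OF k(2)]
  have Y: "Y \<in> Ob M" "cofibrant M Y" "const_path Y \<in> Hom M Y (paths Y)" "Id M Y \<in> Hom M Y Y"
    using k by simp_all
  note pc = postcomp_cells[OF g(1) Y(4) k(2)] 
  have "Id M Y \<rhd> gen Y = gen Y"
    by (rule gen_unique[OF pc(1) g(1)])
      (use pc g Y k postcomp_precomp[OF g(1) Y(4) k(2) Y(2,3)] postcomp_vid[OF Y(4,2) k(2,2) Y(4)] in simp_all)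
  then show ?thesis
    unfolding k(4) postcomp_precomp[OF g(1) Y(4) k(2) k(1,3), symmetric] by simp
qed

subsection \<open>Vertical composition\<close>

lemma double_path_space_arr:
  assumes "double_path_space M p u v E eb ep ec" "u \<in> Hom M B D" "v \<in> Hom M C D"
  shows "eb \<in> Hom M E B" "ep \<in> Hom M E (path_space M p)" "ec \<in> Hom M E C"
    and "ev0 p \<cdot> ep = u \<cdot> eb" "ev1 p \<cdot> ep = v \<cdot> ec"
  using assms by (simp_all add: double_path_space_def)

lemma double_path_space_map:
  assumes "double_path_space M p u v E eb ep ec" "u \<in> Hom M B D" "v \<in> Hom M C D"
    and "b \<in> Hom M T B" "k \<in> Hom M T (path_space M p)" "x \<in> Hom M T C"
    and "ev0 p \<cdot> k = u \<cdot> b" "ev1 p \<cdot> k = v \<cdot> x"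
  obtains m where "m \<in> Hom M T E" "eb \<cdot> m = b" "ep \<cdot> m = k" "ec \<cdot> m = x"
proof -
  have "\<forall>T. \<forall>b \<in> Hom M T B. \<forall>k \<in> Hom M T (path_space M p). \<forall>x \<in> Hom M T C.
        ev0 p \<cdot> k = u \<cdot> b \<and> ev1 p \<cdot> k = v \<cdot> x \<longrightarrow>
        (\<exists>!m. m \<in> Hom M T E \<and> eb \<cdot> m = b \<and> ep \<cdot> m = k \<and> ec \<cdot> m = x)"
    using assms(1-3) by (simp add: double_path_space_def)
  then show ?thesis using assms(4-) that by blast
qed

lemma double_path_space_unique:
  assumes "double_path_space M p u v E eb ep ec" "is_path_ob M D p" "u \<in> Hom M B D" "v \<in> Hom M C D"
    and "m \<in> Hom M T E" "m' \<in> Hom M T E"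
    and "eb \<cdot> m = eb \<cdot> m'" "ep \<cdot> m = ep \<cdot> m'" "ec \<cdot> m = ec \<cdot> m'"
  shows "m = m'"
proof -
  note a = double_path_space_arr[OF assms(1,3,4)]
  have p: "ev0 p \<in> Hom M (path_space M p) D" "ev1 p \<in> Hom M (path_space M p) D"
    using assms(2) by (simp_all add: is_path_ob_def)
  have u: "\<forall>T. \<forall>b \<in> Hom M T B. \<forall>k \<in> Hom M T (path_space M p). \<forall>x \<in> Hom M T C.
        ev0 p \<cdot> k = u \<cdot> b \<and> ev1 p \<cdot> k = v \<cdot> x \<longrightarrow>
        (\<exists>!m. m \<in> Hom M T E \<and> eb \<cdot> m = b \<and> ep \<cdot> m = k \<and> ec \<cdot> m = x)"
    using assms(1,3,4) by (simp add: double_path_space_def)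
  have "eb \<cdot> m \<in> Hom M T B" "ep \<cdot> m \<in> Hom M T (path_space M p)" "ec \<cdot> m \<in> Hom M T C"
    "ev0 p \<cdot> (ep \<cdot> m) = u \<cdot> (eb \<cdot> m)" "ev1 p \<cdot> (ep \<cdot> m) = v \<cdot> (ec \<cdot> m)"
    using a p assms comp_cong[OF a(4)] comp_cong[OF a(5)] by simp_all
  then have "\<exists>!n. n \<in> Hom M T E \<and> eb \<cdot> n = eb \<cdot> m \<and> ep \<cdot> n = ep \<cdot> m \<and> ec \<cdot> n = ec \<cdot> m"
    using u by blast
  then show ?thesis using assms by metis
qed

text \<open>Concatenation of paths needs a domain on which it is defined by extension from the constant
  paths: an object \<open>Q\<close> that is related to \<open>Y\<close> by an acyclic cofibration and, by an acyclic
  fibration, to the object of composable pairs of paths. The last two clauses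
  are what is left of that fibration: composable pairs, and homotopies of such pairs with given ends,
  lift to \<open>Q\<close>.\<close>

definition concat_object where
  "concat_object Y Q i p0 p1 m \<longleftrightarrow>
     i \<in> Hom M Y Q \<and> i \<in> Cof M \<and> i \<in> Weq M \<and>
     p0 \<in> Hom M Q (paths Y) \<and> p1 \<in> Hom M Q (paths Y) \<and> m \<in> Hom M Q (paths Y) \<and>
     p0 \<cdot> i = const_path Y \<and> p1 \<cdot> i = const_path Y \<and> m \<cdot> i = const_path Y \<and>
     finish Y \<cdot> p0 = start Y \<cdot> p1 \<and> start Y \<cdot> m = start Y \<cdot> p0 \<and> finish Y \<cdot> m = finish Y \<cdot> p1 \<and>
     (\<forall>A. cofibrant M A \<longrightarrow> (\<forall>k\<in>Hom M A (paths Y). \<forall>l\<in>Hom M A (paths Y). finish Y \<cdot> k = start Y \<cdot> l \<longrightarrow>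
        (\<exists>a\<in>Hom M A Q. p0 \<cdot> a = k \<and> p1 \<cdot> a = l))) \<and>
     (\<forall>A c K L. is_cylinder M A c \<longrightarrow> (\<forall>a\<in>Hom M A Q. \<forall>a'\<in>Hom M A Q.
        K \<in> Hom M (cyl_ob M c) (paths Y) \<and> L \<in> Hom M (cyl_ob M c) (paths Y) \<and> finish Y \<cdot> K = start Y \<cdot> L \<and>
        K \<cdot> inc0 c = p0 \<cdot> a \<and> L \<cdot> inc0 c = p1 \<cdot> a \<and> K \<cdot> inc1 c = p0 \<cdot> a' \<and> L \<cdot> inc1 c = p1 \<cdot> a' \<longrightarrow>
        (\<exists>b\<in>Hom M (cyl_ob M c) Q. b \<cdot> inc0 c = a \<and> b \<cdot> inc1 c = a' \<and> p0 \<cdot> b = K \<and> p1 \<cdot> b = L)))"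

lemma concat_object_exists:
  assumes Y: "bifibrant M Y"
  shows "\<exists>Q i p0 p1 m. concat_object Y Q i p0 p1 m"
proof -
  have Y': "Y \<in> Ob M" "fibrant M Y" using Y by simp_all
  let ?p = "path_object Y"
  note p = path_object[OF Y'(1)]
  have u: "finish Y \<in> Hom M (paths Y) Y" and v: "Id M Y \<in> Hom M Y Y" using Y' by simp_all
  have P: "path_space M ?p = paths Y" "ev0 ?p = start Y" "ev1 ?p = finish Y"
    by (simp_all add: paths_def start_def finish_def)
  \<comment> \<open>With the identity as second map, the double path space is the object of composable pairs.\<close>
  obtain E eb ep ec where E: "double_path_space M ?p (finish Y) (Id M Y) E eb ep ec"
    using double_path_space_exists[OF u v p] .
  note ea = double_path_space_arr[OF E u v, unfolded P]
  note em = double_path_space_map[OF E u v, unfolded P]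
  note eu = double_path_space_unique[OF E p u v]
  have eb: "eb \<in> Fib M \<and> eb \<in> Weq M"
  proof (rule tfib_by_lifting)
    show "eb \<in> Hom M E (paths Y)" by (fact ea)
    fix U W j x y assume j: "j \<in> Hom M U W" "j \<in> Cof M" and x: "x \<in> Hom M U E"
      and y: "y \<in> Hom M W (paths Y)" and e: "eb \<cdot> x = y \<cdot> j"
    have "start Y \<cdot> (ep \<cdot> x) = (finish Y \<cdot> y) \<cdot> j"
      using comp_cong[OF ea(4)] e j x y ea Y' by simp
    then obtain k where k: "k \<in> Hom M W (paths Y)" "k \<cdot> j = ep \<cdot> x" "start Y \<cdot> k = finish Y \<cdot> y"
      using lift_tfib[OF j(2) ev_tfib(1,2)[OF Y'(2)] j(1), of "paths Y" Y "ep \<cdot> x" "finish Y \<cdot> y"]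
        x y ea Y' by auto
    obtain m where m: "m \<in> Hom M W E" "eb \<cdot> m = y" "ep \<cdot> m = k" "ec \<cdot> m = finish Y \<cdot> k"
      using em[OF y k(1), of "finish Y \<cdot> k"] k Y' by auto
    have "finish Y \<cdot> (ep \<cdot> x) = ec \<cdot> x" using comp_cong[OF ea(5)] x ea Y' by simp
    then have "m \<cdot> j = x"
      using eu[of "m \<cdot> j" U x] m j x k e ea Y' comp_cong[OF m(2)] comp_cong[OF m(3)] comp_cong[OF m(4)] by simp
    with m show "\<exists>l\<in>Hom M W E. l \<cdot> j = x \<and> eb \<cdot> l = y" by blast
  qed
  obtain cc where cc: "cc \<in> Hom M Y E" "eb \<cdot> cc = const_path Y" "ep \<cdot> cc = const_path Y" "ec \<cdot> cc = Id M Y"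
    using em[of "const_path Y" Y "const_path Y" "Id M Y"] Y' by auto
  have ccw: "cc \<in> Weq M" using weq_right[of eb cc Y E "paths Y"] eb cc ea Y' by simp
  obtain Q i r where Q: "i \<in> Hom M Y Q" "r \<in> Hom M Q E" "cc = r \<cdot> i" "i \<in> Cof M" "r \<in> Fib M" "r \<in> Weq M"
    using CM5_cof_tfib[OF cc(1)] by blast
  have iw: "i \<in> Weq M" using weq_right[OF Q(6) _ Q(1,2)] Q(3) ccw by simp
  obtain m where m: "m \<in> Hom M Q (paths Y)" "m \<cdot> i = const_path Y" "start Y \<cdot> m = start Y \<cdot> (eb \<cdot> r)"
      "finish Y \<cdot> m = finish Y \<cdot> (ep \<cdot> r)"
    by (rule path_lift[OF Y'(1) Q(1,4) iw, of "const_path Y" "start Y \<cdot> (eb \<cdot> r)" "finish Y \<cdot> (ep \<cdot> r)"])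
      (use Q cc ea Y' in auto)
  have L1: "\<exists>a\<in>Hom M A Q. (eb \<cdot> r) \<cdot> a = k \<and> (ep \<cdot> r) \<cdot> a = l"
    if A: "cofibrant M A" and k: "k \<in> Hom M A (paths Y)" "l \<in> Hom M A (paths Y)" "finish Y \<cdot> k = start Y \<cdot> l" for A k l
  proof -
    obtain n where n: "n \<in> Hom M A E" "eb \<cdot> n = k" "ep \<cdot> n = l"
      using em[OF k(1,2), of "finish Y \<cdot> l"] k Y' by auto
    obtain a where "a \<in> Hom M A Q" "r \<cdot> a = n" using cofibrant_lift[OF A Q(2,5,6) n(1)] .
    then show ?thesis using n Q ea by (intro bexI[of _ a]) simp_all
  qed
  have L2: "\<exists>b\<in>Hom M (cyl_ob M c) Q. b \<cdot> inc0 c = a \<and> b \<cdot> inc1 c = a' \<and> (eb \<cdot> r) \<cdot> b = K \<and> (ep \<cdot> r) \<cdot> b = L"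
    if c: "is_cylinder M A c" and a: "a \<in> Hom M A Q" "a' \<in> Hom M A Q"
      and K: "K \<in> Hom M (cyl_ob M c) (paths Y)" "L \<in> Hom M (cyl_ob M c) (paths Y)" "finish Y \<cdot> K = start Y \<cdot> L"
      and e: "K \<cdot> inc0 c = (eb \<cdot> r) \<cdot> a" "L \<cdot> inc0 c = (ep \<cdot> r) \<cdot> a"
        "K \<cdot> inc1 c = (eb \<cdot> r) \<cdot> a'" "L \<cdot> inc1 c = (ep \<cdot> r) \<cdot> a'" for A c a a' K L
  proof -
    note ca = cylinder_arr[OF c]
    obtain n where n: "n \<in> Hom M (cyl_ob M c) E" "eb \<cdot> n = K" "ep \<cdot> n = L" "ec \<cdot> n = finish Y \<cdot> L"
      using em[OF K(1,2), of "finish Y \<cdot> L"] K Y' by auto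
    have ec: "finish Y \<cdot> (ep \<cdot> x) = ec \<cdot> x" if "x \<in> Hom M T E" for x T
      using that comp_cong[OF ea(5)] ea Y' by simp
    have 1: "r \<cdot> a = n \<cdot> inc0 c"
      using eu[of "r \<cdot> a" A "n \<cdot> inc0 c"] n a Q ca e ea ec[of "r \<cdot> a" A] Y' K
        comp_cong[OF n(2)] comp_cong[OF n(3)] comp_cong[OF n(4)] by simp
    have 2: "r \<cdot> a' = n \<cdot> inc1 c"
      using eu[of "r \<cdot> a'" A "n \<cdot> inc1 c"] n a Q ca e ea ec[of "r \<cdot> a'" A] Y' K
        comp_cong[OF n(2)] comp_cong[OF n(3)] comp_cong[OF n(4)] by simp
    obtain b where "b \<in> Hom M (cyl_ob M c) Q" "b \<cdot> inc0 c = a" "b \<cdot> inc1 c = a'" "r \<cdot> b = n"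
      using cylinder_lift[OF c Q(2,5,6) a n(1) 1 2] .
    then show ?thesis using n Q ea by (intro bexI[of _ b]) simp_all
  qed
  have "concat_object Y Q i (eb \<cdot> r) (ep \<cdot> r) m"
    unfolding concat_object_def
  proof (intro conjI allI impI ballI)
    show "finish Y \<cdot> (eb \<cdot> r) = start Y \<cdot> (ep \<cdot> r)" using comp_cong[OF ea(4), of r] Q ea Y' by simp
    show "(eb \<cdot> r) \<cdot> i = const_path Y" "(ep \<cdot> r) \<cdot> i = const_path Y" using Q cc ea by simp_all
    show "\<And>A k l. \<lbrakk>cofibrant M A; k \<in> Hom M A (paths Y); l \<in> Hom M A (paths Y); finish Y \<cdot> k = start Y \<cdot> l\<rbrakk>
      \<Longrightarrow> \<exists>a\<in>Hom M A Q. (eb \<cdot> r) \<cdot> a = k \<and> (ep \<cdot> r) \<cdot> a = l" by (rule L1)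
    show "\<exists>b\<in>Hom M (cyl_ob M c) Q. b \<cdot> inc0 c = a \<and> b \<cdot> inc1 c = a' \<and> (eb \<cdot> r) \<cdot> b = K \<and> (ep \<cdot> r) \<cdot> b = L"
      if "is_cylinder M A c" "a \<in> Hom M A Q" "a' \<in> Hom M A Q"
      "K \<in> Hom M (cyl_ob M c) (paths Y) \<and> L \<in> Hom M (cyl_ob M c) (paths Y) \<and> finish Y \<cdot> K = start Y \<cdot> L \<and>
       K \<cdot> inc0 c = (eb \<cdot> r) \<cdot> a \<and> L \<cdot> inc0 c = (ep \<cdot> r) \<cdot> a \<and> K \<cdot> inc1 c = (eb \<cdot> r) \<cdot> a' \<and> L \<cdot> inc1 c = (ep \<cdot> r) \<cdot> a'"
      for A c K L a a'
      using that L2 by blast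
  qed (use Q iw m ea in simp_all)
  then show ?thesis by blast
qed

definition concat where
  "concat Y = (SOME (i, p0, p1, m). concat_object Y (Cod M i) i p0 p1 m)"

definition vcomp (infixr "\<bullet>" 70) where
  "\<beta> \<bullet> \<alpha> = (let Y = Cod M (src \<alpha>); (i, p0, p1, m) = concat Y
     in cell Y (m \<cdot> (SOME a. a \<in> Hom M (Dom M (src \<alpha>)) (Cod M i) \<and> cell Y (p0 \<cdot> a) = \<alpha> \<and> cell Y (p1 \<cdot> a) = \<beta>)))"

text \<open>The composite does not depend on the chosen lift to the concatenation object: vertical homotopies
  between the components of two lifts form a homotopy of composable pairs, and this lifts as well.\<close>

lemma vcomp_via_concat:
  assumes Y: "bifibrant M Y"
  obtains Q i p0 p1 m where "concat_object Y Q i p0 p1 m"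
    "\<forall>A a. cofibrant M A \<longrightarrow> a \<in> Hom M A Q \<longrightarrow> cell Y (p1 \<cdot> a) \<bullet> cell Y (p0 \<cdot> a) = cell Y (m \<cdot> a)"
proof -
  have Y': "Y \<in> Ob M" using Y by simp
  obtain i p0 p1 m where c: "concat Y = (i, p0, p1, m)" using prod_cases4 by blast
  have "\<exists>x. case x of (i, p0, p1, m) \<Rightarrow> concat_object Y (Cod M i) i p0 p1 m"
  proof -
    obtain Q i p0 p1 m where q: "concat_object Y Q i p0 p1 m" using concat_object_exists[OF Y] by blast
    then have "Cod M i = Q" by (simp add: concat_object_def)
    with q show ?thesis by (intro exI[of _ "(i, p0, p1, m)"]) simp
  qed
  from someI_ex[OF this] have Q: "concat_object Y (Cod M i) i p0 p1 m"
    using c unfolding concat_def by simp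
  let ?Q = "Cod M i"
  have a: "p0 \<in> Hom M ?Q (paths Y)" "p1 \<in> Hom M ?Q (paths Y)" "m \<in> Hom M ?Q (paths Y)"
      "start Y \<cdot> m = start Y \<cdot> p0" "finish Y \<cdot> m = finish Y \<cdot> p1" "finish Y \<cdot> p0 = start Y \<cdot> p1"
    using Q unfolding concat_object_def by blast+
  have lift: "\<exists>b\<in>Hom M (cyl_ob M c) ?Q. b \<cdot> inc0 c = a \<and> b \<cdot> inc1 c = a' \<and> p0 \<cdot> b = K \<and> p1 \<cdot> b = L"
    if "is_cylinder M A c" "a \<in> Hom M A ?Q" "a' \<in> Hom M A ?Q"
      "K \<in> Hom M (cyl_ob M c) (paths Y)" "L \<in> Hom M (cyl_ob M c) (paths Y)" "finish Y \<cdot> K = start Y \<cdot> L"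
      "K \<cdot> inc0 c = p0 \<cdot> a" "L \<cdot> inc0 c = p1 \<cdot> a" "K \<cdot> inc1 c = p0 \<cdot> a'" "L \<cdot> inc1 c = p1 \<cdot> a'" for A c a a' K L
    using Q that unfolding concat_object_def by blast
  show ?thesis
  proof (rule that[OF Q], intro allI impI)
    fix A x assume A: "cofibrant M A" and x: "x \<in> Hom M A ?Q"
    have A': "A \<in> Ob M" using A by simp
    let ?P = "\<lambda>a. a \<in> Hom M A ?Q \<and> cell Y (p0 \<cdot> a) = cell Y (p0 \<cdot> x) \<and> cell Y (p1 \<cdot> a) = cell Y (p1 \<cdot> x)"
    have "?P x" using x by simp
    then have s: "?P (SOME a. ?P a)" by (rule someI[of ?P])
    have "cell Y (m \<cdot> a) = cell Y (m \<cdot> x)" if P: "?P a" for a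
    proof -
      obtain c where c: "is_cylinder M A c" using cylinder_exists[OF A'] .
      note ca = cylinder_arr[OF c]
      have h: "p0 \<cdot> a \<in> Hom M A (paths Y)" "p1 \<cdot> a \<in> Hom M A (paths Y)" using P a by simp_all
      have v: "vertical Y (p0 \<cdot> a) (p0 \<cdot> x)" "vertical Y (p1 \<cdot> a) (p1 \<cdot> x)"
        using P cell_eq_iff[OF A Y' h(1), of "p0 \<cdot> x"] cell_eq_iff[OF A Y' h(2), of "p1 \<cdot> x"] by blast+
      have i: "Id M A \<in> Hom M A (Dom M (p0 \<cdot> a))" "Id M A \<in> Hom M A (Dom M (p1 \<cdot> a))" using h A' by simp_all
      obtain K where K: "K \<in> Hom M (cyl_ob M c) (paths Y)" "K \<cdot> inc0 c = p0 \<cdot> a" "K \<cdot> inc1 c = p0 \<cdot> x"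
          "start Y \<cdot> K = (start Y \<cdot> (p0 \<cdot> a)) \<cdot> proj c" "finish Y \<cdot> K = (finish Y \<cdot> (p0 \<cdot> a)) \<cdot> proj c"
        by (rule vertical_precomp_on[OF v(1) Y' i(1) c]) (use that P x a in simp)
      obtain L where L: "L \<in> Hom M (cyl_ob M c) (paths Y)" "L \<cdot> inc0 c = p1 \<cdot> a" "L \<cdot> inc1 c = p1 \<cdot> x"
          "start Y \<cdot> L = (start Y \<cdot> (p1 \<cdot> a)) \<cdot> proj c" "finish Y \<cdot> L = (finish Y \<cdot> (p1 \<cdot> a)) \<cdot> proj c"
        by (rule vertical_precomp_on[OF v(2) Y' i(2) c]) (use that P x a in simp)
      have fs: "finish Y \<cdot> K = start Y \<cdot> L"
        unfolding K(5) L(4) using comp_cong[OF a(6)] P a Y' ca by simp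
      obtain b where b: "b \<in> Hom M (cyl_ob M c) ?Q" "b \<cdot> inc0 c = a" "b \<cdot> inc1 c = x" "p0 \<cdot> b = K" "p1 \<cdot> b = L"
        using lift[OF c _ x K(1) L(1) fs K(2) L(2) K(3) L(3)] P by blast
      have "vertical Y (m \<cdot> a) (m \<cdot> x)"
        unfolding vertical_def
        by (intro exI[of _ A] exI[of _ c] exI[of _ "m \<cdot> b"])
          (use A c b a P x ca K L Y' comp_cong[OF a(4)] comp_cong[OF a(5)] in simp)
      then show ?thesis using cell_eq_iff[OF A Y', of "m \<cdot> a" "m \<cdot> x"] P a by simp
    qed
    from this[OF s] show "cell Y (p1 \<cdot> x) \<bullet> cell Y (p0 \<cdot> x) = cell Y (m \<cdot> x)"
      using c x a Y' by (simp add: vcomp_def Let_def)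
  qed
qed

end

context closed_model_category begin

lemma vcomp_via_concat_cells:
  assumes \<alpha>: "\<alpha> \<in> cells A Y" and \<beta>: "\<beta> \<in> cells A Y" and e: "tgt \<alpha> = src \<beta>"
  obtains Q i p0 p1 m a where "concat_object Y Q i p0 p1 m" "a \<in> Hom M A Q" "\<alpha> = cell Y (p0 \<cdot> a)" "\<beta> = cell Y (p1 \<cdot> a)"
    "\<forall>A a. cofibrant M A \<longrightarrow> a \<in> Hom M A Q \<longrightarrow> cell Y (p1 \<cdot> a) \<bullet> cell Y (p0 \<cdot> a) = cell Y (m \<cdot> a)"
proof -
  obtain k where k: "cofibrant M A" "bifibrant M Y" "k \<in> Hom M A (paths Y)" "\<alpha> = cell Y k" using cellsE[OF \<alpha>] .
  obtain l where l: "l \<in> Hom M A (paths Y)" "\<beta> = cell Y l" using cellsE[OF \<beta>] .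
  obtain Q i p0 p1 m where Q: "concat_object Y Q i p0 p1 m"
    "\<forall>A a. cofibrant M A \<longrightarrow> a \<in> Hom M A Q \<longrightarrow> cell Y (p1 \<cdot> a) \<bullet> cell Y (p0 \<cdot> a) = cell Y (m \<cdot> a)"
    using vcomp_via_concat[OF k(2)] .
  have "finish Y \<cdot> k = start Y \<cdot> l" using e k l by simp
  then obtain a where "a \<in> Hom M A Q" "p0 \<cdot> a = k" "p1 \<cdot> a = l"
    using Q(1) k l unfolding concat_object_def by blast
  with that[OF Q(1)] Q(2) k l show ?thesis by blast
qed

lemma concat_objectD:
  assumes "concat_object Y Q i p0 p1 m"
  shows "i \<in> Hom M Y Q" "i \<in> Cof M" "i \<in> Weq M"
     "p0 \<in> Hom M Q (paths Y)" "p1 \<in> Hom M Q (paths Y)" "m \<in> Hom M Q (paths Y)"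
     "p0 \<cdot> i = const_path Y" "p1 \<cdot> i = const_path Y" "m \<cdot> i = const_path Y"
     "finish Y \<cdot> p0 = start Y \<cdot> p1" "start Y \<cdot> m = start Y \<cdot> p0" "finish Y \<cdot> m = finish Y \<cdot> p1"
  using assms unfolding concat_object_def by blast+

lemma vcomp_cells:
  assumes \<alpha>: "\<alpha> \<in> cells A Y" and \<beta>: "\<beta> \<in> cells A Y" and e: "tgt \<alpha> = src \<beta>"
  shows "\<beta> \<bullet> \<alpha> \<in> cells A Y" "src (\<beta> \<bullet> \<alpha>) = src \<alpha>" "tgt (\<beta> \<bullet> \<alpha>) = tgt \<beta>"
proof -
  obtain Q i p0 p1 m a where Q: "concat_object Y Q i p0 p1 m" and a: "a \<in> Hom M A Q" "\<alpha> = cell Y (p0 \<cdot> a)" "\<beta> = cell Y (p1 \<cdot> a)"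
    and r: "\<forall>A a. cofibrant M A \<longrightarrow> a \<in> Hom M A Q \<longrightarrow> cell Y (p1 \<cdot> a) \<bullet> cell Y (p0 \<cdot> a) = cell Y (m \<cdot> a)"
    using vcomp_via_concat_cells[OF assms] .
  note q = concat_objectD[OF Q]
  have k: "cofibrant M A" "bifibrant M Y" "Y \<in> Ob M" using \<alpha> by (auto elim: cellsE)
  show "\<beta> \<bullet> \<alpha> \<in> cells A Y" "src (\<beta> \<bullet> \<alpha>) = src \<alpha>" "tgt (\<beta> \<bullet> \<alpha>) = tgt \<beta>"
    using a r[rule_format, OF k(1) a(1)] q k comp_cong[OF q(11)] comp_cong[OF q(12)] by (simp_all add: cellsI)
qed

lemma vcomp_precomp:
  assumes \<alpha>: "\<alpha> \<in> cells A Y" and \<beta>: "\<beta> \<in> cells A Y" and e: "tgt \<alpha> = src \<beta>"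
    and A': "cofibrant M A'" and b: "b \<in> Hom M A' A"
  shows "(\<beta> \<bullet> \<alpha>) \<lhd> b = (\<beta> \<lhd> b) \<bullet> (\<alpha> \<lhd> b)"
proof -
  obtain Q i p0 p1 m a where Q: "concat_object Y Q i p0 p1 m" and a: "a \<in> Hom M A Q" "\<alpha> = cell Y (p0 \<cdot> a)" "\<beta> = cell Y (p1 \<cdot> a)"
    and r: "\<forall>A a. cofibrant M A \<longrightarrow> a \<in> Hom M A Q \<longrightarrow> cell Y (p1 \<cdot> a) \<bullet> cell Y (p0 \<cdot> a) = cell Y (m \<cdot> a)"
    using vcomp_via_concat_cells[OF assms(1-3)] .
  note q = concat_objectD[OF Q]
  have k: "cofibrant M A" "bifibrant M Y" "Y \<in> Ob M" using \<alpha> by (auto elim: cellsE)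
  show ?thesis
    using a r[rule_format, OF k(1) a(1)] r[rule_format, OF A', of "a \<cdot> b"] q k A' b by (simp add: precomp_cell[of A A'])
qed

lemma vcomp_vid_Id:
  assumes Y: "bifibrant M Y"
  shows "vid (Id M Y) \<bullet> vid (Id M Y) = vid (Id M Y)"
proof -
  obtain Q i p0 p1 m where Q: "concat_object Y Q i p0 p1 m"
    "\<forall>A a. cofibrant M A \<longrightarrow> a \<in> Hom M A Q \<longrightarrow> cell Y (p1 \<cdot> a) \<bullet> cell Y (p0 \<cdot> a) = cell Y (m \<cdot> a)"
    using vcomp_via_concat[OF Y] .
  note q = concat_objectD[OF Q(1)]
  show ?thesis using Q(2)[rule_format, OF _ q(1)] Y q by (simp add: vid_def)
qed

lemma vcomp_vid_vid:
  assumes "f \<in> Hom M A Y" "cofibrant M A" and Y: "bifibrant M Y"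
  shows "vid f \<bullet> vid f = vid f"
proof -
  have i: "Id M Y \<in> Hom M Y Y" "cofibrant M Y" using Y by simp_all
  note v = vid_cells[OF i Y]
  show ?thesis
    using vcomp_precomp[OF v(1) v(1) _ assms(2,1)] v vcomp_vid_Id[OF Y] vid_precomp[OF i Y assms(2,1)] assms
    by simp
qed

text \<open>The laws below are identities of two-cells that are natural in the source of one of their
  constituents. They hold by path induction: it suffices to check them for the universal two-cell, or
  the universal composable pair, and there after restriction along the constant paths.\<close>

lemma vcomp_vid:
  assumes \<alpha>: "\<alpha> \<in> cells A Y"
  shows "vid (tgt \<alpha>) \<bullet> \<alpha> = \<alpha>" "\<alpha> \<bullet> vid (src \<alpha>) = \<alpha>"
proof -
  obtain k where k: "cofibrant M A" "bifibrant M Y" "k \<in> Hom M A (paths Y)" "\<alpha> = gen Y \<lhd> k" using cells_gen[OF \<alpha>] .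
  note g = gen_cells[OF k(2)] and vv = vcomp_vid_Id[OF k(2)]
  have Y: "Y \<in> Ob M" "cofibrant M Y" "const_path Y \<in> Hom M Y (paths Y)" "cofibrant M (paths Y)"
      "start Y \<in> Hom M (paths Y) Y" "finish Y \<in> Hom M (paths Y) Y"
    using k by simp_all
  note vf = vid_cells[OF Y(6,4) k(2)] and vs = vid_cells[OF Y(5,4) k(2)]
  note cf = vcomp_cells[OF g(1) vf(1)] and cs = vcomp_cells[OF vs(1) g(1)]
  note pf = vcomp_precomp[OF g(1) vf(1) _ Y(2,3)] and ps = vcomp_precomp[OF vs(1) g(1) _ Y(2,3)]
  have "vid (finish Y) \<bullet> gen Y = gen Y"
    by (rule gen_unique[OF cf(1) g(1)])
      (use pf cf g vf Y k vv vid_precomp[OF Y(6,4) k(2) Y(2,3)] in simp_all)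
  moreover have "gen Y \<bullet> vid (start Y) = gen Y"
    by (rule gen_unique[OF cs(1) g(1)])
      (use ps cs g vs Y k vv vid_precomp[OF Y(5,4) k(2) Y(2,3)] in simp_all)
  ultimately show "vid (tgt \<alpha>) \<bullet> \<alpha> = \<alpha>" "\<alpha> \<bullet> vid (src \<alpha>) = \<alpha>"
    using vcomp_precomp[OF g(1) vf(1) _ k(1,3)] vcomp_precomp[OF vs(1) g(1) _ k(1,3)] g vf vs
      precomp_cells[OF g(1) k(1,3)] vid_precomp[OF Y(6,4) k(2) k(1,3)] vid_precomp[OF Y(5,4) k(2) k(1,3)] k(4)
    by simp_all
qed

lemma vcomp_inverse:
  assumes \<alpha>: "\<alpha> \<in> cells A Y"
  shows "inverse_cell \<alpha> \<bullet> \<alpha> = vid (src \<alpha>)" "\<alpha> \<bullet> inverse_cell \<alpha> = vid (tgt \<alpha>)"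
proof -
  obtain k where k: "cofibrant M A" "bifibrant M Y" "k \<in> Hom M A (paths Y)" "\<alpha> = gen Y \<lhd> k" using cells_gen[OF \<alpha>] .
  note g = gen_cells[OF k(2)] and vv = vcomp_vid_Id[OF k(2)]
  note i = inverse_cells[OF g(1)]
  have Y: "Y \<in> Ob M" "cofibrant M Y" "const_path Y \<in> Hom M Y (paths Y)" "cofibrant M (paths Y)"
      "start Y \<in> Hom M (paths Y) Y" "finish Y \<in> Hom M (paths Y) Y" "Id M Y \<in> Hom M Y Y"
    using k by simp_all
  have ic: "inverse_cell (gen Y) \<lhd> const_path Y = vid (Id M Y)"
    using inverse_precomp[OF g(1) Y(2,3)] g(4) inverse_vid[OF Y(7,2) k(2)] by simp
  note vf = vid_cells[OF Y(6,4) k(2)] and vs = vid_cells[OF Y(5,4) k(2)]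
  note ci = vcomp_cells[OF g(1) i(1)] and cg = vcomp_cells[OF i(1) g(1)]
  note pi = vcomp_precomp[OF g(1) i(1) _ Y(2,3)] and pg = vcomp_precomp[OF i(1) g(1) _ Y(2,3)]
  have "inverse_cell (gen Y) \<bullet> gen Y = vid (start Y)"
    by (rule gen_unique[OF ci(1) vs(1)])
      (use pi ci g i ic vs Y k vv vid_precomp[OF Y(5,4) k(2) Y(2,3)] in simp_all)
  moreover have "gen Y \<bullet> inverse_cell (gen Y) = vid (finish Y)"
    by (rule gen_unique[OF cg(1) vf(1)])
      (use pg cg g i ic vf Y k vv vid_precomp[OF Y(6,4) k(2) Y(2,3)] in simp_all)
  ultimately show "inverse_cell \<alpha> \<bullet> \<alpha> = vid (src \<alpha>)" "\<alpha> \<bullet> inverse_cell \<alpha> = vid (tgt \<alpha>)"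
    using vcomp_precomp[OF g(1) i(1) _ k(1,3)] vcomp_precomp[OF i(1) g(1) _ k(1,3)] g i
      precomp_cells[OF g(1) k(1,3)] vid_precomp[OF Y(6,4) k(2) k(1,3)] vid_precomp[OF Y(5,4) k(2) k(1,3)] k(4)
      inverse_precomp[OF g(1) k(1,3)]
    by simp_all
qed

lemma postcomp_vcomp:
  assumes \<alpha>: "\<alpha> \<in> cells A Y" and \<beta>: "\<beta> \<in> cells A Y" and e: "tgt \<alpha> = src \<beta>"
    and u: "u \<in> Hom M Y Y'" and Y': "bifibrant M Y'"
  shows "u \<rhd> (\<beta> \<bullet> \<alpha>) = (u \<rhd> \<beta>) \<bullet> (u \<rhd> \<alpha>)"
proof -
  obtain Q i p0 p1 m a where Q: "concat_object Y Q i p0 p1 m" and a: "a \<in> Hom M A Q" "\<alpha> = cell Y (p0 \<cdot> a)" "\<beta> = cell Y (p1 \<cdot> a)"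
    using vcomp_via_concat_cells[OF assms(1-3)] .
  note q = concat_objectD[OF Q]
  have k: "cofibrant M A" "bifibrant M Y" "Y \<in> Ob M" "cofibrant M Y" "Id M Y \<in> Hom M Y Y" using \<alpha> by (auto elim: cellsE)
  have cQ: "cofibrant M Q" using cofibrant_cof[OF k(4) q(1,2)] .
  have w: "cell Y p0 \<in> cells Q Y" "cell Y p1 \<in> cells Q Y" "tgt (cell Y p0) = src (cell Y p1)"
    using q cQ k by (simp_all add: cellsI)
  have r: "\<alpha> = cell Y p0 \<lhd> a" "\<beta> = cell Y p1 \<lhd> a" "cell Y p0 \<lhd> i = vid (Id M Y)" "cell Y p1 \<lhd> i = vid (Id M Y)"
    using a q cQ k by (simp_all add: precomp_cell[of Q A] precomp_cell[of Q Y] vid_def)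
  note c = vcomp_cells[OF w]
  note c1 = postcomp_cells[OF c(1) u Y']
  note c0 = postcomp_cells[OF w(1) u Y'] postcomp_cells[OF w(2) u Y']
  have t: "tgt (u \<rhd> cell Y p0) = src (u \<rhd> cell Y p1)" using c0 w by simp
  note c2 = vcomp_cells[OF c0(1,4) t]
  have "u \<rhd> (cell Y p1 \<bullet> cell Y p0) = (u \<rhd> cell Y p1) \<bullet> (u \<rhd> cell Y p0)"
  proof (rule two_cell_unique[OF c1(1) c2(1) _ _ k(4) q(1-3)])
    show "src (u \<rhd> (cell Y p1 \<bullet> cell Y p0)) = src ((u \<rhd> cell Y p1) \<bullet> (u \<rhd> cell Y p0))"
      "tgt (u \<rhd> (cell Y p1 \<bullet> cell Y p0)) = tgt ((u \<rhd> cell Y p1) \<bullet> (u \<rhd> cell Y p0))"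
      using c c0 c1 c2 by simp_all
    show "(u \<rhd> (cell Y p1 \<bullet> cell Y p0)) \<lhd> i = ((u \<rhd> cell Y p1) \<bullet> (u \<rhd> cell Y p0)) \<lhd> i"
      unfolding postcomp_precomp[OF c(1) u Y' k(4) q(1)] vcomp_precomp[OF w k(4) q(1)]
        vcomp_precomp[OF c0(1,4) t k(4) q(1)] postcomp_precomp[OF w(1) u Y' k(4) q(1)]
        postcomp_precomp[OF w(2) u Y' k(4) q(1)] r(3,4) vcomp_vid_Id[OF k(2)]
      using postcomp_vid[OF k(5,4,2) Y' u] vcomp_vid_vid[of "u" Y Y'] u k Y' by simp
  qed
  then show ?thesis unfolding r(1,2)
    vcomp_precomp[OF w k(1) a(1), symmetric] postcomp_precomp[OF w(1) u Y' k(1) a(1), symmetric]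
    postcomp_precomp[OF w(2) u Y' k(1) a(1), symmetric] postcomp_precomp[OF c(1) u Y' k(1) a(1), symmetric]
    vcomp_precomp[OF c0(1,4) t k(1) a(1), symmetric] by simp
qed

text \<open>For an identity \<open>\<alpha>\<close> both sides are \<open>\<beta>\<close>; the general case is path induction on \<open>\<alpha>\<close>.\<close>

lemma interchange:
  assumes \<alpha>: "\<alpha> \<in> cells A B" and \<beta>: "\<beta> \<in> cells B Y"
  shows "(\<beta> \<lhd> tgt \<alpha>) \<bullet> (src \<beta> \<rhd> \<alpha>) = (tgt \<beta> \<rhd> \<alpha>) \<bullet> (\<beta> \<lhd> src \<alpha>)"
proof -
  obtain k where k: "cofibrant M A" "bifibrant M B" "k \<in> Hom M A (paths B)" "\<alpha> = gen B \<lhd> k" using cells_gen[OF \<alpha>] .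
  have Y: "bifibrant M Y" using \<beta> by (auto elim: cellsE)
  note g = gen_cells[OF k(2)] and e = cells_ends[OF \<beta>]
  have B: "B \<in> Ob M" "cofibrant M B" "const_path B \<in> Hom M B (paths B)" "cofibrant M (paths B)"
      "start B \<in> Hom M (paths B) B" "finish B \<in> Hom M (paths B) B" "Id M B \<in> Hom M B B"
    using k by simp_all
  note s = postcomp_cells[OF g(1) e(1) Y] and t = postcomp_cells[OF g(1) e(2) Y]
  note bs = precomp_cells[OF \<beta> B(4,5)] and bf = precomp_cells[OF \<beta> B(4,6)]
  have L: "tgt (src \<beta> \<rhd> gen B) = src (\<beta> \<lhd> finish B)" using s bf g by simp
  have R: "tgt (\<beta> \<lhd> start B) = src (tgt \<beta> \<rhd> gen B)" using t bs g by simp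
  note cL = vcomp_cells[OF s(1) bf(1) L] and cR = vcomp_cells[OF bs(1) t(1) R]
  have "(\<beta> \<lhd> finish B) \<bullet> (src \<beta> \<rhd> gen B) = (tgt \<beta> \<rhd> gen B) \<bullet> (\<beta> \<lhd> start B)"
  proof (rule gen_unique[OF cL(1) cR(1) _ _ k(2)])
    show "src ((\<beta> \<lhd> finish B) \<bullet> (src \<beta> \<rhd> gen B)) = src ((tgt \<beta> \<rhd> gen B) \<bullet> (\<beta> \<lhd> start B))"
      "tgt ((\<beta> \<lhd> finish B) \<bullet> (src \<beta> \<rhd> gen B)) = tgt ((tgt \<beta> \<rhd> gen B) \<bullet> (\<beta> \<lhd> start B))"
      using cL cR s t bs bf g by simp_all
    show "((\<beta> \<lhd> finish B) \<bullet> (src \<beta> \<rhd> gen B)) \<lhd> const_path B = ((tgt \<beta> \<rhd> gen B) \<bullet> (\<beta> \<lhd> start B)) \<lhd> const_path B"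
      unfolding vcomp_precomp[OF s(1) bf(1) L B(2,3)] vcomp_precomp[OF bs(1) t(1) R B(2,3)]
        postcomp_precomp[OF g(1) e(1) Y B(2,3)] postcomp_precomp[OF g(1) e(2) Y B(2,3)] g(4)
        precomp_precomp[OF \<beta> B(4,5) B(2,3)] precomp_precomp[OF \<beta> B(4,6) B(2,3)]
        postcomp_vid[OF B(7,2) k(2) Y e(1)] postcomp_vid[OF B(7,2) k(2) Y e(2)]
      using vcomp_vid[OF \<beta>] precomp_Id[OF \<beta>] B e by simp
  qed
  then show ?thesis
    unfolding k(4) using vcomp_precomp[OF s(1) bf(1) L k(1,3)] vcomp_precomp[OF bs(1) t(1) R k(1,3)]
        postcomp_precomp[OF g(1) e(1) Y k(1,3)] postcomp_precomp[OF g(1) e(2) Y k(1,3)]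
        precomp_precomp[OF \<beta> B(4,5) k(1,3)] precomp_precomp[OF \<beta> B(4,6) k(1,3)]
        precomp_cells[OF g(1) k(1,3)] g by simp
qed

lemma cylinder_cofibrant:
  assumes "cofibrant M A" "is_cylinder M A c"
  shows "cofibrant M (cyl_ob M c)"
  using cofibrant_cof[OF assms(1) cylinder_arr(1)[OF assms(2)]] inc_tcof[OF assms] by simp

text \<open>Any two-cell can be contracted to its target along a cylinder. This reduces an identity that
  involves it, with the other two-cells starting at its target held fixed, to the case of an
  identity two-cell. Associativity, where no single universal two-cell is available, is proved in
  this way.\<close>

lemma cell_contract:
  assumes \<alpha>: "\<alpha> \<in> cells A Y" and c: "is_cylinder M A c"
  obtains K where "K \<in> cells (cyl_ob M c) Y" "tgt K = tgt \<alpha> \<cdot> proj c" "K \<lhd> inc0 c = \<alpha>" "K \<lhd> inc1 c = vid (tgt \<alpha>)"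
proof -
  obtain k where k: "cofibrant M A" "bifibrant M Y" "k \<in> Hom M A (paths Y)" "\<alpha> = cell Y k" using cellsE[OF \<alpha>] .
  have Y: "Y \<in> Ob M" "fibrant M Y" using k by simp_all
  note ca = cylinder_arr[OF c] and e = cells_ends[OF \<alpha>]
  have f: "finish Y \<in> Hom M (paths Y) Y" using Y by simp
  have l1: "const_path Y \<cdot> tgt \<alpha> \<in> Hom M A (paths Y)" and z: "tgt \<alpha> \<cdot> proj c \<in> Hom M (cyl_ob M c) Y"
    using e ca Y by simp_all
  obtain L where L: "L \<in> Hom M (cyl_ob M c) (paths Y)" "L \<cdot> inc0 c = k" "L \<cdot> inc1 c = const_path Y \<cdot> tgt \<alpha>"
      "finish Y \<cdot> L = tgt \<alpha> \<cdot> proj c"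
    by (rule cylinder_lift[OF c f ev_tfib(3,4)[OF Y(2)] k(3) l1 z]) (use k e ca Y in simp_all)
  have cc: "cofibrant M (cyl_ob M c)" using cylinder_cofibrant k c by blast
  show ?thesis
    by (rule that[of "cell Y L"])
      (use L cc k ca e in \<open>simp_all add: cellsI precomp_cell[of "cyl_ob M c" A] vid_def\<close>)
qed

lemma vcomp_assoc:
  assumes \<alpha>: "\<alpha> \<in> cells A Y" and \<beta>: "\<beta> \<in> cells A Y" and \<gamma>: "\<gamma> \<in> cells A Y"
    and e: "tgt \<alpha> = src \<beta>" "tgt \<beta> = src \<gamma>"
  shows "(\<gamma> \<bullet> \<beta>) \<bullet> \<alpha> = \<gamma> \<bullet> (\<beta> \<bullet> \<alpha>)"
proof -
  have k: "cofibrant M A" "bifibrant M Y" "A \<in> Ob M" using \<alpha> by (auto elim: cellsE)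
  obtain c where c: "is_cylinder M A c" using cylinder_exists[OF k(3)] .
  note ca = cylinder_arr[OF c] 
  have C: "cofibrant M (cyl_ob M c)" using cylinder_cofibrant k c by blast
  obtain K where K: "K \<in> cells (cyl_ob M c) Y" "tgt K = tgt \<alpha> \<cdot> proj c" "K \<lhd> inc0 c = \<alpha>" "K \<lhd> inc1 c = vid (tgt \<alpha>)"
    using cell_contract[OF \<alpha> c] .
  let ?b = "\<beta> \<lhd> proj c" and ?g = "\<gamma> \<lhd> proj c"
  note b = precomp_cells[OF \<beta> C ca(3)] and g = precomp_cells[OF \<gamma> C ca(3)]
  have bg: "tgt ?b = src ?g" and kb: "tgt K = src ?b" using b g K e by simp_all
  note gb = vcomp_cells[OF b(1) g(1) bg] and bk = vcomp_cells[OF K(1) b(1) kb]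
  have 1: "tgt K = src (?g \<bullet> ?b)" and 2: "tgt (?b \<bullet> K) = src ?g" using gb bk kb bg by simp_all
  note l = vcomp_cells[OF K(1) gb(1) 1] and r = vcomp_cells[OF bk(1) g(1) 2]
  note p1 = vcomp_precomp[OF K(1) gb(1) 1 k(1)] vcomp_precomp[OF bk(1) g(1) 2 k(1)]
    vcomp_precomp[OF b(1) g(1) bg k(1)] vcomp_precomp[OF K(1) b(1) kb k(1)]
    precomp_precomp[OF \<beta> C ca(3) k(1)] precomp_precomp[OF \<gamma> C ca(3) k(1)]
  have "(?g \<bullet> ?b) \<bullet> K = ?g \<bullet> (?b \<bullet> K)"
  proof (rule two_cell_unique[OF l(1) r(1) _ _ k(1) ca(2) inc_tcof(3,4)[OF k(1) c]])
    show "src ((?g \<bullet> ?b) \<bullet> K) = src (?g \<bullet> (?b \<bullet> K))" "tgt ((?g \<bullet> ?b) \<bullet> K) = tgt (?g \<bullet> (?b \<bullet> K))"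
      using l r gb bk by simp_all
    show "((?g \<bullet> ?b) \<bullet> K) \<lhd> inc1 c = (?g \<bullet> (?b \<bullet> K)) \<lhd> inc1 c"
      unfolding p1[OF ca(2)] K(4) ca(5) precomp_Id[OF \<beta>] precomp_Id[OF \<gamma>] e
      using vcomp_vid(2)[OF \<beta>] vcomp_vid(2)[OF vcomp_cells(1)[OF \<beta> \<gamma> e(2)]] vcomp_cells[OF \<beta> \<gamma> e(2)] by simp
  qed
  then have "((?g \<bullet> ?b) \<bullet> K) \<lhd> inc0 c = (?g \<bullet> (?b \<bullet> K)) \<lhd> inc0 c" by simp
  then show ?thesis
    unfolding p1[OF ca(1)] K(3) ca(4) precomp_Id[OF \<beta>] precomp_Id[OF \<gamma>] .
qed

section \<open>Homotopies as two-cells\<close>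

text \<open>The two-cell of a left homotopy \<open>z\<close>: the unique two-cell on the cylinder from
  \<open>z \<cdot> inc0 \<cdot> proj\<close> to \<open>z\<close> that is the identity at the bottom, evaluated at the top.\<close>

definition cell_of where
  "cell_of c z = (SOME \<Lambda>. \<Lambda> \<in> cells (cyl_ob M c) (Cod M z) \<and> src \<Lambda> = (z \<cdot> inc0 c) \<cdot> proj c \<and> tgt \<Lambda> = z \<and>
     \<Lambda> \<lhd> inc0 c = vid (z \<cdot> inc0 c)) \<lhd> inc1 c"

lemma cell_of_fill_exists:
  assumes A: "cofibrant M A" and Y: "bifibrant M Y" and c: "is_cylinder M A c" and z: "z \<in> Hom M (cyl_ob M c) Y"
  obtains \<Lambda> where "\<Lambda> \<in> cells (cyl_ob M c) Y" "src \<Lambda> = (z \<cdot> inc0 c) \<cdot> proj c" "tgt \<Lambda> = z" "\<Lambda> \<lhd> inc0 c = vid (z \<cdot> inc0 c)"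
proof -
  note ca = cylinder_arr[OF c]
  have z0: "z \<cdot> inc0 c \<in> Hom M A Y" "(z \<cdot> inc0 c) \<cdot> proj c \<in> Hom M (cyl_ob M c) Y" using z ca by simp_all
  note v = vid_cells[OF z0(1) A Y]
  show ?thesis
    by (rule two_cell_extend[OF v(1) ca(1) inc_tcof(1,2)[OF A c] z0(2) z _ _ that]) (use v ca z in simp_all)
qed

lemma cell_of_eqI:
  assumes A: "cofibrant M A" and Y: "bifibrant M Y" and c: "is_cylinder M A c" and z: "z \<in> Hom M (cyl_ob M c) Y"
    and L: "\<Lambda> \<in> cells (cyl_ob M c) Y" "src \<Lambda> = (z \<cdot> inc0 c) \<cdot> proj c" "tgt \<Lambda> = z" "\<Lambda> \<lhd> inc0 c = vid (z \<cdot> inc0 c)"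
  shows "cell_of c z = \<Lambda> \<lhd> inc1 c"
proof -
  have "Cod M z = Y" using z by simp
  have "(SOME \<Lambda>. \<Lambda> \<in> cells (cyl_ob M c) (Cod M z) \<and> src \<Lambda> = (z \<cdot> inc0 c) \<cdot> proj c \<and> tgt \<Lambda> = z \<and>
     \<Lambda> \<lhd> inc0 c = vid (z \<cdot> inc0 c)) = \<Lambda>"
    unfolding \<open>Cod M z = Y\<close>
  proof (rule some_equality)
    fix \<Lambda>' assume "\<Lambda>' \<in> cells (cyl_ob M c) Y \<and> src \<Lambda>' = (z \<cdot> inc0 c) \<cdot> proj c \<and> tgt \<Lambda>' = z \<and>
      \<Lambda>' \<lhd> inc0 c = vid (z \<cdot> inc0 c)"
    then show "\<Lambda>' = \<Lambda>"
      by (intro two_cell_unique[OF _ L(1) _ _ A cylinder_arr(1)[OF c] inc_tcof(1,2)[OF A c]]) (use L in simp_all)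
  qed (use L in simp)
  then show ?thesis by (simp add: cell_of_def)
qed

lemma cell_of_cells:
  assumes A: "cofibrant M A" and Y: "bifibrant M Y" and c: "is_cylinder M A c" and z: "z \<in> Hom M (cyl_ob M c) Y"
  shows "cell_of c z \<in> cells A Y" "src (cell_of c z) = z \<cdot> inc0 c" "tgt (cell_of c z) = z \<cdot> inc1 c"
proof -
  note ca = cylinder_arr[OF c]
  obtain \<Lambda> where L: "\<Lambda> \<in> cells (cyl_ob M c) Y" "src \<Lambda> = (z \<cdot> inc0 c) \<cdot> proj c" "tgt \<Lambda> = z" "\<Lambda> \<lhd> inc0 c = vid (z \<cdot> inc0 c)"
    using cell_of_fill_exists[OF assms] .
  show "cell_of c z \<in> cells A Y" "src (cell_of c z) = z \<cdot> inc0 c" "tgt (cell_of c z) = z \<cdot> inc1 c"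
    unfolding cell_of_eqI[OF assms L] using precomp_cells[OF L(1) A ca(2)] L ca z by simp_all
qed

lemma postcomp_cell_of:
  assumes A: "cofibrant M A" and Y: "bifibrant M Y" and c: "is_cylinder M A c" and z: "z \<in> Hom M (cyl_ob M c) Y"
    and u: "u \<in> Hom M Y Y'" and Y': "bifibrant M Y'"
  shows "u \<rhd> cell_of c z = cell_of c (u \<cdot> z)"
proof -
  note ca = cylinder_arr[OF c]
  obtain \<Lambda> where L: "\<Lambda> \<in> cells (cyl_ob M c) Y" "src \<Lambda> = (z \<cdot> inc0 c) \<cdot> proj c" "tgt \<Lambda> = z" "\<Lambda> \<lhd> inc0 c = vid (z \<cdot> inc0 c)"
    using cell_of_fill_exists[OF assms(1-4)] .
  note p = postcomp_cells[OF L(1) u Y']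
  have uz: "u \<cdot> z \<in> Hom M (cyl_ob M c) Y'" using u z by simp
  have z0: "z \<cdot> inc0 c \<in> Hom M A Y" using z ca by simp
  have "cell_of c (u \<cdot> z) = (u \<rhd> \<Lambda>) \<lhd> inc1 c"
    by (rule cell_of_eqI[OF A Y' c uz p(1)])
      (use p L u z ca postcomp_precomp[OF L(1) u Y' A ca(1)] postcomp_vid[OF z0 A Y Y' u] in simp_all)
  then show ?thesis using cell_of_eqI[OF assms(1-4) L] postcomp_precomp[OF L(1) u Y' A ca(2)] by simp
qed

lemma cell_of_const:
  assumes A: "cofibrant M A" and Y: "bifibrant M Y" and c: "is_cylinder M A c" and f: "f \<in> Hom M A Y"
  shows "cell_of c (f \<cdot> proj c) = vid f"
proof -
  note ca = cylinder_arr[OF c]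
  have C: "cofibrant M (cyl_ob M c)" using cylinder_cofibrant A c by blast
  have fp: "f \<cdot> proj c \<in> Hom M (cyl_ob M c) Y" using f ca by simp
  have "cell_of c (f \<cdot> proj c) = vid (f \<cdot> proj c) \<lhd> inc1 c"
    by (rule cell_of_eqI[OF A Y c fp])
      (use vid_cells[OF fp C Y] vid_precomp[OF fp C Y A ca(1)] f ca in simp_all)
  then show ?thesis using vid_precomp[OF fp C Y A ca(2)] f ca by simp
qed

text \<open>The converse passage: a path is moved, along a cylinder and with its start fixed, from the constant path
  to itself; the other end of the moving path traces the homotopy.\<close>

lemma cells_are_homotopies:
  assumes \<alpha>: "\<alpha> \<in> cells A Y" and c: "is_cylinder M A c"
  obtains z where "z \<in> Hom M (cyl_ob M c) Y" "z \<cdot> inc0 c = src \<alpha>" "z \<cdot> inc1 c = tgt \<alpha>" "cell_of c z = \<alpha>"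
proof -
  obtain k where k: "cofibrant M A" "bifibrant M Y" "k \<in> Hom M A (paths Y)" "\<alpha> = cell Y k" using cellsE[OF \<alpha>] .
  have Y: "Y \<in> Ob M" "fibrant M Y" using k by simp_all
  note ca = cylinder_arr[OF c] and e = cells_ends[OF \<alpha>]
  have C: "cofibrant M (cyl_ob M c)" using cylinder_cofibrant k c by blast
  have f: "start Y \<in> Hom M (paths Y) Y" using Y by simp
  have l1: "const_path Y \<cdot> src \<alpha> \<in> Hom M A (paths Y)" and z: "src \<alpha> \<cdot> proj c \<in> Hom M (cyl_ob M c) Y"
    using e ca Y by simp_all
  obtain L where L: "L \<in> Hom M (cyl_ob M c) (paths Y)" "L \<cdot> inc0 c = const_path Y \<cdot> src \<alpha>" "L \<cdot> inc1 c = k"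
      "start Y \<cdot> L = src \<alpha> \<cdot> proj c"
    by (rule cylinder_lift[OF c f ev_tfib(1,2)[OF Y(2)] l1 k(3) z]) (use k e ca Y in simp_all)
  let ?z = "finish Y \<cdot> L"
  have z: "?z \<in> Hom M (cyl_ob M c) Y" "?z \<cdot> inc0 c = src \<alpha>" "?z \<cdot> inc1 c = tgt \<alpha>"
    using L Y ca e k by simp_all
  have "cell_of c ?z = cell Y L \<lhd> inc1 c"
    by (rule cell_of_eqI[OF k(1,2) c z(1)])
      (use L z k e ca C Y in \<open>simp_all add: cellsI precomp_cell[of "cyl_ob M c" A] vid_def\<close>)
  also have "\<dots> = \<alpha>" using L k C ca by (simp add: precomp_cell[of "cyl_ob M c" A])
  finally show ?thesis using z that by blast
qed

text \<open>Interchange with a homotopy \<open>z\<close> whose target is merely cofibrant, so that \<open>z\<close> has no two-cell of its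
  own. It is applied to the homotopy inside a double mapping cylinder.\<close>

lemma interchange_homotopy:
  assumes A: "cofibrant M A" and c: "is_cylinder M A c" and z: "z \<in> Hom M (cyl_ob M c) B" and \<beta>: "\<beta> \<in> cells B Y"
  shows "(\<beta> \<lhd> (z \<cdot> inc1 c)) \<bullet> cell_of c (src \<beta> \<cdot> z) = cell_of c (tgt \<beta> \<cdot> z) \<bullet> (\<beta> \<lhd> (z \<cdot> inc0 c))"
proof -
  have k: "cofibrant M B" "bifibrant M Y" using \<beta> by (auto elim: cellsE)
  note ca = cylinder_arr[OF c] and e = cells_ends[OF \<beta>]
  have C: "cofibrant M (cyl_ob M c)" using cylinder_cofibrant A c by blast
  have sz: "src \<beta> \<cdot> z \<in> Hom M (cyl_ob M c) Y" and tz: "tgt \<beta> \<cdot> z \<in> Hom M (cyl_ob M c) Y" using e z by simp_all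
  have z0: "z \<cdot> inc0 c \<in> Hom M A B" and zp: "(z \<cdot> inc0 c) \<cdot> proj c \<in> Hom M (cyl_ob M c) B" using z ca by simp_all
  obtain S where S: "S \<in> cells (cyl_ob M c) Y" "src S = ((src \<beta> \<cdot> z) \<cdot> inc0 c) \<cdot> proj c" "tgt S = src \<beta> \<cdot> z"
      "S \<lhd> inc0 c = vid ((src \<beta> \<cdot> z) \<cdot> inc0 c)" using cell_of_fill_exists[OF A k(2) c sz] .
  obtain T where T: "T \<in> cells (cyl_ob M c) Y" "src T = ((tgt \<beta> \<cdot> z) \<cdot> inc0 c) \<cdot> proj c" "tgt T = tgt \<beta> \<cdot> z"
      "T \<lhd> inc0 c = vid ((tgt \<beta> \<cdot> z) \<cdot> inc0 c)" using cell_of_fill_exists[OF A k(2) c tz] .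
  note bz = precomp_cells[OF \<beta> C z] and b0 = precomp_cells[OF \<beta> C zp] and b0' = precomp_cells[OF \<beta> A z0]
  have 1: "tgt S = src (\<beta> \<lhd> z)" and 2: "tgt (\<beta> \<lhd> ((z \<cdot> inc0 c) \<cdot> proj c)) = src T" using S T bz b0 e z ca by simp_all
  note l = vcomp_cells[OF S(1) bz(1) 1] and r = vcomp_cells[OF b0(1) T(1) 2]
  note p = vcomp_precomp[OF S(1) bz(1) 1 A] vcomp_precomp[OF b0(1) T(1) 2 A] precomp_precomp[OF \<beta> C z A] precomp_precomp[OF \<beta> C zp A]
  have "(\<beta> \<lhd> z) \<bullet> S = T \<bullet> (\<beta> \<lhd> ((z \<cdot> inc0 c) \<cdot> proj c))"
  proof (rule two_cell_unique[OF l(1) r(1) _ _ A ca(1) inc_tcof(1,2)[OF A c]])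
    show "src ((\<beta> \<lhd> z) \<bullet> S) = src (T \<bullet> (\<beta> \<lhd> ((z \<cdot> inc0 c) \<cdot> proj c)))"
      "tgt ((\<beta> \<lhd> z) \<bullet> S) = tgt (T \<bullet> (\<beta> \<lhd> ((z \<cdot> inc0 c) \<cdot> proj c)))"
      using l r S T bz b0 e z ca by simp_all
    show "((\<beta> \<lhd> z) \<bullet> S) \<lhd> inc0 c = (T \<bullet> (\<beta> \<lhd> ((z \<cdot> inc0 c) \<cdot> proj c))) \<lhd> inc0 c"
      unfolding p[OF ca(1)] S(4) T(4)
      using vcomp_vid[OF b0'(1)] b0' e z ca by simp
  qed
  then have "((\<beta> \<lhd> z) \<bullet> S) \<lhd> inc1 c = (T \<bullet> (\<beta> \<lhd> ((z \<cdot> inc0 c) \<cdot> proj c))) \<lhd> inc1 c" by simp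
  then show ?thesis
    unfolding p[OF ca(2)] cell_of_eqI[OF A k(2) c sz S] cell_of_eqI[OF A k(2) c tz T] using z ca by simp
qed

end

context closed_model_category begin

lemma homotopic_iff:
  assumes A: "cofibrant M A" and Y: "bifibrant M Y" and fg: "f \<in> Hom M A Y" "g \<in> Hom M A Y"
  shows "homotopic M f g \<longleftrightarrow> (\<exists>\<alpha>\<in>cells A Y. src \<alpha> = f \<and> tgt \<alpha> = g)"
proof
  assume "homotopic M f g"
  then obtain c h A' B' where h: "f \<in> Hom M A' B'" "is_cylinder M A' c" "h \<in> Hom M (cyl_ob M c) B'" "h \<cdot> inc0 c = f" "h \<cdot> inc1 c = g"
    unfolding homotopic_def is_homotopy_def by blast
  have "A' = A" "B' = Y" using h(1) fg by simp_all
  then have c: "is_cylinder M A c" and h': "h \<in> Hom M (cyl_ob M c) Y" using h by simp_all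
  from cell_of_cells[OF A Y c h'] h show "\<exists>\<alpha>\<in>cells A Y. src \<alpha> = f \<and> tgt \<alpha> = g" by metis
next
  assume "\<exists>\<alpha>\<in>cells A Y. src \<alpha> = f \<and> tgt \<alpha> = g"
  then obtain \<alpha> where a: "\<alpha> \<in> cells A Y" "src \<alpha> = f" "tgt \<alpha> = g" by blast
  obtain c where c: "is_cylinder M A c" using cylinder_exists cofibrant_Ob[OF A] by blast
  obtain z where "z \<in> Hom M (cyl_ob M c) Y" "z \<cdot> inc0 c = src \<alpha>" "z \<cdot> inc1 c = tgt \<alpha>"
    using cells_are_homotopies[OF a(1) c] by blast
  with a c fg show "homotopic M f g" unfolding homotopic_def is_homotopy_def by blast
qed

subsection \<open>Weak equivalences and two-cells\<close>

lemma weq_factor: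
  assumes w: "w \<in> Hom M Z D" "w \<in> Weq M" and D: "cofibrant M D"
  obtains Z' i p s where "i \<in> Hom M Z Z'" "i \<in> Cof M" "i \<in> Weq M" "p \<in> Hom M Z' D" "p \<in> Fib M" "p \<in> Weq M"
    "w = p \<cdot> i" "s \<in> Hom M D Z'" "p \<cdot> s = Id M D"
proof -
  obtain Z' i p where Z': "i \<in> Hom M Z Z'" "p \<in> Hom M Z' D" "w = p \<cdot> i" "i \<in> Cof M" "p \<in> Fib M" "p \<in> Weq M"
    using CM5_cof_tfib[OF w(1)] by blast
  have i: "i \<in> Weq M" using weq_right[OF Z'(6) _ Z'(1,2)] Z' w by simp
  have "Id M D \<in> Hom M D D" using D by simp
  from cofibrant_lift[OF D Z'(2,5,6) this] obtain s where "s \<in> Hom M D Z'" "p \<cdot> s = Id M D" .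
  with that Z' i show ?thesis by blast
qed

text \<open>A section of an acyclic fibration is a homotopy inverse, by a homotopy that stays in the fibres.\<close>

lemma cell_along_section:
  assumes p: "p \<in> Hom M Z' D" "p \<in> Fib M" "p \<in> Weq M" and s: "s \<in> Hom M D Z'" "p \<cdot> s = Id M D"
    and Z': "cofibrant M Z'"
  obtains c e where "is_cylinder M Z' c" "e \<in> Hom M (cyl_ob M c) Z'" "e \<cdot> inc0 c = s \<cdot> p" "e \<cdot> inc1 c = Id M Z'" "p \<cdot> e = p \<cdot> proj c"
proof -
  obtain c where c: "is_cylinder M Z' c" using cylinder_exists cofibrant_Ob[OF Z'] by blast
  note ca = cylinder_arr[OF c]
  have 1: "s \<cdot> p \<in> Hom M Z' Z'" "Id M Z' \<in> Hom M Z' Z'" "p \<cdot> proj c \<in> Hom M (cyl_ob M c) D" using s p ca Z' by simp_all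
  show ?thesis
    by (rule cylinder_lift[OF c p 1]) (use that c s p ca comp_cong[OF s(2)] in simp_all)
qed

text \<open>A weak equivalence between cofibrant objects factors as an acyclic cofibration followed by an
  acyclic fibration with a section. Along the first factor maps and two-cells extend; along the
  second they descend by the section.\<close>

lemma weq_extend_map:
  assumes w: "w \<in> Hom M Z D" "w \<in> Weq M" and Z: "cofibrant M Z" and D: "cofibrant M D" and T: "bifibrant M T"
    and m: "m \<in> Hom M Z T"
  obtains t \<Theta> where "t \<in> Hom M D T" "\<Theta> \<in> cells Z T" "src \<Theta> = t \<cdot> w" "tgt \<Theta> = m"
proof -
  obtain Z' i p s where i: "i \<in> Hom M Z Z'" "i \<in> Cof M" "i \<in> Weq M" and p: "p \<in> Hom M Z' D" "p \<in> Fib M" "p \<in> Weq M"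
    and wp: "w = p \<cdot> i" and s: "s \<in> Hom M D Z'" "p \<cdot> s = Id M D"
    using weq_factor[OF w D] .
  have Z': "cofibrant M Z'" using cofibrant_cof[OF Z i(1,2)] .
  have "fibrant M T" using T by simp
  from fibrant_extend[OF this i m] obtain m' where m': "m' \<in> Hom M Z' T" "m' \<cdot> i = m" .
  obtain c e where c: "is_cylinder M Z' c" and e: "e \<in> Hom M (cyl_ob M c) Z'" "e \<cdot> inc0 c = s \<cdot> p" "e \<cdot> inc1 c = Id M Z'"
    using cell_along_section[OF p s Z'] by blast
  note ca = cylinder_arr[OF c]
  have me: "m' \<cdot> e \<in> Hom M (cyl_ob M c) T" using m' e by simp
  note k = cell_of_cells[OF Z' T c me]
  note k' = precomp_cells[OF k(1) Z i(1)]
  show ?thesis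
    by (rule that[of "m' \<cdot> s", OF _ k'(1)]) (use k k' m' s e ca i p wp in simp_all)
qed

lemma weq_extend_cell:
  assumes w: "w \<in> Hom M Z D" "w \<in> Weq M" and D: "cofibrant M D"
    and G: "\<Gamma> \<in> cells Z T" "t \<in> Hom M D T" "t' \<in> Hom M D T" "src \<Gamma> = t \<cdot> w" "tgt \<Gamma> = t' \<cdot> w"
  obtains \<gamma> where "\<gamma> \<in> cells D T" "src \<gamma> = t" "tgt \<gamma> = t'" "\<gamma> \<lhd> w = \<Gamma>"
proof -
  obtain Z' i p s where i: "i \<in> Hom M Z Z'" "i \<in> Cof M" "i \<in> Weq M" and p: "p \<in> Hom M Z' D" "p \<in> Fib M" "p \<in> Weq M"
    and wp: "w = p \<cdot> i" and s: "s \<in> Hom M D Z'" "p \<cdot> s = Id M D"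
    using weq_factor[OF w D] .
  have Z: "cofibrant M Z" and T: "bifibrant M T" using G(1) by (auto elim: cellsE)
  have Z': "cofibrant M Z'" using cofibrant_cof[OF Z i(1,2)] .
  have tp: "t \<cdot> p \<in> Hom M Z' T" "t' \<cdot> p \<in> Hom M Z' T" using G p by simp_all
  obtain \<Gamma>' where G': "\<Gamma>' \<in> cells Z' T" "src \<Gamma>' = t \<cdot> p" "tgt \<Gamma>' = t' \<cdot> p" "\<Gamma>' \<lhd> i = \<Gamma>"
    by (rule two_cell_extend[OF G(1) i tp]) (use G wp i p that in simp_all)
  obtain c e where c: "is_cylinder M Z' c" and e: "e \<in> Hom M (cyl_ob M c) Z'" "e \<cdot> inc0 c = s \<cdot> p" "e \<cdot> inc1 c = Id M Z'" "p \<cdot> e = p \<cdot> proj c"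
    using cell_along_section[OF p s Z'] by blast
  note ca = cylinder_arr[OF c]
  have "src \<Gamma>' \<cdot> e = (t \<cdot> p) \<cdot> proj c" "tgt \<Gamma>' \<cdot> e = (t' \<cdot> p) \<cdot> proj c" using G' e p G ca by simp_all
  then have "(\<Gamma>' \<lhd> Id M Z') \<bullet> vid (t \<cdot> p) = vid (t' \<cdot> p) \<bullet> (\<Gamma>' \<lhd> (s \<cdot> p))"
    using interchange_homotopy[OF Z' c e(1) G'(1)] cell_of_const[OF Z' T c tp(1)] cell_of_const[OF Z' T c tp(2)] e by simp
  moreover have sp: "s \<cdot> p \<in> Hom M Z' Z'" using s p by simp
  note gs = precomp_cells[OF G'(1) Z' sp]
  have "tgt (\<Gamma>' \<lhd> (s \<cdot> p)) = t' \<cdot> p" using gs G' s p G comp_cong[OF s(2)] by simp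
  ultimately have sp': "\<Gamma>' = \<Gamma>' \<lhd> (s \<cdot> p)"
    using precomp_Id[OF G'(1)] vcomp_vid[OF G'(1)] vcomp_vid(1)[OF gs(1)] G' by simp
  note g = precomp_cells[OF G'(1) D s(1)]
  have "(\<Gamma>' \<lhd> s) \<lhd> w = (\<Gamma>' \<lhd> (s \<cdot> p)) \<lhd> i"
    using precomp_precomp[OF G'(1) D s(1) Z w(1)] precomp_precomp[OF G'(1) Z' sp Z i(1)] wp s p i by simp
  then have "(\<Gamma>' \<lhd> s) \<lhd> w = \<Gamma>" using sp' G' by simp
  then show ?thesis using that[OF g(1)] g G' G s p by simp
qed

lemma weq_homotopy_invariant:
  assumes A: "cofibrant M A" and \<alpha>: "\<alpha> \<in> cells A Y" and w: "tgt \<alpha> \<in> Weq M"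
  shows "src \<alpha> \<in> Weq M"
proof -
  obtain c where c: "is_cylinder M A c" using cylinder_exists cofibrant_Ob[OF A] by blast
  note ca = cylinder_arr[OF c] and it = inc_tcof[OF A c]
  obtain z where z: "z \<in> Hom M (cyl_ob M c) Y" "z \<cdot> inc0 c = src \<alpha>" "z \<cdot> inc1 c = tgt \<alpha>"
    using cells_are_homotopies[OF \<alpha> c] by blast
  have "z \<in> Weq M" using weq_left[OF it(4) _ ca(2) z(1)] z w by simp
  then show ?thesis using weq_comp[OF it(2) _ ca(1) z(1)] z by simp
qed

text \<open>After an acyclic cofibration is split off, the map is a fibration \<open>p\<close> and a homotopy equivalence.
  Lifting the homotopy gives a strict section \<open>s\<close> with \<open>s \<cdot> p\<close> homotopic to the identity, hence a
  weak equivalence, and \<open>p\<close> is a retract of \<open>s \<cdot> p\<close>.\<close>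

lemma homotopy_equivalence_weq:
  assumes X: "bifibrant M X" and Y: "bifibrant M Y" and f: "f \<in> Hom M X Y" and r: "r \<in> Hom M Y X"
    and a: "\<alpha> \<in> cells X X" "src \<alpha> = r \<cdot> f" "tgt \<alpha> = Id M X"
    and b: "\<beta> \<in> cells Y Y" "src \<beta> = f \<cdot> r" "tgt \<beta> = Id M Y"
  shows "f \<in> Weq M"
proof -
  obtain W i p where W: "i \<in> Hom M X W" "p \<in> Hom M W Y" "f = p \<cdot> i" "i \<in> Cof M" "i \<in> Weq M" "p \<in> Fib M"
    using CM5_tcof_fib[OF f] by blast
  have cW: "cofibrant M W" using cofibrant_cof[OF _ W(1,4)] X by simp
  have fW: "fibrant M W" using fibrant_fib[OF _ W(2,6)] Y by simp
  have bW: "bifibrant M W" using cW fW by (rule bifibrantI)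
  have c: "cofibrant M X" "cofibrant M Y" "fibrant M X" "X \<in> Ob M" "Y \<in> Ob M" "W \<in> Ob M" using X Y fW by simp_all
  have idX: "Id M X \<in> Hom M X X" using c by simp
  obtain l where l: "l \<in> Hom M W X" "l \<cdot> i = Id M X"
    using fibrant_extend[OF c(3) W(1,4,5) idX] .
  have il: "i \<cdot> l \<in> Hom M W W" "Id M W \<in> Hom M W W" using W l c by simp_all
  note vi = vid_cells[OF W(1) c(1) bW]
  obtain \<Lambda> where L: "\<Lambda> \<in> cells W W" "src \<Lambda> = i \<cdot> l" "tgt \<Lambda> = Id M W"
    by (rule two_cell_extend[OF vi(1) W(1,4,5) il]) (use vi W l that in simp_all)
  \<comment> \<open>The homotopy section \<open>i \<cdot> r\<close> of \<open>p\<close> is improved to a strict one by lifting the homotopy.\<close>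
  obtain c' where c': "is_cylinder M Y c'" using cylinder_exists c by blast
  note ca = cylinder_arr[OF c'] and it = inc_tcof[OF c(2) c']
  obtain z where z: "z \<in> Hom M (cyl_ob M c') Y" "z \<cdot> inc0 c' = src \<beta>" "z \<cdot> inc1 c' = tgt \<beta>"
    using cells_are_homotopies[OF b(1) c'] by blast
  have ir: "i \<cdot> r \<in> Hom M Y W" "p \<cdot> (i \<cdot> r) = z \<cdot> inc0 c'" using W r z b by simp_all
  obtain z' where z': "z' \<in> Hom M (cyl_ob M c') W" "z' \<cdot> inc0 c' = i \<cdot> r" "p \<cdot> z' = z"
    using lift_tcof[OF it(1,2) W(6) ca(1) W(2) ir(1) z(1) ir(2)] .
  define s where "s = z' \<cdot> inc1 c'"
  have s: "s \<in> Hom M Y W" "p \<cdot> s = Id M Y" using z' ca W z b comp_cong[OF z'(3), of "inc1 c'"] by (simp_all add: s_def)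
  \<comment> \<open>\<open>s \<cdot> p \<simeq> i \<cdot> r \<cdot> p \<simeq> i \<cdot> r \<cdot> p \<cdot> i \<cdot> l \<simeq> i \<cdot> l \<simeq> Id\<close>\<close>
  note S = inverse_cells[OF cell_of_cells(1)[OF c(2) bW c' z'(1)]]
  note Sp = precomp_cells[OF S(1) cW W(2)]
  have irp: "(i \<cdot> r) \<cdot> p \<in> Hom M W W" using ir W by simp
  note A = postcomp_cells[OF inverse_cells(1)[OF L(1)] irp bW]
  have e1: "tgt (inverse_cell (cell_of c' z') \<lhd> p) = src (((i \<cdot> r) \<cdot> p) \<rhd> inverse_cell \<Lambda>)"
    using Sp A S inverse_cells[OF L(1)] L cell_of_cells[OF c(2) bW c' z'(1)] z' W r by simp
  note v1 = vcomp_cells[OF Sp(1) A(1) e1]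
  note al = precomp_cells[OF a(1) cW l(1)]
  note B = postcomp_cells[OF al(1) W(1) bW]
  have e2: "tgt ((((i \<cdot> r) \<cdot> p) \<rhd> inverse_cell \<Lambda>) \<bullet> (inverse_cell (cell_of c' z') \<lhd> p)) = src (i \<rhd> (\<alpha> \<lhd> l))"
    using v1 A inverse_cells[OF L(1)] L B al a W l r f by simp
  note v2 = vcomp_cells[OF v1(1) B(1) e2]
  have e3: "tgt ((i \<rhd> (\<alpha> \<lhd> l)) \<bullet> (((i \<cdot> r) \<cdot> p) \<rhd> inverse_cell \<Lambda>) \<bullet> (inverse_cell (cell_of c' z') \<lhd> p)) = src \<Lambda>"
    using v2 B al a L l W by simp
  note v3 = vcomp_cells[OF v2(1) L(1) e3]
  have "Id M W \<in> Weq M" using id_weq c by simp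
  with weq_homotopy_invariant[OF cW v3(1)]
  have "s \<cdot> p \<in> Weq M"
    using v3 v2 v1 Sp S cell_of_cells[OF c(2) bW c' z'(1)] L by (simp add: s_def)
  moreover have "is_retract M p (s \<cdot> p)"
    unfolding is_retract_def
    by (rule exI[of _ "Id M W"], rule exI[of _ "Id M W"], rule exI[of _ s], rule exI[of _ p])
      (use s W c comp_cong[OF s(2)] in simp)
  ultimately have "p \<in> Weq M" using CM3[of p "s \<cdot> p"] W s by simp
  then show ?thesis using weq_comp[OF W(5) _ W(1,2)] W by simp
qed

subsection \<open>Strict squares of homotopies\<close>

text \<open>An equation between composites of two-cells is realized by a strict square: extending \<open>k0\<close> over the
  cylinder gives a square that is correct except for its last side, which is vertically homotopic to
  \<open>k1\<close>. The vertical homotopy is attached at that end, and the glued object is retracted to the cylinder.\<close>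

lemma square_fill:
  assumes A: "cofibrant M A" and Y: "bifibrant M Y" and c: "is_cylinder M A c"
    and k: "k0 \<in> Hom M A (paths Y)" "k1 \<in> Hom M A (paths Y)"
    and z: "z0 \<in> Hom M (cyl_ob M c) Y" "z1 \<in> Hom M (cyl_ob M c) Y"
    and e: "start Y \<cdot> k0 = z0 \<cdot> inc0 c" "finish Y \<cdot> k0 = z1 \<cdot> inc0 c" "start Y \<cdot> k1 = z0 \<cdot> inc1 c" "finish Y \<cdot> k1 = z1 \<cdot> inc1 c"
    and q: "cell Y k1 \<bullet> cell_of c z0 = cell_of c z1 \<bullet> cell Y k0"
  obtains H where "H \<in> Hom M (cyl_ob M c) (paths Y)" "H \<cdot> inc0 c = k0" "H \<cdot> inc1 c = k1" "start Y \<cdot> H = z0" "finish Y \<cdot> H = z1"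
proof -
  have Y': "Y \<in> Ob M" and A': "A \<in> Ob M" using Y A by simp_all
  note ca = cylinder_arr[OF c] and it = inc_tcof[OF A c]
  obtain H' where H': "H' \<in> Hom M (cyl_ob M c) (paths Y)" "H' \<cdot> inc0 c = k0" "start Y \<cdot> H' = z0" "finish Y \<cdot> H' = z1"
    using path_lift[OF Y' ca(1) it(1,2) k(1) z e(1,2)] .
  let ?k = "H' \<cdot> inc1 c"
  have k': "?k \<in> Hom M A (paths Y)" using H' ca by simp
  note g = gen_cells[OF Y]
  have "cell Y ?k \<bullet> cell_of c z0 = cell_of c z1 \<bullet> cell Y k0"
    using interchange_homotopy[OF A c H'(1) g(1)] g H' gen_precomp[OF Y A k'] gen_precomp[OF Y A k(1)] by simp
  then have eq: "cell Y ?k \<bullet> cell_of c z0 = cell Y k1 \<bullet> cell_of c z0" using q by simp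
  note z0c = cell_of_cells[OF A Y c z(1)] and iz = inverse_cells[OF cell_of_cells(1)[OF A Y c z(1)]]
  have kc: "cell Y ?k \<in> cells A Y" "cell Y k1 \<in> cells A Y" using k k' A Y by (simp_all add: cellsI)
  have 1: "tgt (cell_of c z0) = src (cell Y ?k)" "tgt (cell_of c z0) = src (cell Y k1)"
    using z0c e comp_cong[OF H'(3)] H' ca Y' by simp_all
  have "(x \<bullet> cell_of c z0) \<bullet> inverse_cell (cell_of c z0) = x" if "x \<in> cells A Y" "tgt (cell_of c z0) = src x" for x
    using vcomp_assoc[OF iz(1) z0c(1) that(1)] vcomp_inverse(2)[OF z0c(1)] vcomp_vid(2)[OF that(1)] that iz by simp
  then have "cell Y ?k = cell Y k1" using kc 1 eq by metis
  then have v: "vertical Y ?k k1" using cell_eq_iff[OF A Y' k'] by blast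
  have "Id M A \<in> Hom M A (Dom M ?k)" using k' A' by simp
  from vertical_precomp_on[OF v Y' this c]
  obtain V where V: "V \<in> Hom M (cyl_ob M c) (paths Y)" "V \<cdot> inc0 c = ?k" "V \<cdot> inc1 c = k1"
      "start Y \<cdot> V = (start Y \<cdot> ?k) \<cdot> proj c" "finish Y \<cdot> V = (finish Y \<cdot> ?k) \<cdot> proj c"
    using k k' by auto
  have iA: "Id M A \<in> Hom M A A" using A' by simp
  obtain Z zb zi zc where Z: "double_cylinder M c (inc1 c) (Id M A) Z zb zi zc"
    using double_cylinder_exists[OF ca(2) iA c] .
  note za = double_cylinder_arr[OF Z ca(2) iA]
  have zb: "zb \<in> Weq M" using double_cylinder_tcof[OF Z c A ca(2) iA] id_weq[OF A'] by simp
  have ic: "Id M (cyl_ob M c) \<in> Hom M (cyl_ob M c) (cyl_ob M c)" "inc1 c \<cdot> proj c \<in> Hom M (cyl_ob M c) (cyl_ob M c)"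
    using ca by simp_all
  obtain r where r: "r \<in> Hom M Z (cyl_ob M c)" "r \<cdot> zb = Id M (cyl_ob M c)" "r \<cdot> zi = inc1 c \<cdot> proj c" "r \<cdot> zc = inc1 c"
    by (rule double_cylinder_map[OF Z ca(2) iA ic ca(2)]) (use ca in simp_all)
  obtain N where N: "N \<in> Hom M Z (paths Y)" "N \<cdot> zb = H'" "N \<cdot> zi = V" "N \<cdot> zc = k1"
    by (rule double_cylinder_map[OF Z ca(2) iA H'(1) V(1) k(2)]) (use V k in simp_all)
  have s: "start Y \<cdot> (H' \<cdot> x) = z0 \<cdot> x" "finish Y \<cdot> (H' \<cdot> x) = z1 \<cdot> x" if "x \<in> Hom M T (cyl_ob M c)" for x T
    using that comp_cong[OF H'(3)] comp_cong[OF H'(4)] H' Y' by simp_all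
  have e0: "start Y \<cdot> N = z0 \<cdot> r"
    by (rule double_cylinder_unique[OF Z c ca(2) iA])
      (use N r za H' V e s[OF ca(2)] ca z Y' in simp_all)
  have e1: "finish Y \<cdot> N = z1 \<cdot> r"
    by (rule double_cylinder_unique[OF Z c ca(2) iA])
      (use N r za H' V e s[OF ca(2)] ca z Y' in simp_all)
  have zz: "zb \<cdot> inc0 c \<in> Hom M A Z" using za ca by simp
  obtain H where H: "H \<in> Hom M (cyl_ob M c) (paths Y)" "H \<cdot> inc0 c = N \<cdot> (zb \<cdot> inc0 c)" "H \<cdot> inc1 c = N \<cdot> zc"
    "start Y \<cdot> H = z0 \<cdot> Id M (cyl_ob M c)" "finish Y \<cdot> H = z1 \<cdot> Id M (cyl_ob M c)"
    by (rule section_homotopy[OF Y' za(1) zb r(1,2) N(1) z e0 e1 c zz za(3) ic(1)])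
      (use r ca za comp_cong[OF r(2)] in simp_all)
  show ?thesis
    by (rule that[OF H(1)]) (use H N H' za ca z comp_cong[OF N(2)] in simp_all)
qed

end

section \<open>Track categories and their weak pushouts\<close>

text \<open>A strict category whose hom-sets are groupoids of two-cells: \<open>\<bullet>\<close> is composition of two-cells between
  parallel arrows, \<open>\<rhd>\<close> and \<open>\<lhd>\<close> are whiskering on the left and on the right. As rewrite rules the laws
  distribute whiskering over composition and associate everything to the right.\<close>

locale track_category =
  fixes H :: "'m set" and dm cd :: "'m \<Rightarrow> 'o" and cmp :: "'m \<Rightarrow> 'm \<Rightarrow> 'm" (infixr "\<odot>" 78)
    and idn :: "'o \<Rightarrow> 'm"
    and T :: "'t set" and sr tg :: "'t \<Rightarrow> 'm" and vc :: "'t \<Rightarrow> 't \<Rightarrow> 't" (infixr "\<bullet>" 70)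
    and vid :: "'m \<Rightarrow> 't" and inv :: "'t \<Rightarrow> 't"
    and lw :: "'m \<Rightarrow> 't \<Rightarrow> 't" (infixr "\<rhd>" 76) and rw :: "'t \<Rightarrow> 'm \<Rightarrow> 't" (infixl "\<lhd>" 75)
  assumes cmp [simp]: "\<lbrakk>f \<in> H; g \<in> H; cd f = dm g\<rbrakk> \<Longrightarrow> g \<odot> f \<in> H"
      "\<lbrakk>f \<in> H; g \<in> H; cd f = dm g\<rbrakk> \<Longrightarrow> dm (g \<odot> f) = dm f"
      "\<lbrakk>f \<in> H; g \<in> H; cd f = dm g\<rbrakk> \<Longrightarrow> cd (g \<odot> f) = cd g"
    and cmp_assoc [simp]: "\<lbrakk>f \<in> H; g \<in> H; h \<in> H; cd f = dm g; cd g = dm h\<rbrakk> \<Longrightarrow> (h \<odot> g) \<odot> f = h \<odot> g \<odot> f"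
    and idn_dm: "f \<in> H \<Longrightarrow> idn (dm f) \<in> H \<and> dm (idn (dm f)) = dm f \<and> cd (idn (dm f)) = dm f"
    and idn_cd: "f \<in> H \<Longrightarrow> idn (cd f) \<in> H \<and> dm (idn (cd f)) = cd f \<and> cd (idn (cd f)) = cd f"
    and cmp_idn [simp]: "\<lbrakk>f \<in> H; dm f = X\<rbrakk> \<Longrightarrow> f \<odot> idn X = f" "\<lbrakk>f \<in> H; cd f = Y\<rbrakk> \<Longrightarrow> idn Y \<odot> f = f"
    and cell_ends [simp]: "\<alpha> \<in> T \<Longrightarrow> sr \<alpha> \<in> H" "\<alpha> \<in> T \<Longrightarrow> tg \<alpha> \<in> H"
      "\<alpha> \<in> T \<Longrightarrow> dm (tg \<alpha>) = dm (sr \<alpha>)" "\<alpha> \<in> T \<Longrightarrow> cd (tg \<alpha>) = cd (sr \<alpha>)"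
    and vc [simp]: "\<lbrakk>\<alpha> \<in> T; \<beta> \<in> T; tg \<alpha> = sr \<beta>\<rbrakk> \<Longrightarrow> \<beta> \<bullet> \<alpha> \<in> T"
      "\<lbrakk>\<alpha> \<in> T; \<beta> \<in> T; tg \<alpha> = sr \<beta>\<rbrakk> \<Longrightarrow> sr (\<beta> \<bullet> \<alpha>) = sr \<alpha>"
      "\<lbrakk>\<alpha> \<in> T; \<beta> \<in> T; tg \<alpha> = sr \<beta>\<rbrakk> \<Longrightarrow> tg (\<beta> \<bullet> \<alpha>) = tg \<beta>"
    and vc_assoc [simp]: "\<lbrakk>\<alpha> \<in> T; \<beta> \<in> T; \<gamma> \<in> T; tg \<alpha> = sr \<beta>; tg \<beta> = sr \<gamma>\<rbrakk> \<Longrightarrow> (\<gamma> \<bullet> \<beta>) \<bullet> \<alpha> = \<gamma> \<bullet> \<beta> \<bullet> \<alpha>"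
    and vid [simp]: "f \<in> H \<Longrightarrow> vid f \<in> T" "f \<in> H \<Longrightarrow> sr (vid f) = f" "f \<in> H \<Longrightarrow> tg (vid f) = f"
    and vc_vid [simp]: "\<lbrakk>\<alpha> \<in> T; sr \<alpha> = f\<rbrakk> \<Longrightarrow> \<alpha> \<bullet> vid f = \<alpha>" "\<lbrakk>\<alpha> \<in> T; tg \<alpha> = f\<rbrakk> \<Longrightarrow> vid f \<bullet> \<alpha> = \<alpha>"
    and inv [simp]: "\<alpha> \<in> T \<Longrightarrow> inv \<alpha> \<in> T" "\<alpha> \<in> T \<Longrightarrow> sr (inv \<alpha>) = tg \<alpha>" "\<alpha> \<in> T \<Longrightarrow> tg (inv \<alpha>) = sr \<alpha>"
    and vc_inv [simp]: "\<alpha> \<in> T \<Longrightarrow> inv \<alpha> \<bullet> \<alpha> = vid (sr \<alpha>)" "\<alpha> \<in> T \<Longrightarrow> \<alpha> \<bullet> inv \<alpha> = vid (tg \<alpha>)"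
    and lw [simp]: "\<lbrakk>\<alpha> \<in> T; u \<in> H; cd (sr \<alpha>) = dm u\<rbrakk> \<Longrightarrow> u \<rhd> \<alpha> \<in> T"
      "\<lbrakk>\<alpha> \<in> T; u \<in> H; cd (sr \<alpha>) = dm u\<rbrakk> \<Longrightarrow> sr (u \<rhd> \<alpha>) = u \<odot> sr \<alpha>"
      "\<lbrakk>\<alpha> \<in> T; u \<in> H; cd (sr \<alpha>) = dm u\<rbrakk> \<Longrightarrow> tg (u \<rhd> \<alpha>) = u \<odot> tg \<alpha>"
    and lw_vc [simp]: "\<lbrakk>\<alpha> \<in> T; \<beta> \<in> T; tg \<alpha> = sr \<beta>; u \<in> H; cd (sr \<alpha>) = dm u\<rbrakk> \<Longrightarrow> u \<rhd> (\<beta> \<bullet> \<alpha>) = (u \<rhd> \<beta>) \<bullet> (u \<rhd> \<alpha>)"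
    and lw_vid [simp]: "\<lbrakk>f \<in> H; u \<in> H; cd f = dm u\<rbrakk> \<Longrightarrow> u \<rhd> vid f = vid (u \<odot> f)"
    and lw_lw [simp]: "\<lbrakk>\<alpha> \<in> T; u \<in> H; u' \<in> H; cd (sr \<alpha>) = dm u; cd u = dm u'\<rbrakk> \<Longrightarrow> u' \<rhd> u \<rhd> \<alpha> = u' \<odot> u \<rhd> \<alpha>"
    and lw_idn [simp]: "\<lbrakk>\<alpha> \<in> T; cd (sr \<alpha>) = Y\<rbrakk> \<Longrightarrow> idn Y \<rhd> \<alpha> = \<alpha>"
    and rw [simp]: "\<lbrakk>\<alpha> \<in> T; a \<in> H; dm (sr \<alpha>) = cd a\<rbrakk> \<Longrightarrow> \<alpha> \<lhd> a \<in> T"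
      "\<lbrakk>\<alpha> \<in> T; a \<in> H; dm (sr \<alpha>) = cd a\<rbrakk> \<Longrightarrow> sr (\<alpha> \<lhd> a) = sr \<alpha> \<odot> a"
      "\<lbrakk>\<alpha> \<in> T; a \<in> H; dm (sr \<alpha>) = cd a\<rbrakk> \<Longrightarrow> tg (\<alpha> \<lhd> a) = tg \<alpha> \<odot> a"
    and rw_vc [simp]: "\<lbrakk>\<alpha> \<in> T; \<beta> \<in> T; tg \<alpha> = sr \<beta>; a \<in> H; dm (sr \<alpha>) = cd a\<rbrakk> \<Longrightarrow> (\<beta> \<bullet> \<alpha>) \<lhd> a = (\<beta> \<lhd> a) \<bullet> (\<alpha> \<lhd> a)"
    and rw_vid [simp]: "\<lbrakk>f \<in> H; a \<in> H; dm f = cd a\<rbrakk> \<Longrightarrow> vid f \<lhd> a = vid (f \<odot> a)"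
    and rw_rw [simp]: "\<lbrakk>\<alpha> \<in> T; a \<in> H; a' \<in> H; dm (sr \<alpha>) = cd a; dm a = cd a'\<rbrakk> \<Longrightarrow> \<alpha> \<lhd> a \<lhd> a' = \<alpha> \<lhd> (a \<odot> a')"
    and rw_idn [simp]: "\<lbrakk>\<alpha> \<in> T; dm (sr \<alpha>) = X\<rbrakk> \<Longrightarrow> \<alpha> \<lhd> idn X = \<alpha>"
    and lw_rw [simp]: "\<lbrakk>\<alpha> \<in> T; a \<in> H; dm (sr \<alpha>) = cd a; u \<in> H; cd (sr \<alpha>) = dm u\<rbrakk> \<Longrightarrow> (u \<rhd> \<alpha>) \<lhd> a = u \<rhd> (\<alpha> \<lhd> a)"
    and interchange: "\<lbrakk>\<alpha> \<in> T; \<beta> \<in> T; cd (sr \<alpha>) = dm (sr \<beta>)\<rbrakk> \<Longrightarrow>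
      (\<beta> \<lhd> tg \<alpha>) \<bullet> (sr \<beta> \<rhd> \<alpha>) = (tg \<beta> \<rhd> \<alpha>) \<bullet> (\<beta> \<lhd> sr \<alpha>)"
begin

definition hom where hom [simp]: "hom f X Y \<longleftrightarrow> f \<in> H \<and> dm f = X \<and> cd f = Y"
definition two where two [simp]: "two \<alpha> f g \<longleftrightarrow> \<alpha> \<in> T \<and> sr \<alpha> = f \<and> tg \<alpha> = g"

lemma inv_unique: "\<lbrakk>\<alpha> \<in> T; \<beta> \<in> T; sr \<beta> = tg \<alpha>; tg \<beta> = sr \<alpha>; \<beta> \<bullet> \<alpha> = vid (sr \<alpha>)\<rbrakk> \<Longrightarrow> inv \<alpha> = \<beta>"
  using vc_assoc[of "inv \<alpha>" \<alpha> \<beta>] by simp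

lemma inv_inv [simp]: "\<alpha> \<in> T \<Longrightarrow> inv (inv \<alpha>) = \<alpha>"
  by (rule inv_unique) simp_all

lemma cancel [simp]:
  assumes "\<alpha> \<in> T" "\<beta> \<in> T"
  shows "tg \<beta> = sr \<alpha> \<Longrightarrow> inv \<alpha> \<bullet> \<alpha> \<bullet> \<beta> = \<beta>" "tg \<beta> = tg \<alpha> \<Longrightarrow> \<alpha> \<bullet> inv \<alpha> \<bullet> \<beta> = \<beta>"
  using assms by (subst vc_assoc[symmetric]; simp)+

lemma inv_vc [simp]: "\<lbrakk>\<alpha> \<in> T; \<beta> \<in> T; tg \<alpha> = sr \<beta>\<rbrakk> \<Longrightarrow> inv (\<beta> \<bullet> \<alpha>) = inv \<alpha> \<bullet> inv \<beta>"
  by (rule inv_unique) simp_all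

lemma inv_lw [simp]: "\<lbrakk>\<alpha> \<in> T; u \<in> H; cd (sr \<alpha>) = dm u\<rbrakk> \<Longrightarrow> inv (u \<rhd> \<alpha>) = u \<rhd> inv \<alpha>"
  by (rule inv_unique) (simp_all flip: lw_vc)

lemma inv_rw [simp]: "\<lbrakk>\<alpha> \<in> T; a \<in> H; dm (sr \<alpha>) = cd a\<rbrakk> \<Longrightarrow> inv (\<alpha> \<lhd> a) = inv \<alpha> \<lhd> a"
  by (rule inv_unique) (simp_all flip: rw_vc)

lemma lw_cancel [simp]:
  assumes "\<alpha> \<in> T" "u \<in> H" "cd (sr \<alpha>) = dm u"
  shows "(u \<rhd> inv \<alpha>) \<bullet> (u \<rhd> \<alpha>) = vid (u \<odot> sr \<alpha>)" "(u \<rhd> \<alpha>) \<bullet> (u \<rhd> inv \<alpha>) = vid (u \<odot> tg \<alpha>)"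
    and "\<beta> \<in> T \<Longrightarrow> tg \<beta> = u \<odot> sr \<alpha> \<Longrightarrow> (u \<rhd> inv \<alpha>) \<bullet> (u \<rhd> \<alpha>) \<bullet> \<beta> = \<beta>"
    and "\<beta> \<in> T \<Longrightarrow> tg \<beta> = u \<odot> tg \<alpha> \<Longrightarrow> (u \<rhd> \<alpha>) \<bullet> (u \<rhd> inv \<alpha>) \<bullet> \<beta> = \<beta>"
  using assms cancel[of "u \<rhd> \<alpha>" \<beta>] vc_inv[of "u \<rhd> \<alpha>"] by simp_all

lemma rw_cancel [simp]:
  assumes "\<alpha> \<in> T" "a \<in> H" "dm (sr \<alpha>) = cd a"
  shows "(inv \<alpha> \<lhd> a) \<bullet> (\<alpha> \<lhd> a) = vid (sr \<alpha> \<odot> a)" "(\<alpha> \<lhd> a) \<bullet> (inv \<alpha> \<lhd> a) = vid (tg \<alpha> \<odot> a)"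
    and "\<beta> \<in> T \<Longrightarrow> tg \<beta> = sr \<alpha> \<odot> a \<Longrightarrow> (inv \<alpha> \<lhd> a) \<bullet> (\<alpha> \<lhd> a) \<bullet> \<beta> = \<beta>"
    and "\<beta> \<in> T \<Longrightarrow> tg \<beta> = tg \<alpha> \<odot> a \<Longrightarrow> (\<alpha> \<lhd> a) \<bullet> (inv \<alpha> \<lhd> a) \<bullet> \<beta> = \<beta>"
  using assms cancel[of "\<alpha> \<lhd> a" \<beta>] vc_inv[of "\<alpha> \<lhd> a"] by simp_all

lemma lw_rw_cancel [simp]:
  assumes "\<alpha> \<in> T" "a \<in> H" "dm (sr \<alpha>) = cd a" "u \<in> H" "cd (sr \<alpha>) = dm u"
  shows "(u \<rhd> (inv \<alpha> \<lhd> a)) \<bullet> (u \<rhd> (\<alpha> \<lhd> a)) = vid (u \<odot> sr \<alpha> \<odot> a)"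
    "(u \<rhd> (\<alpha> \<lhd> a)) \<bullet> (u \<rhd> (inv \<alpha> \<lhd> a)) = vid (u \<odot> tg \<alpha> \<odot> a)"
    and "\<beta> \<in> T \<Longrightarrow> tg \<beta> = u \<odot> sr \<alpha> \<odot> a \<Longrightarrow> (u \<rhd> (inv \<alpha> \<lhd> a)) \<bullet> (u \<rhd> (\<alpha> \<lhd> a)) \<bullet> \<beta> = \<beta>"
    and "\<beta> \<in> T \<Longrightarrow> tg \<beta> = u \<odot> tg \<alpha> \<odot> a \<Longrightarrow> (u \<rhd> (\<alpha> \<lhd> a)) \<bullet> (u \<rhd> (inv \<alpha> \<lhd> a)) \<bullet> \<beta> = \<beta>"
  using assms lw_cancel[of "\<alpha> \<lhd> a" u] by simp_all

lemma solve_right: "\<lbrakk>\<beta> \<bullet> \<alpha> = \<gamma>; \<alpha> \<in> T; \<beta> \<in> T; tg \<alpha> = sr \<beta>\<rbrakk> \<Longrightarrow> \<beta> = \<gamma> \<bullet> inv \<alpha>"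
  by auto

lemma solve_left: "\<lbrakk>\<beta> \<bullet> \<alpha> = \<gamma>; \<alpha> \<in> T; \<beta> \<in> T; tg \<alpha> = sr \<beta>\<rbrakk> \<Longrightarrow> \<alpha> = inv \<beta> \<bullet> \<gamma>"
  by auto

lemma vc_cong: "\<lbrakk>\<beta> \<bullet> \<alpha> = \<delta> \<bullet> \<gamma>; \<alpha> \<in> T; \<beta> \<in> T; \<gamma> \<in> T; \<delta> \<in> T; \<xi> \<in> T; tg \<xi> = sr \<alpha>; tg \<xi> = sr \<gamma>; tg \<alpha> = sr \<beta>; tg \<gamma> = sr \<delta>\<rbrakk>
   \<Longrightarrow> \<beta> \<bullet> \<alpha> \<bullet> \<xi> = \<delta> \<bullet> \<gamma> \<bullet> \<xi>"
  using vc_assoc[of \<xi> \<alpha> \<beta>] vc_assoc[of \<xi> \<gamma> \<delta>] by metis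

lemma swap:
  assumes "two \<alpha> f f'" "two \<beta> g g'" "cd f = dm g"
  shows "(\<beta> \<lhd> f') \<bullet> (g \<rhd> \<alpha>) = (g' \<rhd> \<alpha>) \<bullet> (\<beta> \<lhd> f)"
  using interchange[of \<alpha> \<beta>] assms by auto

subsection \<open>Weak pushouts\<close>

text \<open>The pushouts are weak in the sense that the map out of the corner, and the two-cell between two
  such maps, exist but are not unique. In \<open>po\<close> the two-cell restricts to the given ones on the two
  legs; in \<open>wpo\<close> it merely exists. Cancellation yields only the second form, because a two-cell on
  the corner is not determined by its restrictions to the legs. In the track category of a model
  category both forms agree.\<close>

definition square where
  "square f g u v h \<longleftrightarrow> f \<in> H \<and> g \<in> H \<and> u \<in> H \<and> v \<in> H \<and> dm g = dm f \<and> dm u = cd f \<and> dm v = cd g \<and> cd v = cd u \<and>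
     two h (u \<odot> f) (v \<odot> g)"

definition weak_exist where
  "weak_exist f g u v h \<longleftrightarrow> (\<forall>b x k. square f g b x k \<longrightarrow>
     (\<exists>t \<alpha> \<beta>. hom t (cd u) (cd b) \<and> two \<alpha> (t \<odot> u) b \<and> two \<beta> (t \<odot> v) x \<and>
        k \<bullet> (\<alpha> \<lhd> f) = (\<beta> \<lhd> g) \<bullet> (t \<rhd> h)))"

definition parallel where
  "parallel f g u v h t t' \<alpha> \<beta> \<longleftrightarrow> t \<in> H \<and> t' \<in> H \<and> dm t = cd u \<and> dm t' = cd u \<and> cd t' = cd t \<and>
     two \<alpha> (t \<odot> u) (t' \<odot> u) \<and> two \<beta> (t \<odot> v) (t' \<odot> v) \<and>
     (\<beta> \<lhd> g) \<bullet> (t \<rhd> h) = (t' \<rhd> h) \<bullet> (\<alpha> \<lhd> f)"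

definition wpo where
  "wpo f g u v h \<longleftrightarrow> square f g u v h \<and> weak_exist f g u v h \<and>
     (\<forall>t t' \<alpha> \<beta>. parallel f g u v h t t' \<alpha> \<beta> \<longrightarrow> (\<exists>\<gamma>. two \<gamma> t t'))"

definition po where
  "po f g u v h \<longleftrightarrow> square f g u v h \<and> weak_exist f g u v h \<and>
     (\<forall>t t' \<alpha> \<beta>. parallel f g u v h t t' \<alpha> \<beta> \<longrightarrow> (\<exists>\<gamma>. two \<gamma> t t' \<and> \<gamma> \<lhd> u = \<alpha> \<and> \<gamma> \<lhd> v = \<beta>))"

lemma po_imp_wpo: "po f g u v h \<Longrightarrow> wpo f g u v h"
  unfolding po_def wpo_def by blast

lemma wpo_square: "wpo f g u v h \<Longrightarrow> square f g u v h"
  by (simp add: wpo_def)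

lemma wpo_exist:
  assumes "wpo f g u v h" "square f g b x k"
  obtains t \<alpha> \<beta> where "hom t (cd u) (cd b)" "two \<alpha> (t \<odot> u) b" "two \<beta> (t \<odot> v) x"
    "k \<bullet> (\<alpha> \<lhd> f) = (\<beta> \<lhd> g) \<bullet> (t \<rhd> h)"
  using assms unfolding wpo_def weak_exist_def by blast

lemma wpo_unique:
  assumes "wpo f g u v h" "parallel f g u v h t t' \<alpha> \<beta>"
  obtains \<gamma> where "two \<gamma> t t'"
  using assms unfolding wpo_def by blast

lemma po_unique:
  assumes "po f g u v h" "parallel f g u v h t t' \<alpha> \<beta>"
  obtains \<gamma> where "two \<gamma> t t'" "\<gamma> \<lhd> u = \<alpha>" "\<gamma> \<lhd> v = \<beta>"
  using assms unfolding po_def by blast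

lemma parallelD:
  assumes "parallel f g u v h t t' \<alpha> \<beta>"
  shows "t \<in> H" "t' \<in> H" "dm t = cd u" "dm t' = cd u" "cd t' = cd t"
    "two \<alpha> (t \<odot> u) (t' \<odot> u)" "two \<beta> (t \<odot> v) (t' \<odot> v)"
    "(\<beta> \<lhd> g) \<bullet> (t \<rhd> h) = (t' \<rhd> h) \<bullet> (\<alpha> \<lhd> f)"
  using assms unfolding parallel_def by blast+

lemma wpoI:
  assumes "square f g u v h"
    and "\<And>b x k. square f g b x k \<Longrightarrow>
       \<exists>t \<alpha> \<beta>. hom t (cd u) (cd b) \<and> two \<alpha> (t \<odot> u) b \<and> two \<beta> (t \<odot> v) x \<and> k \<bullet> (\<alpha> \<lhd> f) = (\<beta> \<lhd> g) \<bullet> (t \<rhd> h)"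
    and "\<And>t t' \<alpha> \<beta>. parallel f g u v h t t' \<alpha> \<beta> \<Longrightarrow> \<exists>\<gamma>. two \<gamma> t t'"
  shows "wpo f g u v h"
  using assms unfolding wpo_def weak_exist_def by blast

lemma wpo_sym:
  assumes P: "wpo f g u v h"
  shows "wpo g f v u (inv h)"
proof (rule wpoI)
  note s = wpo_square[OF P, unfolded square_def, simplified]
  show "square g f v u (inv h)" using s by (simp add: square_def)
  fix b x k assume "square g f b x k"
  then have k: "b \<in> H" "x \<in> H" "dm b = cd g" "dm x = cd f" "cd x = cd b" "two k (b \<odot> g) (x \<odot> f)"
    by (simp_all add: square_def)
  have "square f g x b (inv k)" using s k by (simp add: square_def)
  then obtain t \<alpha> \<beta> where t: "hom t (cd u) (cd x)" "two \<alpha> (t \<odot> u) x" "two \<beta> (t \<odot> v) b"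
      "inv k \<bullet> (\<alpha> \<lhd> f) = (\<beta> \<lhd> g) \<bullet> (t \<rhd> h)"
    using wpo_exist[OF P] by blast
  have "\<alpha> \<lhd> f = k \<bullet> (\<beta> \<lhd> g) \<bullet> (t \<rhd> h)" using solve_left[OF t(4)] s k t(1-3) by simp
  then have e: "k \<bullet> (\<beta> \<lhd> g) = (\<alpha> \<lhd> f) \<bullet> (t \<rhd> inv h)" using s k t(1-3) by simp
  show "\<exists>t \<alpha> \<beta>. hom t (cd v) (cd b) \<and> two \<alpha> (t \<odot> v) b \<and> two \<beta> (t \<odot> u) x \<and> k \<bullet> (\<alpha> \<lhd> g) = (\<beta> \<lhd> f) \<bullet> (t \<rhd> inv h)"
    by (rule exI[of _ t], rule exI[of _ \<beta>], rule exI[of _ \<alpha>])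
      (use e s t k in simp)
next
  note s = wpo_square[OF P, unfolded square_def, simplified]
  fix t t' \<alpha> \<beta> assume par: "parallel g f v u (inv h) t t' \<alpha> \<beta>"
  have p: "t \<in> H" "t' \<in> H" "dm t = cd u" "dm t' = cd u" "cd t' = cd t" "two \<alpha> (t \<odot> v) (t' \<odot> v)" "two \<beta> (t \<odot> u) (t' \<odot> u)"
     "(\<beta> \<lhd> f) \<bullet> (t \<rhd> inv h) = (t' \<rhd> inv h) \<bullet> (\<alpha> \<lhd> g)" using parallelD[OF par] s by simp_all
  have "\<beta> \<lhd> f = ((t' \<rhd> inv h) \<bullet> (\<alpha> \<lhd> g)) \<bullet> inv (t \<rhd> inv h)"
    by (rule solve_right[OF p(8)]) (use p s in simp_all)
  then have "(\<alpha> \<lhd> g) \<bullet> (t \<rhd> h) = (t' \<rhd> h) \<bullet> (\<beta> \<lhd> f)" using p(1-7) s by simp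
  then have "parallel f g u v h t t' \<beta> \<alpha>" using p s by (simp add: parallel_def)
  then show "\<exists>\<gamma>. two \<gamma> t t'" using wpo_unique[OF P] by blast
qed

lemma wpo_change_leg:
  assumes P: "wpo f g u v h" and \<phi>: "two \<phi> f' f"
  shows "wpo f' g u v (h \<bullet> (u \<rhd> \<phi>))"
proof (rule wpoI)
  note s = wpo_square[OF P, unfolded square_def, simplified]
  have f': "f' \<in> H" "dm f' = dm f" "cd f' = cd f" using cell_ends[of \<phi>] \<phi> by auto
  show "square f' g u v (h \<bullet> (u \<rhd> \<phi>))" using s f' \<phi> by (simp add: square_def)
  fix b x k assume "square f' g b x k"
  then have k: "b \<in> H" "x \<in> H" "dm b = cd f" "dm x = cd g" "cd x = cd b" "two k (b \<odot> f') (x \<odot> g)"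
    using f' by (simp_all add: square_def)
  have "square f g b x (k \<bullet> (b \<rhd> inv \<phi>))" using s k f' \<phi> by (simp add: square_def)
  then obtain t \<alpha> \<beta> where t: "hom t (cd u) (cd b)" "two \<alpha> (t \<odot> u) b" "two \<beta> (t \<odot> v) x"
      "(k \<bullet> (b \<rhd> inv \<phi>)) \<bullet> (\<alpha> \<lhd> f) = (\<beta> \<lhd> g) \<bullet> (t \<rhd> h)"
    using wpo_exist[OF P] by blast
  have "(\<alpha> \<lhd> f) \<bullet> ((t \<odot> u) \<rhd> \<phi>) = (b \<rhd> \<phi>) \<bullet> (\<alpha> \<lhd> f')"
    by (rule swap[OF \<phi> t(2)]) (use t s f' in simp)
  then have "(k \<bullet> (b \<rhd> inv \<phi>)) \<bullet> (\<alpha> \<lhd> f) \<bullet> ((t \<odot> u) \<rhd> \<phi>) = k \<bullet> (\<alpha> \<lhd> f')"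
    using t(1-3) s k f' \<phi> by simp
  moreover have "(k \<bullet> (b \<rhd> inv \<phi>)) \<bullet> (\<alpha> \<lhd> f) \<bullet> ((t \<odot> u) \<rhd> \<phi>) = (\<beta> \<lhd> g) \<bullet> (t \<rhd> (h \<bullet> (u \<rhd> \<phi>)))"
    using vc_cong[OF t(4), of "(t \<odot> u) \<rhd> \<phi>"] t(1-3) s k f' \<phi> by simp
  ultimately have "k \<bullet> (\<alpha> \<lhd> f') = (\<beta> \<lhd> g) \<bullet> (t \<rhd> (h \<bullet> (u \<rhd> \<phi>)))" by simp
  then show "\<exists>t \<alpha> \<beta>. hom t (cd u) (cd b) \<and> two \<alpha> (t \<odot> u) b \<and> two \<beta> (t \<odot> v) x \<and> k \<bullet> (\<alpha> \<lhd> f') = (\<beta> \<lhd> g) \<bullet> (t \<rhd> (h \<bullet> (u \<rhd> \<phi>)))"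
    using t by blast
next
  note s = wpo_square[OF P, unfolded square_def, simplified]
  have f': "f' \<in> H" "dm f' = dm f" "cd f' = cd f" using cell_ends[of \<phi>] \<phi> by auto
  fix t t' \<alpha> \<beta> assume par: "parallel f' g u v (h \<bullet> (u \<rhd> \<phi>)) t t' \<alpha> \<beta>"
  have p: "t \<in> H" "t' \<in> H" "dm t = cd u" "dm t' = cd u" "cd t' = cd t" "two \<alpha> (t \<odot> u) (t' \<odot> u)" "two \<beta> (t \<odot> v) (t' \<odot> v)"
 using parallelD[OF par] s by simp_all
  note e = parallelD(8)[OF par]
  have "(\<alpha> \<lhd> f) \<bullet> ((t \<odot> u) \<rhd> \<phi>) = ((t' \<odot> u) \<rhd> \<phi>) \<bullet> (\<alpha> \<lhd> f')"
    by (rule swap[OF \<phi> p(6)]) (use p s f' in simp)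
  then have "((\<beta> \<lhd> g) \<bullet> (t \<rhd> h)) \<bullet> ((t \<odot> u) \<rhd> \<phi>) = ((t' \<rhd> h) \<bullet> (\<alpha> \<lhd> f)) \<bullet> ((t \<odot> u) \<rhd> \<phi>)"
    using e p s f' \<phi> by simp
  from solve_right[OF this] have "(\<beta> \<lhd> g) \<bullet> (t \<rhd> h) = (t' \<rhd> h) \<bullet> (\<alpha> \<lhd> f)"
    using p s f' \<phi> by simp
  then have "parallel f g u v h t t' \<alpha> \<beta>" using p s by (simp add: parallel_def)
  then show "\<exists>\<gamma>. two \<gamma> t t'" using wpo_unique[OF P] by blast
qed

lemma wpo_change_side:
  assumes P: "wpo f g u v h" and \<psi>: "two \<psi> v v'"
  shows "wpo f g u v' ((\<psi> \<lhd> g) \<bullet> h)"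
proof (rule wpoI)
  note s = wpo_square[OF P, unfolded square_def, simplified]
  have v': "v' \<in> H" "dm v' = dm v" "cd v' = cd v" using cell_ends[of \<psi>] \<psi> by auto
  show "square f g u v' ((\<psi> \<lhd> g) \<bullet> h)" using s v' \<psi> by (simp add: square_def)
  fix b x k assume sq: "square f g b x k"
  then have k: "b \<in> H" "x \<in> H" "dm b = cd f" "dm x = cd g" "cd x = cd b" "two k (b \<odot> f) (x \<odot> g)"
    by (simp_all add: square_def)
  obtain t \<alpha> \<beta> where t: "hom t (cd u) (cd b)" "two \<alpha> (t \<odot> u) b" "two \<beta> (t \<odot> v) x"
      "k \<bullet> (\<alpha> \<lhd> f) = (\<beta> \<lhd> g) \<bullet> (t \<rhd> h)"
    using wpo_exist[OF P sq] by blast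
  show "\<exists>t \<alpha> \<beta>. hom t (cd u) (cd b) \<and> two \<alpha> (t \<odot> u) b \<and> two \<beta> (t \<odot> v') x \<and> k \<bullet> (\<alpha> \<lhd> f) = (\<beta> \<lhd> g) \<bullet> (t \<rhd> ((\<psi> \<lhd> g) \<bullet> h))"
    by (rule exI[of _ t], rule exI[of _ \<alpha>], rule exI[of _ "\<beta> \<bullet> (t \<rhd> inv \<psi>)"])
      (use t s v' \<psi> k in simp)
next
  note s = wpo_square[OF P, unfolded square_def, simplified]
  have v': "v' \<in> H" "dm v' = dm v" "cd v' = cd v" using cell_ends[of \<psi>] \<psi> by auto
  fix t t' \<alpha> \<beta> assume par: "parallel f g u v' ((\<psi> \<lhd> g) \<bullet> h) t t' \<alpha> \<beta>"
  have p: "t \<in> H" "t' \<in> H" "dm t = cd u" "dm t' = cd u" "cd t' = cd t" "two \<alpha> (t \<odot> u) (t' \<odot> u)" "two \<beta> (t \<odot> v') (t' \<odot> v')"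
 using parallelD[OF par] s by simp_all
  note e = parallelD(8)[OF par]
  have "parallel f g u v h t t' \<alpha> ((t' \<rhd> inv \<psi>) \<bullet> \<beta> \<bullet> (t \<rhd> \<psi>))"
    using p e s v' \<psi> by (simp add: parallel_def)
  then show "\<exists>\<gamma>. two \<gamma> t t'" using wpo_unique[OF P] by blast
qed

text \<open>A map out of the pasted corner is obtained by extending first over \<open>D\<close>, the corner of the first
  square, and then over the second; prescribing the two-cell on \<open>u\<close> makes the two steps
  compatible.\<close>

lemma wpo_paste:
  assumes P1: "po f g u v h" and P2: "wpo b u p q k"
  shows "wpo (b \<odot> f) g p (q \<odot> v) ((q \<rhd> h) \<bullet> (k \<lhd> f))"
proof (rule wpoI)
  note P1' = po_imp_wpo[OF P1]
  note s = wpo_square[OF P1', unfolded square_def, simplified] wpo_square[OF P2, unfolded square_def, simplified]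
  show "square (b \<odot> f) g p (q \<odot> v) ((q \<rhd> h) \<bullet> (k \<lhd> f))" using s by (simp add: square_def)
  fix e x \<kappa> assume "square (b \<odot> f) g e x \<kappa>"
  then have k: "e \<in> H" "x \<in> H" "dm e = cd b" "dm x = cd g" "cd x = cd e" "two \<kappa> (e \<odot> b \<odot> f) (x \<odot> g)"
    using s by (simp_all add: square_def)
  have "square f g (e \<odot> b) x \<kappa>" using s k by (simp add: square_def)
  then obtain t1 \<alpha>1 \<beta>1 where t1: "hom t1 (cd u) (cd e)" "two \<alpha>1 (t1 \<odot> u) (e \<odot> b)" "two \<beta>1 (t1 \<odot> v) x"
      "\<kappa> \<bullet> (\<alpha>1 \<lhd> f) = (\<beta>1 \<lhd> g) \<bullet> (t1 \<rhd> h)"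
    using wpo_exist[OF P1'] s k by (metis cmp(3))
  have "square b u e t1 (inv \<alpha>1)" using s k t1 by (simp add: square_def)
  then obtain t \<alpha> \<beta> where t: "hom t (cd p) (cd e)" "two \<alpha> (t \<odot> p) e" "two \<beta> (t \<odot> q) t1"
      "inv \<alpha>1 \<bullet> (\<alpha> \<lhd> b) = (\<beta> \<lhd> u) \<bullet> (t \<rhd> k)"
    using wpo_exist[OF P2] by blast
  have sw: "(\<beta> \<lhd> (v \<odot> g)) \<bullet> ((t \<odot> q) \<rhd> h) = (t1 \<rhd> h) \<bullet> (\<beta> \<lhd> (u \<odot> f))"
    by (rule swap[OF _ t(3)]) (use s t in simp_all)
  have "((\<beta>1 \<bullet> (\<beta> \<lhd> v)) \<lhd> g) \<bullet> (t \<rhd> ((q \<rhd> h) \<bullet> (k \<lhd> f))) =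
      (\<beta>1 \<lhd> g) \<bullet> ((\<beta> \<lhd> (v \<odot> g)) \<bullet> ((t \<odot> q) \<rhd> h)) \<bullet> (t \<rhd> (k \<lhd> f))"
    using s k t(1-3) t1(1-3) by simp
  also have "\<dots> = ((\<beta>1 \<lhd> g) \<bullet> (t1 \<rhd> h)) \<bullet> (((\<beta> \<lhd> u) \<bullet> (t \<rhd> k)) \<lhd> f)"
    unfolding sw using s k t(1-3) t1(1-3) by simp
  also have "\<dots> = \<kappa> \<bullet> (\<alpha> \<lhd> (b \<odot> f))"
    unfolding t1(4)[symmetric] t(4)[symmetric] using s k t(1-3) t1(1-3) by simp
  finally have e: "((\<beta>1 \<bullet> (\<beta> \<lhd> v)) \<lhd> g) \<bullet> (t \<rhd> ((q \<rhd> h) \<bullet> (k \<lhd> f))) = \<kappa> \<bullet> (\<alpha> \<lhd> (b \<odot> f))" .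
  show "\<exists>t \<alpha> \<beta>. hom t (cd p) (cd e) \<and> two \<alpha> (t \<odot> p) e \<and> two \<beta> (t \<odot> q \<odot> v) x \<and>
      \<kappa> \<bullet> (\<alpha> \<lhd> (b \<odot> f)) = (\<beta> \<lhd> g) \<bullet> (t \<rhd> ((q \<rhd> h) \<bullet> (k \<lhd> f)))"
    by (rule exI[of _ t], rule exI[of _ \<alpha>], rule exI[of _ "\<beta>1 \<bullet> (\<beta> \<lhd> v)"])
      (use e[symmetric] s k t(1-3) t1(1-3) in simp)
next
  note P1' = po_imp_wpo[OF P1]
  note s = wpo_square[OF P1', unfolded square_def, simplified] wpo_square[OF P2, unfolded square_def, simplified]
  fix t t' \<alpha> \<beta> assume par: "parallel (b \<odot> f) g p (q \<odot> v) ((q \<rhd> h) \<bullet> (k \<lhd> f)) t t' \<alpha> \<beta>"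
  have p: "t \<in> H" "t' \<in> H" "dm t = cd p" "dm t' = cd p" "cd t' = cd t" "two \<alpha> (t \<odot> p) (t' \<odot> p)" "two \<beta> (t \<odot> q \<odot> v) (t' \<odot> q \<odot> v)"

    using parallelD[OF par] s by simp_all
  note e = parallelD(8)[OF par]
  let ?\<alpha> = "(t' \<rhd> k) \<bullet> (\<alpha> \<lhd> b) \<bullet> (t \<rhd> inv k)"
  have "((\<beta> \<lhd> g) \<bullet> (t \<odot> q \<rhd> h)) \<bullet> (t \<rhd> (k \<lhd> f)) = (t' \<odot> q \<rhd> h) \<bullet> (t' \<rhd> (k \<lhd> f)) \<bullet> (\<alpha> \<lhd> (b \<odot> f))"
    using e p s by simp
  from solve_right[OF this] have "(\<beta> \<lhd> g) \<bullet> (t \<odot> q \<rhd> h) = (t' \<odot> q \<rhd> h) \<bullet> (?\<alpha> \<lhd> f)"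
    using p s by simp
  then have "parallel f g u v h (t \<odot> q) (t' \<odot> q) ?\<alpha> \<beta>"
    using p s by (simp add: parallel_def)
  then obtain \<gamma> where g: "two \<gamma> (t \<odot> q) (t' \<odot> q)" "\<gamma> \<lhd> u = ?\<alpha>" using po_unique[OF P1] by blast
  have "parallel b u p q k t t' \<alpha> \<gamma>"
    using p s g by (simp add: parallel_def)
  then show "\<exists>\<gamma>. two \<gamma> t t'" using wpo_unique[OF P2] by blast
qed

text \<open>A cocone on the second square restricts along \<open>v\<close> to one on the pasted square. The map so obtained
  agrees with the given one on the corner of the first square by the uniqueness part of the latter.\<close>

lemma wpo_cancel:
  assumes P1: "po f g u v h" and P3: "wpo (b \<odot> f) g p (q \<odot> v) ((q \<rhd> h) \<bullet> (k \<lhd> f))" and sq: "square b u p q k"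
  shows "wpo b u p q k"
proof (rule wpoI)
  note P1' = po_imp_wpo[OF P1]
  note s = wpo_square[OF P1', unfolded square_def, simplified] sq[unfolded square_def, simplified]
  show "square b u p q k" by (fact sq)
  fix e d \<kappa> assume "square b u e d \<kappa>"
  then have k: "e \<in> H" "d \<in> H" "dm e = cd b" "dm d = cd u" "cd d = cd e" "two \<kappa> (e \<odot> b) (d \<odot> u)"
    using s by (simp_all add: square_def)
  have "square (b \<odot> f) g e (d \<odot> v) ((d \<rhd> h) \<bullet> (\<kappa> \<lhd> f))" using s k by (simp add: square_def)
  then obtain t \<alpha> \<beta> where t: "hom t (cd p) (cd e)" "two \<alpha> (t \<odot> p) e" "two \<beta> (t \<odot> q \<odot> v) (d \<odot> v)"
      "((d \<rhd> h) \<bullet> (\<kappa> \<lhd> f)) \<bullet> (\<alpha> \<lhd> (b \<odot> f)) = (\<beta> \<lhd> g) \<bullet> (t \<rhd> ((q \<rhd> h) \<bullet> (k \<lhd> f)))"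
    using wpo_exist[OF P3] by blast
  let ?\<alpha> = "\<kappa> \<bullet> (\<alpha> \<lhd> b) \<bullet> (t \<rhd> inv k)"
  have "((\<beta> \<lhd> g) \<bullet> (t \<odot> q \<rhd> h)) \<bullet> (t \<rhd> (k \<lhd> f)) = (d \<rhd> h) \<bullet> (\<kappa> \<lhd> f) \<bullet> (\<alpha> \<lhd> (b \<odot> f))"
    using t s k by simp
  from solve_right[OF this] have "(\<beta> \<lhd> g) \<bullet> (t \<odot> q \<rhd> h) = (d \<rhd> h) \<bullet> (?\<alpha> \<lhd> f)"
    using t s k by simp
  then have "parallel f g u v h (t \<odot> q) d ?\<alpha> \<beta>"
    using t s k by (simp add: parallel_def)
  then obtain \<gamma> where g: "two \<gamma> (t \<odot> q) d" "\<gamma> \<lhd> u = ?\<alpha>" using po_unique[OF P1] by blast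
  show "\<exists>t \<alpha> \<beta>. hom t (cd p) (cd e) \<and> two \<alpha> (t \<odot> p) e \<and> two \<beta> (t \<odot> q) d \<and> \<kappa> \<bullet> (\<alpha> \<lhd> b) = (\<beta> \<lhd> u) \<bullet> (t \<rhd> k)"
    by (rule exI[of _ t], rule exI[of _ \<alpha>], rule exI[of _ \<gamma>])
      (use g t(1-3) s k in simp)
next
  note P1' = po_imp_wpo[OF P1]
  note s = wpo_square[OF P1', unfolded square_def, simplified] sq[unfolded square_def, simplified]
  fix t t' \<alpha> \<delta> assume par: "parallel b u p q k t t' \<alpha> \<delta>"
  have p: "t \<in> H" "t' \<in> H" "dm t = cd p" "dm t' = cd p" "cd t' = cd t" "two \<alpha> (t \<odot> p) (t' \<odot> p)" "two \<delta> (t \<odot> q) (t' \<odot> q)"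

    using parallelD[OF par] s by simp_all
  note e = parallelD(8)[OF par]
  have sw: "(\<delta> \<lhd> (v \<odot> g)) \<bullet> ((t \<odot> q) \<rhd> h) = ((t' \<odot> q) \<rhd> h) \<bullet> (\<delta> \<lhd> (u \<odot> f))"
    by (rule swap[OF _ p(7)]) (use s p in simp_all)
  have "((\<delta> \<lhd> v) \<lhd> g) \<bullet> (t \<rhd> ((q \<rhd> h) \<bullet> (k \<lhd> f))) = ((\<delta> \<lhd> (v \<odot> g)) \<bullet> ((t \<odot> q) \<rhd> h)) \<bullet> (t \<rhd> (k \<lhd> f))"
    using p s by simp
  also have "\<dots> = (t' \<odot> q \<rhd> h) \<bullet> (((\<delta> \<lhd> u) \<bullet> (t \<rhd> k)) \<lhd> f)"
    unfolding sw using p s by simp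
  also have "\<dots> = (t' \<rhd> ((q \<rhd> h) \<bullet> (k \<lhd> f))) \<bullet> (\<alpha> \<lhd> (b \<odot> f))"
    unfolding e using p s by simp
  finally have "parallel (b \<odot> f) g p (q \<odot> v) ((q \<rhd> h) \<bullet> (k \<lhd> f)) t t' \<alpha> (\<delta> \<lhd> v)"
    using p s by (simp add: parallel_def)
  then show "\<exists>\<gamma>. two \<gamma> t t'" using wpo_unique[OF P3] by blast
qed

end

section \<open>Pushing a relative sequence and a Ganea stage forward\<close>

context track_category begin

lemma squareD:
  assumes "square f g u v h"
  shows "f \<in> H" "g \<in> H" "u \<in> H" "v \<in> H" "dm g = dm f" "dm u = cd f" "dm v = cd g" "cd v = cd u"
    "h \<in> T" "sr h = u \<odot> f" "tg h = v \<odot> g"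
  using assms by (simp_all add: square_def)

text \<open>Weak pushouts preserve equivalences. The homotopies \<open>\<epsilon>\<close> and \<open>\<epsilon>'\<close> are unrelated, so the second is
  replaced by the one that makes \<open>f\<close> and \<open>f'\<close> an adjoint equivalence, \<open>e \<lhd> f = f \<rhd> \<epsilon>\<close>; the compatibility
  on the source of the span is exactly this identity.\<close>

lemma wpo_equivalence:
  assumes P: "wpo f g u v h" and f': "hom f' (cd f) (dm f)"
    and e1: "two \<epsilon> (f' \<odot> f) (idn (dm f))" and e2: "two \<epsilon>' (f \<odot> f') (idn (cd f))"
  obtains r \<zeta> \<xi> where "hom r (cd v) (dm v)" "two \<zeta> (r \<odot> v) (idn (dm v))" "two \<xi> (v \<odot> r) (idn (cd v))"
proof -
  note s = squareD[OF wpo_square[OF P]]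
  note i = idn_dm[OF s(1)] idn_cd[OF s(1)] idn_cd[OF s(2)] idn_cd[OF s(3)]
  define e where "e = \<epsilon>' \<bullet> (f \<rhd> (\<epsilon> \<lhd> f')) \<bullet> (inv \<epsilon>' \<lhd> (f \<odot> f'))"
  have e: "two e (f \<odot> f') (idn (cd f))" using s i f' e1 e2 by (simp add: e_def)
  have "(\<epsilon> \<lhd> idn (dm f)) \<bullet> (f' \<odot> f \<rhd> \<epsilon>) = (idn (dm f) \<rhd> \<epsilon>) \<bullet> (\<epsilon> \<lhd> f' \<odot> f)"
    by (rule swap[OF e1 e1]) (use s i f' in simp)
  then have "inv \<epsilon> \<bullet> \<epsilon> \<bullet> (f' \<odot> f \<rhd> \<epsilon>) = inv \<epsilon> \<bullet> \<epsilon> \<bullet> (\<epsilon> \<lhd> f' \<odot> f)" using s i f' e1 by simp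
  then have n1: "f' \<odot> f \<rhd> \<epsilon> = \<epsilon> \<lhd> f' \<odot> f" using s i f' e1 by simp
  have "two (f \<rhd> \<epsilon>) (f \<odot> f' \<odot> f) f" using s i f' e1 by simp
  from swap[OF this e2]
  have n2: "(\<epsilon>' \<lhd> f) \<bullet> (f \<odot> f' \<odot> f \<rhd> \<epsilon>) = (f \<rhd> \<epsilon>) \<bullet> (\<epsilon>' \<lhd> (f \<odot> f' \<odot> f))"
    using s i f' e1 e2 by simp
  have "e \<lhd> f = ((\<epsilon>' \<lhd> f) \<bullet> (f \<rhd> (\<epsilon> \<lhd> f' \<odot> f))) \<bullet> (inv \<epsilon>' \<lhd> (f \<odot> f' \<odot> f))"
    using s i f' e1 e2 by (simp add: e_def)
  also have "(\<epsilon>' \<lhd> f) \<bullet> (f \<rhd> (\<epsilon> \<lhd> f' \<odot> f)) = (f \<rhd> \<epsilon>) \<bullet> (\<epsilon>' \<lhd> (f \<odot> f' \<odot> f))"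
    unfolding n1[symmetric] n2[symmetric] using s i f' e1 e2 by simp
  finally have ef: "e \<lhd> f = f \<rhd> \<epsilon>" using s i f' e1 e2 by simp
  have "square f g (g \<odot> f') (idn (cd g)) (g \<rhd> \<epsilon>)" using s i f' e1 by (simp add: square_def)
  then obtain r \<alpha> \<beta> where r: "hom r (cd u) (cd (g \<odot> f'))" "two \<alpha> (r \<odot> u) (g \<odot> f')" "two \<beta> (r \<odot> v) (idn (cd g))"
      "(g \<rhd> \<epsilon>) \<bullet> (\<alpha> \<lhd> f) = (\<beta> \<lhd> g) \<bullet> (r \<rhd> h)"
    using wpo_exist[OF P] by blast
  have r1: "hom r (cd u) (cd g)" using r(1) s f' by simp
  let ?\<alpha> = "(u \<rhd> e) \<bullet> (inv h \<lhd> f') \<bullet> (v \<rhd> \<alpha>)" and ?\<beta> = "v \<rhd> \<beta>"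
  have "two (inv h) (v \<odot> g) (u \<odot> f)" using s by simp
  from swap[OF e1 this]
  have n3: "inv h \<bullet> (v \<odot> g \<rhd> \<epsilon>) = (u \<odot> f \<rhd> \<epsilon>) \<bullet> (inv h \<lhd> (f' \<odot> f))"
    using s i f' e1 by simp
  have "(?\<beta> \<lhd> g) \<bullet> (v \<odot> r \<rhd> h) = v \<rhd> ((\<beta> \<lhd> g) \<bullet> (r \<rhd> h))"
    using s i f' r1 r(2,3) by simp
  also have "\<dots> = h \<bullet> (inv h \<bullet> (v \<odot> g \<rhd> \<epsilon>)) \<bullet> (v \<rhd> (\<alpha> \<lhd> f))"
    unfolding r(4)[symmetric] using s i f' e1 r1 r(2,3) by simp
  also have "\<dots> = (idn (cd u) \<rhd> h) \<bullet> (?\<alpha> \<lhd> f)"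
    unfolding n3 using s i f' e1 e r1 r(2,3) by (simp add: ef)
  finally have "parallel f g u v h (v \<odot> r) (idn (cd u)) ?\<alpha> ?\<beta>"
    using s i f' e1 e r1 r(2,3) by (simp add: parallel_def)
  then obtain \<gamma> where "two \<gamma> (v \<odot> r) (idn (cd u))" using wpo_unique[OF P] by blast
  then show ?thesis using that[of r \<beta> \<gamma>] r1 r s by simp
qed

text \<open>One step of a relative sequence, pushed forward along \<open>f : A \<rightarrow> B\<close>. Write \<open>S = X \<union>\<^sub>A B\<close>,
  \<open>S' = X' \<union>\<^sub>A B\<close> and \<open>W = Z \<union>\<^sub>A B\<close>, the latter along \<open>\<sigma>\<close>. As \<open>\<tau> \<odot> \<sigma>\<close> is homotopic to \<open>j\<close>, cancellation gives
  \<open>S = X \<union>\<^sub>Z W\<close>. Pasting gives \<open>S' = X \<union>\<^sub>Z B\<close>, and cancelling the former square from the latter shows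
  \<open>S' = S \<union>\<^sub>W B\<close>.\<close>

lemma pushout_of_step:
  assumes str: "\<And>f g u v h. wpo f g u v h \<Longrightarrow> po f g u v h"
    and P: "po \<rho> \<tau> j' \<chi> h" and \<sigma>: "hom \<sigma> (cd \<rho>) (dm \<rho>)"
    and a: "two a (\<rho> \<odot> \<sigma>) (idn (cd \<rho>))" and b: "two b (\<tau> \<odot> \<sigma>) j"
    and S: "po j f u \<kappa> k" and S': "po j' f u' \<kappa>' k'" and W: "po \<sigma> f p q l"
  obtains \<rho>' \<tau>' \<chi>' h' a' b' where "po \<rho>' \<tau>' \<kappa>' \<chi>' h'" "hom \<rho>' (cd q) (cd f)" "hom \<tau>' (cd q) (cd u)"
    "two a' (\<rho>' \<odot> q) (idn (cd f))" "two b' (\<tau>' \<odot> q) \<kappa>"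
proof -
  note wP = po_imp_wpo[OF P] and wS = po_imp_wpo[OF S] and wS' = po_imp_wpo[OF S'] and wW = po_imp_wpo[OF W]
  note s = squareD[OF wpo_square[OF wP]] squareD[OF wpo_square[OF wS]] squareD[OF wpo_square[OF wS']] squareD[OF wpo_square[OF wW]]
  note i = idn_dm[OF s(1)] idn_cd[OF s(1)] idn_dm[OF \<open>f \<in> H\<close>] idn_cd[OF \<open>f \<in> H\<close>]
  have j: "dm j = cd \<rho>" "cd j = cd \<tau>" using b \<sigma> s cell_ends[of b] by auto
  have \<sigma>': "\<sigma> \<in> H" "dm \<sigma> = cd \<rho>" "cd \<sigma> = dm \<rho>" using \<sigma> by simp_all
  have df: "dm f = cd \<rho>" using s j by simp
  \<comment> \<open>\<open>S\<close> as the pushout of \<open>\<tau>\<close> along \<open>p : Z \<rightarrow> W\<close>\<close>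
  note S1 = wpo_change_leg[OF wS b]
  have "square \<sigma> f (u \<odot> \<tau>) \<kappa> (k \<bullet> (u \<rhd> b))"
    using s b j \<sigma>' df by (simp add: square_def)
  from wpo_exist[OF wW this] obtain \<tau>' m1 m2 where t: "hom \<tau>' (cd p) (cd (u \<odot> \<tau>))" "two m1 (\<tau>' \<odot> p) (u \<odot> \<tau>)" "two m2 (\<tau>' \<odot> q) \<kappa>"
      "(k \<bullet> (u \<rhd> b)) \<bullet> (m1 \<lhd> \<sigma>) = (m2 \<lhd> f) \<bullet> (\<tau>' \<rhd> l)" .
  have t1: "\<tau>' \<in> H" "dm \<tau>' = cd p" "cd \<tau>' = cd u" using t(1) s j by simp_all
  note ty = s b j \<sigma>' df t1 t(2,3) a i
  have "square \<tau> p u \<tau>' (inv m1)" using ty by (simp add: square_def)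
  moreover have "wpo (\<tau> \<odot> \<sigma>) f u (\<tau>' \<odot> q) ((inv m2 \<lhd> f) \<bullet> k \<bullet> (u \<rhd> b))"
    by (rule wpo_change_side[OF S1, of "inv m2"]) (use ty in simp)
  moreover have "(inv m2 \<lhd> f) \<bullet> k \<bullet> (u \<rhd> b) = (\<tau>' \<rhd> l) \<bullet> (inv m1 \<lhd> \<sigma>)"
  proof -
    have "k \<bullet> (u \<rhd> b) = ((m2 \<lhd> f) \<bullet> (\<tau>' \<rhd> l)) \<bullet> inv (m1 \<lhd> \<sigma>)"
      by (rule solve_right[OF t(4)]) (use ty in simp_all)
    then show ?thesis using ty by simp
  qed
  ultimately have "wpo \<tau> p u \<tau>' (inv m1)" using wpo_cancel[OF W] by simp
  then have "wpo p \<tau> \<tau>' u (inv (inv m1))" by (rule wpo_sym)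
  then have R: "po p \<tau> \<tau>' u m1" using str ty by simp
  note wR = po_imp_wpo[OF R]
  have "square \<sigma> f (f \<odot> \<rho>) (idn (cd f)) (f \<rhd> a)" using ty by (simp add: square_def)
  from wpo_exist[OF wW this] obtain \<rho>' n1 n2 where r: "hom \<rho>' (cd p) (cd (f \<odot> \<rho>))" "two n1 (\<rho>' \<odot> p) (f \<odot> \<rho>)" "two n2 (\<rho>' \<odot> q) (idn (cd f))" .
  have r1: "\<rho>' \<in> H" "dm \<rho>' = cd p" "cd \<rho>' = cd f" using r(1) ty by simp_all
  note ty = ty r1 r(2,3)
  \<comment> \<open>\<open>S'\<close> as the pushout of \<open>\<tau>\<close> along \<open>f \<odot> \<rho>\<close>, then along \<open>\<rho>' \<odot> p\<close>, with the map from \<open>X\<close> through \<open>S\<close>\<close>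
  have k': "po f j' \<kappa>' u' (inv k')" using str wpo_sym[OF wS'] by blast
  note O1 = wpo_paste[OF P po_imp_wpo[OF k']]
  let ?x = "(u' \<rhd> h) \<bullet> (inv k' \<lhd> \<rho>) \<bullet> (\<kappa>' \<rhd> n1)"
  have O2: "wpo (\<rho>' \<odot> p) \<tau> \<kappa>' (u' \<odot> \<chi>) (((u' \<rhd> h) \<bullet> (inv k' \<lhd> \<rho>)) \<bullet> (\<kappa>' \<rhd> n1))"
    by (rule wpo_change_leg[OF O1 r(2)])
  have "square p \<tau> (\<kappa>' \<odot> \<rho>') (u' \<odot> \<chi>) ?x" using ty by (simp add: square_def)
  from wpo_exist[OF wR this] obtain \<chi>' s1 s2 where c: "hom \<chi>' (cd \<tau>') (cd (\<kappa>' \<odot> \<rho>'))" "two s1 (\<chi>' \<odot> \<tau>') (\<kappa>' \<odot> \<rho>')" "two s2 (\<chi>' \<odot> u) (u' \<odot> \<chi>)"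
      "?x \<bullet> (s1 \<lhd> p) = (s2 \<lhd> \<tau>) \<bullet> (\<chi>' \<rhd> m1)" .
  have c1: "\<chi>' \<in> H" "dm \<chi>' = cd \<tau>'" "cd \<chi>' = cd \<kappa>'" using c(1) ty by simp_all
  note ty = ty c1 c(2,3)
  have "wpo (\<rho>' \<odot> p) \<tau> \<kappa>' (\<chi>' \<odot> u) ((inv s2 \<lhd> \<tau>) \<bullet> ((u' \<rhd> h) \<bullet> (inv k' \<lhd> \<rho>)) \<bullet> (\<kappa>' \<rhd> n1))"
    by (rule wpo_change_side[OF O2, of "inv s2"]) (use ty in simp)
  moreover have "(inv s2 \<lhd> \<tau>) \<bullet> ((u' \<rhd> h) \<bullet> (inv k' \<lhd> \<rho>)) \<bullet> (\<kappa>' \<rhd> n1) = (\<chi>' \<rhd> m1) \<bullet> (inv s1 \<lhd> p)"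
  proof -
    have "?x = ((s2 \<lhd> \<tau>) \<bullet> (\<chi>' \<rhd> m1)) \<bullet> inv (s1 \<lhd> p)"
      by (rule solve_right[OF c(4)]) (use ty in simp_all)
    then show ?thesis using ty by simp
  qed
  moreover have "square \<rho>' \<tau>' \<kappa>' \<chi>' (inv s1)" using ty by (simp add: square_def)
  ultimately have "wpo \<rho>' \<tau>' \<kappa>' \<chi>' (inv s1)" using wpo_cancel[OF R] by simp
  from str[OF this] show ?thesis
    by (rule that) (use ty in simp_all)
qed

text \<open>One step of the naturality of the Ganea construction, from \<open>\<iota> : A \<rightarrow> X\<close> to \<open>\<kappa> : B \<rightarrow> S\<close>, where
  \<open>\<zeta>\<close> is the induced map of homotopy pullbacks. The last conclusion relates the two-cells
  for the two compatibilities of \<open>\<phi>1\<close>: over \<open>j\<close> and under \<open>f\<close>. It is automatic at each stage, because the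
  part of \<open>\<theta>1\<close> on \<open>\<alpha>1\<close> is prescribed when \<open>\<theta>1\<close> is constructed out of the pushout.\<close>

lemma ganea_comparison_step:
  assumes tp: "hom \<iota> A X" "hom f A B" "hom j X S" "hom \<kappa> B S" "two c (j \<odot> \<iota>) (\<kappa> \<odot> f)"
    and G: "hom g G X" "hom \<phi> G G'" "hom g' G' S" "two \<theta> (g' \<odot> \<phi>) (j \<odot> g)"
    and F: "hom \<eta> F A" "hom \<beta> F G" "two h (\<iota> \<odot> \<eta>) (g \<odot> \<beta>)"
    and P: "po \<eta> \<beta> \<alpha>1 \<gamma> hp"
    and g1: "hom g1 (cd \<alpha>1) X" "two \<mu> (g1 \<odot> \<alpha>1) \<iota>" "two \<nu> (g1 \<odot> \<gamma>) g" "h \<bullet> (\<mu> \<lhd> \<eta>) = (\<nu> \<lhd> \<beta>) \<bullet> (g1 \<rhd> hp)"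
    and F': "hom \<eta>' F' B" "hom \<beta>' F' G'" "two h' (\<kappa> \<odot> \<eta>') (g' \<odot> \<beta>')"
    and P': "square \<eta>' \<beta>' \<alpha>1' \<gamma>' hp'"
    and g1': "hom g1' (cd \<alpha>1') S" "two \<mu>' (g1' \<odot> \<alpha>1') \<kappa>" "two \<nu>' (g1' \<odot> \<gamma>') g'" "h' \<bullet> (\<mu>' \<lhd> \<eta>') = (\<nu>' \<lhd> \<beta>') \<bullet> (g1' \<rhd> hp')"
    and z: "hom \<zeta> F F'" "\<eta>' \<odot> \<zeta> = f \<odot> \<eta>" "\<beta>' \<odot> \<zeta> = \<phi> \<odot> \<beta>" "h' \<lhd> \<zeta> = (inv \<theta> \<lhd> \<beta>) \<bullet> (j \<rhd> h) \<bullet> (inv c \<lhd> \<eta>)"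
  obtains \<phi>1 \<theta>1 a where "hom \<phi>1 (cd \<alpha>1) (cd \<alpha>1')" "two \<theta>1 (g1' \<odot> \<phi>1) (j \<odot> g1)" "two a (\<phi>1 \<odot> \<alpha>1) (\<alpha>1' \<odot> f)"
    "c \<bullet> (j \<rhd> \<mu>) \<bullet> (\<theta>1 \<lhd> \<alpha>1) = (\<mu>' \<lhd> f) \<bullet> (g1' \<rhd> a)"
proof -
  note wP = po_imp_wpo[OF P]
  note s = squareD[OF wpo_square[OF wP]] squareD[OF P']
  note ty = s tp G F g1(1-3) F' g1'(1-3) z(1-3)
  have z': "\<eta>' \<odot> (\<zeta> \<odot> x) = f \<odot> \<eta> \<odot> x" "\<beta>' \<odot> (\<zeta> \<odot> x) = \<phi> \<odot> \<beta> \<odot> x" if "x \<in> H" "cd x = F" for x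
    using that ty cmp_assoc[of x \<zeta> \<eta>'] cmp_assoc[of x \<zeta> \<beta>'] by simp_all
  have "square \<eta> \<beta> (\<alpha>1' \<odot> f) (\<gamma>' \<odot> \<phi>) (hp' \<lhd> \<zeta>)" using ty by (simp add: square_def)
  from wpo_exist[OF wP this] obtain \<phi>1 a b where p: "hom \<phi>1 (cd \<alpha>1) (cd (\<alpha>1' \<odot> f))" "two a (\<phi>1 \<odot> \<alpha>1) (\<alpha>1' \<odot> f)" "two b (\<phi>1 \<odot> \<gamma>) (\<gamma>' \<odot> \<phi>)"
     "(hp' \<lhd> \<zeta>) \<bullet> (a \<lhd> \<eta>) = (b \<lhd> \<beta>) \<bullet> (\<phi>1 \<rhd> hp)" .
  have p1: "hom \<phi>1 (cd \<alpha>1) (cd \<alpha>1')" using p(1) ty by simp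
  note ty = ty p1 p(2,3)
  let ?a = "(j \<rhd> inv \<mu>) \<bullet> inv c \<bullet> (\<mu>' \<lhd> f) \<bullet> (g1' \<rhd> a)" and ?b = "(j \<rhd> inv \<nu>) \<bullet> \<theta> \<bullet> (\<nu>' \<lhd> \<phi>) \<bullet> (g1' \<rhd> b)"
  have 1: "(g1 \<rhd> hp) \<bullet> (inv \<mu> \<lhd> \<eta>) = (inv \<nu> \<lhd> \<beta>) \<bullet> h"
  proof -
    have "h = ((\<nu> \<lhd> \<beta>) \<bullet> (g1 \<rhd> hp)) \<bullet> inv (\<mu> \<lhd> \<eta>)"
      by (rule solve_right[OF g1(4)]) (use ty in simp_all)
    then show ?thesis using ty by simp
  qed
  have 2: "(\<nu>' \<lhd> \<phi> \<odot> \<beta>) \<bullet> (g1' \<rhd> (hp' \<lhd> \<zeta>)) = (h' \<lhd> \<zeta>) \<bullet> (\<mu>' \<lhd> f \<odot> \<eta>)"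
  proof -
    have "((\<nu>' \<lhd> \<beta>') \<bullet> (g1' \<rhd> hp')) \<lhd> \<zeta> = (h' \<bullet> (\<mu>' \<lhd> \<eta>')) \<lhd> \<zeta>" using g1'(4) by simp
    then show ?thesis using ty by simp
  qed
  have "(?b \<lhd> \<beta>) \<bullet> (g1' \<odot> \<phi>1 \<rhd> hp) =
      (j \<rhd> (inv \<nu> \<lhd> \<beta>)) \<bullet> (\<theta> \<lhd> \<beta>) \<bullet> (\<nu>' \<lhd> \<phi> \<odot> \<beta>) \<bullet> (g1' \<rhd> ((b \<lhd> \<beta>) \<bullet> (\<phi>1 \<rhd> hp)))"
    using ty by simp
  also have "\<dots> = (j \<rhd> (inv \<nu> \<lhd> \<beta>)) \<bullet> (\<theta> \<lhd> \<beta>) \<bullet> ((\<nu>' \<lhd> \<phi> \<odot> \<beta>) \<bullet> (g1' \<rhd> (hp' \<lhd> \<zeta>))) \<bullet> (g1' \<rhd> (a \<lhd> \<eta>))"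
    unfolding p(4)[symmetric] using ty by simp
  also have "\<dots> = (j \<rhd> (inv \<nu> \<lhd> \<beta>)) \<bullet> (j \<rhd> h) \<bullet> (inv c \<lhd> \<eta>) \<bullet> (\<mu>' \<lhd> f \<odot> \<eta>) \<bullet> (g1' \<rhd> (a \<lhd> \<eta>))"
    unfolding 2 z(4) using ty by simp
  also have "\<dots> = (j \<rhd> ((inv \<nu> \<lhd> \<beta>) \<bullet> h)) \<bullet> (inv c \<lhd> \<eta>) \<bullet> (\<mu>' \<lhd> f \<odot> \<eta>) \<bullet> (g1' \<rhd> (a \<lhd> \<eta>))"
    using ty by simp
  also have "\<dots> = (j \<odot> g1 \<rhd> hp) \<bullet> (?a \<lhd> \<eta>)"
    unfolding 1[symmetric] using ty by simp
  finally have "parallel \<eta> \<beta> \<alpha>1 \<gamma> hp (g1' \<odot> \<phi>1) (j \<odot> g1) ?a ?b"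
    using ty by (simp add: parallel_def)
  then obtain \<theta>1 where t: "two \<theta>1 (g1' \<odot> \<phi>1) (j \<odot> g1)" "\<theta>1 \<lhd> \<alpha>1 = ?a" using po_unique[OF P] by blast
  have "c \<bullet> (j \<rhd> \<mu>) \<bullet> (\<theta>1 \<lhd> \<alpha>1) = (\<mu>' \<lhd> f) \<bullet> (g1' \<rhd> a)"
    unfolding t(2) using ty by simp
  with that p1 t(1) p(2) show ?thesis by blast
qed

text \<open>The map \<open>t\<close> is \<open>\<phi> \<odot> \<sigma>\<close> on \<open>X\<close> and \<open>\<alpha>'\<close> on \<open>B\<close>. The two-cells \<open>?P\<close> and \<open>?Q\<close> compare \<open>g' \<odot> t\<close> with the
  identity on \<open>X\<close> and on \<open>B\<close>; on \<open>A\<close> they differ by the loop \<open>?l\<close> at \<open>\<iota>\<close>, which runs through \<open>\<epsilon>\<close>, \<open>\<delta>\<close> and \<open>\<mu>\<close>.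
  The self-map \<open>w\<close> of the pushout that is the identity on \<open>X\<close> and \<open>B\<close>, glued by the inverse loop,
  cancels the difference, and \<open>t \<odot> w\<close> is the section.\<close>

lemma section_over_pushout:
  assumes P: "wpo \<iota> f j \<kappa> c"
    and G: "hom g G (cd \<iota>)" "hom \<sigma> (cd \<iota>) G" "hom \<alpha> (dm \<iota>) G" "two \<epsilon> (g \<odot> \<sigma>) (idn (cd \<iota>))" "two \<delta> (\<sigma> \<odot> \<iota>) \<alpha>" "two \<mu> (g \<odot> \<alpha>) \<iota>"
    and G': "hom \<phi> G G'" "hom g' G' (cd j)" "hom \<alpha>' (cd f) G'" "two \<theta> (g' \<odot> \<phi>) (j \<odot> g)" "two a (\<phi> \<odot> \<alpha>) (\<alpha>' \<odot> f)" "two \<mu>' (g' \<odot> \<alpha>') \<kappa>"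
    and coh: "c \<bullet> (j \<rhd> \<mu>) \<bullet> (\<theta> \<lhd> \<alpha>) = (\<mu>' \<lhd> f) \<bullet> (g' \<rhd> a)"
  obtains \<sigma>' \<epsilon>' \<delta>' where "hom \<sigma>' (cd j) G'" "two \<epsilon>' (g' \<odot> \<sigma>') (idn (cd j))" "two \<delta>' (\<sigma>' \<odot> \<kappa>) \<alpha>'"
proof -
  note s = squareD[OF wpo_square[OF P]]
  note i = idn_dm[OF s(1)] idn_cd[OF s(1)] idn_cd[OF s(2)] idn_cd[OF s(3)]
  note ty = s i G G'
  have "square \<iota> f (\<phi> \<odot> \<sigma>) \<alpha>' (a \<bullet> (\<phi> \<rhd> \<delta>))" using ty by (simp add: square_def)
  from wpo_exist[OF P this] obtain t p q where t: "hom t (cd j) (cd (\<phi> \<odot> \<sigma>))" "two p (t \<odot> j) (\<phi> \<odot> \<sigma>)" "two q (t \<odot> \<kappa>) \<alpha>'"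
      "(a \<bullet> (\<phi> \<rhd> \<delta>)) \<bullet> (p \<lhd> \<iota>) = (q \<lhd> f) \<bullet> (t \<rhd> c)" .
  have t1: "hom t (cd j) G'" using t(1) ty by simp
  note ty = ty t1 t(2,3)
  let ?P = "(j \<rhd> \<epsilon>) \<bullet> (\<theta> \<lhd> \<sigma>) \<bullet> (g' \<rhd> p)" and ?Q = "\<mu>' \<bullet> (g' \<rhd> q)" and ?l = "\<mu> \<bullet> (g \<rhd> \<delta>) \<bullet> (inv \<epsilon> \<lhd> \<iota>)"
  have l: "two ?l \<iota> \<iota>" using ty by simp
  have PQ: "two ?P (g' \<odot> t \<odot> j) j" "two ?Q (g' \<odot> t \<odot> \<kappa>) \<kappa>" using ty by simp_all
  have sw: "(\<theta> \<lhd> \<alpha>) \<bullet> (g' \<odot> \<phi> \<rhd> \<delta>) = (j \<odot> g \<rhd> \<delta>) \<bullet> (\<theta> \<lhd> (\<sigma> \<odot> \<iota>))"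
    by (rule swap[OF G(5) G'(4)]) (use ty in simp)
  have "(?Q \<lhd> f) \<bullet> (g' \<odot> t \<rhd> c) = (\<mu>' \<lhd> f) \<bullet> (g' \<rhd> ((q \<lhd> f) \<bullet> (t \<rhd> c)))" using ty by simp
  also have "\<dots> = ((\<mu>' \<lhd> f) \<bullet> (g' \<rhd> a)) \<bullet> (g' \<odot> \<phi> \<rhd> \<delta>) \<bullet> (g' \<rhd> (p \<lhd> \<iota>))"
    unfolding t(4)[symmetric] using ty by simp
  also have "\<dots> = c \<bullet> (j \<rhd> \<mu>) \<bullet> ((\<theta> \<lhd> \<alpha>) \<bullet> (g' \<odot> \<phi> \<rhd> \<delta>)) \<bullet> (g' \<rhd> (p \<lhd> \<iota>))"
    unfolding coh[symmetric] using ty by simp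
  also have "\<dots> = c \<bullet> (j \<rhd> ?l) \<bullet> (?P \<lhd> \<iota>)"
    unfolding sw using ty by simp
  finally have M: "(?Q \<lhd> f) \<bullet> (g' \<odot> t \<rhd> c) = c \<bullet> (j \<rhd> ?l) \<bullet> (?P \<lhd> \<iota>)" .
  have "square \<iota> f j \<kappa> (c \<bullet> (j \<rhd> inv ?l))" using ty l by (simp add: square_def)
  from wpo_exist[OF P this] obtain w p' q' where w: "hom w (cd j) (cd j)" "two p' (w \<odot> j) j" "two q' (w \<odot> \<kappa>) \<kappa>"
      "(c \<bullet> (j \<rhd> inv ?l)) \<bullet> (p' \<lhd> \<iota>) = (q' \<lhd> f) \<bullet> (w \<rhd> c)" .
  obtain l where l_def: "l = ?l" by blast
  have l: "two l \<iota> \<iota>" using l l_def by simp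
  obtain P Q where PQ_def: "P = ?P" "Q = ?Q" by blast
  have PQ: "two P (g' \<odot> t \<odot> j) j" "two Q (g' \<odot> t \<odot> \<kappa>) \<kappa>" using PQ PQ_def by simp_all
  note M = M[folded l_def PQ_def] and w4 = w(4)[folded l_def]
  have sw': "(P \<lhd> \<iota>) \<bullet> (g' \<odot> t \<odot> j \<rhd> inv l) = (j \<rhd> inv l) \<bullet> (P \<lhd> \<iota>)"
    using swap[of "inv l" \<iota> \<iota> P] l PQ ty by simp
  note ty = ty w(1-3) l PQ
  have "((Q \<bullet> (g' \<odot> t \<rhd> q')) \<lhd> f) \<bullet> (g' \<odot> t \<odot> w \<rhd> c) = (Q \<lhd> f) \<bullet> (g' \<odot> t \<rhd> ((q' \<lhd> f) \<bullet> (w \<rhd> c)))"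
    using ty by simp
  also have "\<dots> = ((Q \<lhd> f) \<bullet> (g' \<odot> t \<rhd> c)) \<bullet> (g' \<odot> t \<odot> j \<rhd> inv l) \<bullet> (g' \<odot> t \<rhd> (p' \<lhd> \<iota>))"
    unfolding w4[symmetric] using ty by simp
  also have "\<dots> = c \<bullet> (j \<rhd> l) \<bullet> ((P \<lhd> \<iota>) \<bullet> (g' \<odot> t \<odot> j \<rhd> inv l)) \<bullet> (g' \<odot> t \<rhd> (p' \<lhd> \<iota>))"
    unfolding M using ty by simp
  also have "\<dots> = c \<bullet> ((P \<bullet> (g' \<odot> t \<rhd> p')) \<lhd> \<iota>)"
    unfolding sw' using ty by simp
  finally have "parallel \<iota> f j \<kappa> c (g' \<odot> t \<odot> w) (idn (cd j)) (P \<bullet> (g' \<odot> t \<rhd> p')) (Q \<bullet> (g' \<odot> t \<rhd> q'))"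
    using ty by (simp add: parallel_def)
  then obtain \<gamma> where \<gamma>: "two \<gamma> (g' \<odot> t \<odot> w) (idn (cd j))" using wpo_unique[OF assms(1)] by blast
  show ?thesis
    by (rule that[of "t \<odot> w" \<gamma> "q \<bullet> (t \<rhd> q')"]) (use ty \<gamma> in simp_all)
qed

end

context closed_model_category begin

section \<open>The track category of bifibrant objects\<close>

text \<open>Two-cells have been constructed for cofibrant sources and bifibrant targets. To compose in both
  directions, all objects are now bifibrant.\<close>

definition bifibrant_arr where "bifibrant_arr = {f \<in> Arr M. bifibrant M (Dom M f) \<and> bifibrant M (Cod M f)}"
definition bifibrant_cells where "bifibrant_cells = (\<Union>A\<in>{A. bifibrant M A}. \<Union>Y. cells A Y)"

lemma bifibrant_cellsE:
  assumes "\<alpha> \<in> bifibrant_cells"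
  shows "\<alpha> \<in> cells (Dom M (src \<alpha>)) (Cod M (src \<alpha>))" "bifibrant M (Dom M (src \<alpha>))" "bifibrant M (Cod M (src \<alpha>))"
    "Dom M (tgt \<alpha>) = Dom M (src \<alpha>)" "Cod M (tgt \<alpha>) = Cod M (src \<alpha>)" "src \<alpha> \<in> Arr M" "tgt \<alpha> \<in> Arr M"
proof -
  obtain A Y where a: "bifibrant M A" "\<alpha> \<in> cells A Y" using assms unfolding bifibrant_cells_def by blast
  have Y: "bifibrant M Y" using a(2) by (auto elim: cellsE)
  note e = cells_ends[OF a(2)]
  show "\<alpha> \<in> cells (Dom M (src \<alpha>)) (Cod M (src \<alpha>))" "bifibrant M (Dom M (src \<alpha>))" "bifibrant M (Cod M (src \<alpha>))"
    "Dom M (tgt \<alpha>) = Dom M (src \<alpha>)" "Cod M (tgt \<alpha>) = Cod M (src \<alpha>)" "src \<alpha> \<in> Arr M" "tgt \<alpha> \<in> Arr M"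
    using a Y e by simp_all
qed

lemma bifibrant_cellsI: "\<alpha> \<in> cells A Y \<Longrightarrow> bifibrant M A \<Longrightarrow> \<alpha> \<in> bifibrant_cells"
  unfolding bifibrant_cells_def by blast

lemma bifibrant_arr_iff: "f \<in> bifibrant_arr \<longleftrightarrow> f \<in> Arr M \<and> bifibrant M (Dom M f) \<and> bifibrant M (Cod M f)"
  by (simp add: bifibrant_arr_def)

sublocale track: track_category bifibrant_arr "Dom M" "Cod M" "(\<cdot>)" "Id M" bifibrant_cells src tgt
  "(\<bullet>)" vid inverse_cell "(\<rhd>)" "(\<lhd>)"
proof
  fix f g h assume "f \<in> bifibrant_arr" "g \<in> bifibrant_arr" "Cod M f = Dom M g"
  then show "g \<cdot> f \<in> bifibrant_arr" "Dom M (g \<cdot> f) = Dom M f" "Cod M (g \<cdot> f) = Cod M g"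
    by (simp_all add: bifibrant_arr_iff)
next
  fix f g h assume "f \<in> bifibrant_arr" "g \<in> bifibrant_arr" "h \<in> bifibrant_arr" "Cod M f = Dom M g" "Cod M g = Dom M h"
  then show "(h \<cdot> g) \<cdot> f = h \<cdot> (g \<cdot> f)" by (simp add: bifibrant_arr_iff)
next
  fix f assume "f \<in> bifibrant_arr"
  then show "Id M (Dom M f) \<in> bifibrant_arr \<and> Dom M (Id M (Dom M f)) = Dom M f \<and> Cod M (Id M (Dom M f)) = Dom M f"
    "Id M (Cod M f) \<in> bifibrant_arr \<and> Dom M (Id M (Cod M f)) = Cod M f \<and> Cod M (Id M (Cod M f)) = Cod M f"
    by (simp_all add: bifibrant_arr_iff)
next
  fix f X assume "f \<in> bifibrant_arr" "Dom M f = X" then show "f \<cdot> Id M X = f" by (simp add: bifibrant_arr_iff)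
next
  fix f X assume "f \<in> bifibrant_arr" "Cod M f = X" then show "Id M X \<cdot> f = f" by (simp add: bifibrant_arr_iff)
next
  fix \<alpha> assume "\<alpha> \<in> bifibrant_cells"
  note c = bifibrant_cellsE[OF this]
  show "src \<alpha> \<in> bifibrant_arr" "tgt \<alpha> \<in> bifibrant_arr" "Dom M (tgt \<alpha>) = Dom M (src \<alpha>)" "Cod M (tgt \<alpha>) = Cod M (src \<alpha>)"
    using c by (simp_all add: bifibrant_arr_iff)
  note i = inverse_cells[OF c(1)]
  show "inverse_cell \<alpha> \<in> bifibrant_cells" "src (inverse_cell \<alpha>) = tgt \<alpha>" "tgt (inverse_cell \<alpha>) = src \<alpha>"
    using i bifibrant_cellsI[OF _ c(2)] by simp_all
  show "inverse_cell \<alpha> \<bullet> \<alpha> = vid (src \<alpha>)" "\<alpha> \<bullet> inverse_cell \<alpha> = vid (tgt \<alpha>)"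
    using vcomp_inverse[OF c(1)] by simp_all
next
  fix \<alpha> \<beta> assume a: "\<alpha> \<in> bifibrant_cells" and b: "\<beta> \<in> bifibrant_cells" and e: "tgt \<alpha> = src \<beta>"
  note ca = bifibrant_cellsE[OF a] and cb = bifibrant_cellsE[OF b]
  have b': "\<beta> \<in> cells (Dom M (src \<alpha>)) (Cod M (src \<alpha>))" using ca cb e by simp
  note v = vcomp_cells[OF ca(1) b' e]
  show "\<beta> \<bullet> \<alpha> \<in> bifibrant_cells" "src (\<beta> \<bullet> \<alpha>) = src \<alpha>" "tgt (\<beta> \<bullet> \<alpha>) = tgt \<beta>"
    using v bifibrant_cellsI[OF _ ca(2)] by simp_all
  { fix u assume u: "u \<in> bifibrant_arr" "Cod M (src \<alpha>) = Dom M u"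
    then have "u \<in> Hom M (Cod M (src \<alpha>)) (Cod M u)" "bifibrant M (Cod M u)" by (simp_all add: bifibrant_arr_iff)
    from postcomp_vcomp[OF ca(1) b' e this]
    show "u \<rhd> (\<beta> \<bullet> \<alpha>) = (u \<rhd> \<beta>) \<bullet> (u \<rhd> \<alpha>)" . }
  { fix u assume u: "u \<in> bifibrant_arr" "Dom M (src \<alpha>) = Cod M u"
    then have "cofibrant M (Dom M u)" "u \<in> Hom M (Dom M u) (Dom M (src \<alpha>))" by (simp_all add: bifibrant_arr_iff)
    from vcomp_precomp[OF ca(1) b' e this]
    show "(\<beta> \<bullet> \<alpha>) \<lhd> u = (\<beta> \<lhd> u) \<bullet> (\<alpha> \<lhd> u)" . }
  { fix \<gamma> assume g: "\<gamma> \<in> bifibrant_cells" "tgt \<beta> = src \<gamma>"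
    then have "\<gamma> \<in> cells (Dom M (src \<alpha>)) (Cod M (src \<alpha>))" using bifibrant_cellsE[OF g(1)] ca cb e by simp
    from vcomp_assoc[OF ca(1) b' this e g(2)] show "(\<gamma> \<bullet> \<beta>) \<bullet> \<alpha> = \<gamma> \<bullet> (\<beta> \<bullet> \<alpha>)" . }
next
  fix f assume f: "f \<in> bifibrant_arr"
  then have f': "f \<in> Hom M (Dom M f) (Cod M f)" "bifibrant M (Dom M f)" "cofibrant M (Dom M f)" "bifibrant M (Cod M f)"
    by (simp_all add: bifibrant_arr_iff)
  note v = vid_cells[OF f'(1,3,4)]
  show "vid f \<in> bifibrant_cells" "src (vid f) = f" "tgt (vid f) = f"
    using v bifibrant_cellsI[OF _ f'(2)] by simp_all
  { fix u assume u: "u \<in> bifibrant_arr" "Cod M f = Dom M u"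
    then have "bifibrant M (Cod M u)" "u \<in> Hom M (Cod M f) (Cod M u)" by (simp_all add: bifibrant_arr_iff)
    from postcomp_vid[OF f'(1,3,4) this] show "u \<rhd> vid f = vid (u \<cdot> f)" . }
  { fix u assume u: "u \<in> bifibrant_arr" "Dom M f = Cod M u"
    then have "cofibrant M (Dom M u)" "u \<in> Hom M (Dom M u) (Dom M f)" by (simp_all add: bifibrant_arr_iff)
    from vid_precomp[OF f'(1,3,4) this] show "vid f \<lhd> u = vid (f \<cdot> u)" . }
next
  fix \<alpha> f assume a: "\<alpha> \<in> bifibrant_cells"
  note c = bifibrant_cellsE[OF a]
  { assume "src \<alpha> = f" then show "\<alpha> \<bullet> vid f = \<alpha>" using vcomp_vid[OF c(1)] by simp }
  { assume "tgt \<alpha> = f" then show "vid f \<bullet> \<alpha> = \<alpha>" using vcomp_vid[OF c(1)] by simp }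
next
  fix \<alpha> u assume a: "\<alpha> \<in> bifibrant_cells" and u: "u \<in> bifibrant_arr" "Cod M (src \<alpha>) = Dom M u"
  note c = bifibrant_cellsE[OF a]
  have u': "u \<in> Hom M (Cod M (src \<alpha>)) (Cod M u)" "bifibrant M (Cod M u)" using u by (simp_all add: bifibrant_arr_iff)
  note p = postcomp_cells[OF c(1) u']
  show "u \<rhd> \<alpha> \<in> bifibrant_cells" "src (u \<rhd> \<alpha>) = u \<cdot> src \<alpha>" "tgt (u \<rhd> \<alpha>) = u \<cdot> tgt \<alpha>"
    using p bifibrant_cellsI[OF _ c(2)] by simp_all
  { fix w assume w: "w \<in> bifibrant_arr" "Cod M u = Dom M w"
    then have "w \<in> Hom M (Cod M u) (Cod M w)" "bifibrant M (Cod M w)" by (simp_all add: bifibrant_arr_iff)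
    from postcomp_postcomp[OF c(1) u'(1) this(1) u'(2) this(2)] show "w \<rhd> u \<rhd> \<alpha> = (w \<cdot> u) \<rhd> \<alpha>" . }
  { fix w assume w: "w \<in> bifibrant_arr" "Dom M (src \<alpha>) = Cod M w"
    then have "cofibrant M (Dom M w)" "w \<in> Hom M (Dom M w) (Dom M (src \<alpha>))" by (simp_all add: bifibrant_arr_iff)
    from postcomp_precomp[OF c(1) u' this] show "(u \<rhd> \<alpha>) \<lhd> w = u \<rhd> (\<alpha> \<lhd> w)" . }
next
  fix \<alpha> Y assume a: "\<alpha> \<in> bifibrant_cells"
  note c = bifibrant_cellsE[OF a]
  { assume "Cod M (src \<alpha>) = Y" then show "Id M Y \<rhd> \<alpha> = \<alpha>" using postcomp_Id[OF c(1)] by simp }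
  { assume "Dom M (src \<alpha>) = Y" then show "\<alpha> \<lhd> Id M Y = \<alpha>" using precomp_Id[OF c(1)] by simp }
next
  fix \<alpha> u assume a: "\<alpha> \<in> bifibrant_cells" and u: "u \<in> bifibrant_arr" "Dom M (src \<alpha>) = Cod M u"
  note c = bifibrant_cellsE[OF a]
  have u': "cofibrant M (Dom M u)" "bifibrant M (Dom M u)" "u \<in> Hom M (Dom M u) (Dom M (src \<alpha>))" using u by (simp_all add: bifibrant_arr_iff)
  note p = precomp_cells[OF c(1) u'(1,3)]
  show "\<alpha> \<lhd> u \<in> bifibrant_cells" "src (\<alpha> \<lhd> u) = src \<alpha> \<cdot> u" "tgt (\<alpha> \<lhd> u) = tgt \<alpha> \<cdot> u"
    using p bifibrant_cellsI[OF _ u'(2)] by simp_all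
  { fix w assume w: "w \<in> bifibrant_arr" "Dom M u = Cod M w"
    then have "cofibrant M (Dom M w)" "w \<in> Hom M (Dom M w) (Dom M u)" by (simp_all add: bifibrant_arr_iff)
    from precomp_precomp[OF c(1) u'(1,3) this] show "\<alpha> \<lhd> u \<lhd> w = \<alpha> \<lhd> (u \<cdot> w)" . }
next
  fix \<alpha> \<beta> assume a: "\<alpha> \<in> bifibrant_cells" and b: "\<beta> \<in> bifibrant_cells" and e: "Cod M (src \<alpha>) = Dom M (src \<beta>)"
  note ca = bifibrant_cellsE[OF a] and cb = bifibrant_cellsE[OF b]
  show "(\<beta> \<lhd> tgt \<alpha>) \<bullet> (src \<beta> \<rhd> \<alpha>) = (tgt \<beta> \<rhd> \<alpha>) \<bullet> (\<beta> \<lhd> src \<alpha>)"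
    using interchange[OF _ cb(1), of \<alpha> "Dom M (src \<alpha>)"] ca(1) e by simp
qed

lemma hcomm_squareD:
  assumes "hcomm_square M c f g u v h"
  shows "f \<in> bifibrant_arr" "g \<in> bifibrant_arr" "u \<in> bifibrant_arr" "v \<in> bifibrant_arr"
    "Dom M g = Dom M f" "Dom M u = Cod M f" "Dom M v = Cod M g" "Cod M v = Cod M u"
    "is_cylinder M (Dom M f) c" "h \<in> Hom M (cyl_ob M c) (Cod M u)" "h \<cdot> inc0 c = u \<cdot> f" "h \<cdot> inc1 c = v \<cdot> g"
proof -
  obtain A B C D where t: "bifibrant M A" "bifibrant M B" "bifibrant M C" "bifibrant M D"
        "f \<in> Hom M A B" "g \<in> Hom M A C" "u \<in> Hom M B D" "v \<in> Hom M C D"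
      and h: "is_homotopy M c h (u \<cdot> f) (v \<cdot> g)"
    using assms unfolding hcomm_square_def by blast
  show "f \<in> bifibrant_arr" "g \<in> bifibrant_arr" "u \<in> bifibrant_arr" "v \<in> bifibrant_arr"
    "Dom M g = Dom M f" "Dom M u = Cod M f" "Dom M v = Cod M g" "Cod M v = Cod M u"
    using t by (simp_all add: bifibrant_arr_iff)
  obtain A' D' where h': "u \<cdot> f \<in> Hom M A' D'" "is_cylinder M A' c" "h \<in> Hom M (cyl_ob M c) D'"
      "h \<cdot> inc0 c = u \<cdot> f" "h \<cdot> inc1 c = v \<cdot> g"
    using h unfolding is_homotopy_def by blast
  have "A' = Dom M f" "D' = Cod M u" using h'(1) t by simp_all
  with h' show "is_cylinder M (Dom M f) c" "h \<in> Hom M (cyl_ob M c) (Cod M u)" "h \<cdot> inc0 c = u \<cdot> f" "h \<cdot> inc1 c = v \<cdot> g"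
    by simp_all
qed

lemma hcomm_squareI:
  assumes "f \<in> bifibrant_arr" "g \<in> bifibrant_arr" "u \<in> bifibrant_arr" "v \<in> bifibrant_arr"
    "Dom M g = Dom M f" "Dom M u = Cod M f" "Dom M v = Cod M g" "Cod M v = Cod M u"
    "is_cylinder M (Dom M f) c" "h \<in> Hom M (cyl_ob M c) (Cod M u)" "h \<cdot> inc0 c = u \<cdot> f" "h \<cdot> inc1 c = v \<cdot> g"
  shows "hcomm_square M c f g u v h"
  unfolding hcomm_square_def is_homotopy_def
proof (intro conjI exI)
  show "bifibrant M (Dom M f)" "bifibrant M (Cod M f)" "bifibrant M (Cod M g)" "bifibrant M (Cod M u)"
    "f \<in> Hom M (Dom M f) (Cod M f)" "g \<in> Hom M (Dom M f) (Cod M g)" "u \<in> Hom M (Cod M f) (Cod M u)"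
    "v \<in> Hom M (Cod M g) (Cod M u)" "u \<cdot> f \<in> Hom M (Dom M f) (Cod M u)" "v \<cdot> g \<in> Hom M (Dom M f) (Cod M u)"
    using assms by (simp_all add: bifibrant_arr_iff)
qed (use assms in blast)+

lemma hcomm_square_cell:
  assumes s: "hcomm_square M c f g u v h"
  shows "cell_of c h \<in> cells (Dom M f) (Cod M u)" "track.square f g u v (cell_of c h)"
proof -
  note d = hcomm_squareD[OF s]
  have b: "bifibrant M (Dom M f)" "cofibrant M (Dom M f)" "bifibrant M (Cod M u)" using d by (simp_all add: bifibrant_arr_iff)
  note k = cell_of_cells[OF b(2,3) d(9,10)]
  show "cell_of c h \<in> cells (Dom M f) (Cod M u)" by (fact k)
  show "track.square f g u v (cell_of c h)"
    using d k bifibrant_cellsI[OF k(1) b(1)] by (simp add: track.square_def)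
qed

lemma square_hcomm:
  assumes s: "track.square f g u v \<eta>" and c: "is_cylinder M (Dom M f) c"
  obtains h where "hcomm_square M c f g u v h" "cell_of c h = \<eta>"
proof -
  note d = track.squareD[OF s]
  have "\<eta> \<in> cells (Dom M f) (Cod M u)"
    using bifibrant_cellsE(1)[OF d(9)] d by (simp add: bifibrant_arr_iff)
  from cells_are_homotopies[OF this c] obtain h where h: "h \<in> Hom M (cyl_ob M c) (Cod M u)"
    "h \<cdot> inc0 c = src \<eta>" "h \<cdot> inc1 c = tgt \<eta>" "cell_of c h = \<eta>" .
  then have "hcomm_square M c f g u v h"
    using d by (intro hcomm_squareI[OF d(1-8) c]) auto
  with h that show ?thesis by blast
qed

section \<open>Homotopy pushouts are weak pushouts of the track category\<close>

lemma homotopy_pushout_square: "homotopy_pushout M c f g u v h \<Longrightarrow> hcomm_square M c f g u v h"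
  by (simp add: homotopy_pushout_def)

lemma homotopy_pushoutE:
  assumes P: "homotopy_pushout M c f g u v h"
  obtains Z zb zi zc w where "double_cylinder M c f g Z zb zi zc" "w \<in> Hom M Z (Cod M u)"
    "w \<cdot> zb = u" "w \<cdot> zi = h" "w \<cdot> zc = v" "w \<in> Weq M"
  using P unfolding homotopy_pushout_def by blast

lemma whisker_exists:
  assumes P: "homotopy_pushout M c f g u v h" and s: "hcomm_square M c f g b x k"
  obtains t where "is_whisker M c f g u v h b x k t"
proof -
  obtain Z zb zi zc w where Z: "double_cylinder M c f g Z zb zi zc" and w: "w \<in> Hom M Z (Cod M u)"
    "w \<cdot> zb = u" "w \<cdot> zi = h" "w \<cdot> zc = v" "w \<in> Weq M" using homotopy_pushoutE[OF P] .
  note d = hcomm_squareD[OF homotopy_pushout_square[OF P]] and e = hcomm_squareD[OF s]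
  have fg: "f \<in> Hom M (Dom M f) (Cod M f)" "g \<in> Hom M (Dom M f) (Cod M g)" using d by (simp_all add: bifibrant_arr_iff)
  have bx: "b \<in> Hom M (Cod M f) (Cod M b)" "x \<in> Hom M (Cod M g) (Cod M b)" using e by (simp_all add: bifibrant_arr_iff)
  obtain m where m: "m \<in> Hom M Z (Cod M b)" "m \<cdot> zb = b" "m \<cdot> zi = k" "m \<cdot> zc = x"
    using double_cylinder_map[OF Z fg bx(1) e(10) bx(2) e(11,12)] .
  have bf: "cofibrant M (Cod M f)" "cofibrant M (Cod M g)" "cofibrant M (Cod M u)" "bifibrant M (Cod M b)"
    using d e by (simp_all add: bifibrant_arr_iff)
  have cZ: "cofibrant M Z" using double_cylinder_cofibrant[OF Z d(9) fg bf(1,2)] .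
  obtain t \<Theta> where t: "t \<in> Hom M (Cod M u) (Cod M b)" "\<Theta> \<in> cells Z (Cod M b)" "src \<Theta> = t \<cdot> w" "tgt \<Theta> = m"
    using weq_extend_map[OF w(1,5) cZ bf(3,4) m(1)] .
  have "homotopic M (t \<cdot> w) m"
    using homotopic_iff[OF cZ bf(4), of "t \<cdot> w" m] t w m by auto
  then have "is_whisker M c f g u v h b x k t"
    unfolding is_whisker_def using s t(1) Z w(1-4) m by blast
  with that show ?thesis .
qed

text \<open>The homotopy \<open>t \<cdot> w \<simeq> m\<close> on the double mapping cylinder restricts to the two legs; its interchange with
  the homotopy inside the cylinder is the compatibility of the restrictions.\<close>

lemma whisker_cells:
  assumes s: "hcomm_square M c f g u v h" and W: "is_whisker M c f g u v h b x k t"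
  obtains \<alpha> \<beta> where "track.hom t (Cod M u) (Cod M b)" "track.two \<alpha> (t \<cdot> u) b" "track.two \<beta> (t \<cdot> v) x"
    "cell_of c k \<bullet> (\<alpha> \<lhd> f) = (\<beta> \<lhd> g) \<bullet> (t \<rhd> cell_of c h)"
proof -
  have sk: "hcomm_square M c f g b x k" and t: "t \<in> Hom M (Cod M u) (Cod M b)"
    using W unfolding is_whisker_def by blast+
  obtain Z zb zi zc w m where Z: "double_cylinder M c f g Z zb zi zc" and
      w: "w \<in> Hom M Z (Cod M u)" "w \<cdot> zb = u" "w \<cdot> zi = h" "w \<cdot> zc = v" and
      m: "m \<in> Hom M Z (Cod M b)" "m \<cdot> zb = b" "m \<cdot> zi = k" "m \<cdot> zc = x" and hm: "homotopic M (t \<cdot> w) m"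
    using W unfolding is_whisker_def by blast
  note d = hcomm_squareD[OF s] and e = hcomm_squareD[OF sk]
  have fg: "f \<in> Hom M (Dom M f) (Cod M f)" "g \<in> Hom M (Dom M f) (Cod M g)" using d by (simp_all add: bifibrant_arr_iff)
  note za = double_cylinder_arr[OF Z fg]
  have bf: "cofibrant M (Cod M f)" "cofibrant M (Cod M g)" "bifibrant M (Cod M u)" "bifibrant M (Cod M b)" "cofibrant M (Dom M f)"
    using d e by (simp_all add: bifibrant_arr_iff)
  have cZ: "cofibrant M Z" using double_cylinder_cofibrant[OF Z d(9) fg bf(1,2)] .
  obtain \<Theta> where T: "\<Theta> \<in> cells Z (Cod M b)" "src \<Theta> = t \<cdot> w" "tgt \<Theta> = m"
    using homotopic_iff[OF cZ bf(4), of "t \<cdot> w" m] t w m hm by auto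
  note A = precomp_cells[OF T(1) bf(1) za(1)] and B = precomp_cells[OF T(1) bf(2) za(3)]
  have bb: "\<Theta> \<lhd> zb \<in> bifibrant_cells" "\<Theta> \<lhd> zc \<in> bifibrant_cells"
    using bifibrant_cellsI[OF A(1)] bifibrant_cellsI[OF B(1)] d by (simp_all add: bifibrant_arr_iff)
  have "src \<Theta> \<cdot> zi = t \<cdot> h" "tgt \<Theta> \<cdot> zi = k" using T t w za m by simp_all
  then have "(\<Theta> \<lhd> (zc \<cdot> g)) \<bullet> cell_of c (t \<cdot> h) = cell_of c k \<bullet> (\<Theta> \<lhd> (zb \<cdot> f))"
    using interchange_homotopy[OF bf(5) d(9) za(2) T(1)] za(4,5) by simp
  moreover have "t \<rhd> cell_of c h = cell_of c (t \<cdot> h)" using postcomp_cell_of[OF bf(5,3) d(9,10) t bf(4)] .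
  moreover have "\<Theta> \<lhd> (zc \<cdot> g) = (\<Theta> \<lhd> zc) \<lhd> g" "\<Theta> \<lhd> (zb \<cdot> f) = (\<Theta> \<lhd> zb) \<lhd> f"
    using precomp_precomp[OF T(1) bf(2) za(3) bf(5) fg(2)] precomp_precomp[OF T(1) bf(1) za(1) bf(5) fg(1)] by simp_all
  ultimately have "cell_of c k \<bullet> ((\<Theta> \<lhd> zb) \<lhd> f) = ((\<Theta> \<lhd> zc) \<lhd> g) \<bullet> (t \<rhd> cell_of c h)" by simp
  then show ?thesis
    using that[of "\<Theta> \<lhd> zb" "\<Theta> \<lhd> zc"] bb A B T w m t za bf by (simp add: bifibrant_arr_iff)
qed

text \<open>Maps out of the corner come from maps out of the double mapping cylinder, as these are weakly
  equivalent. A compatible pair of two-cells on the legs becomes, after \<open>square_fill\<close>, a strict map from the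
  double mapping cylinder to the path object, that is, a two-cell on it, which descends to the corner.\<close>

theorem homotopy_pushout_po:
  assumes P: "homotopy_pushout M c f g u v h"
  shows "track.po f g u v (cell_of c h)"
  unfolding track.po_def track.weak_exist_def
proof (intro conjI allI impI)
  note s = homotopy_pushout_square[OF P]
  note d = hcomm_squareD[OF s]
  show "track.square f g u v (cell_of c h)" using hcomm_square_cell[OF s] by simp
  { fix b x \<kappa> assume "track.square f g b x \<kappa>"
    from square_hcomm[OF this d(9)] obtain k where k: "hcomm_square M c f g b x k" "cell_of c k = \<kappa>" .
    obtain t where "is_whisker M c f g u v h b x k t" using whisker_exists[OF P k(1)] .
    from whisker_cells[OF s this] k
    show "\<exists>t \<alpha> \<beta>. track.hom t (Cod M u) (Cod M b) \<and> track.two \<alpha> (t \<cdot> u) b \<and> track.two \<beta> (t \<cdot> v) x \<and>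
        \<kappa> \<bullet> (\<alpha> \<lhd> f) = (\<beta> \<lhd> g) \<bullet> (t \<rhd> cell_of c h)" by metis }
  fix t t' \<alpha> \<beta> assume par: "track.parallel f g u v (cell_of c h) t t' \<alpha> \<beta>"
  note p = track.parallelD[OF par]
  obtain Z zb zi zc w where Z: "double_cylinder M c f g Z zb zi zc" and w: "w \<in> Hom M Z (Cod M u)"
    "w \<cdot> zb = u" "w \<cdot> zi = h" "w \<cdot> zc = v" "w \<in> Weq M" using homotopy_pushoutE[OF P] .
  let ?T = "Cod M t"
  have fg: "f \<in> Hom M (Dom M f) (Cod M f)" "g \<in> Hom M (Dom M f) (Cod M g)" using d by (simp_all add: bifibrant_arr_iff)
  note za = double_cylinder_arr[OF Z fg] and ca = cylinder_arr[OF d(9)]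
  have bf: "cofibrant M (Cod M f)" "cofibrant M (Cod M g)" "cofibrant M (Cod M u)" "bifibrant M ?T" "cofibrant M (Dom M f)" "?T \<in> Ob M"
      "bifibrant M (Cod M u)"
    using d p(1) by (simp_all add: bifibrant_arr_iff)
  have cZ: "cofibrant M Z" using double_cylinder_cofibrant[OF Z d(9) fg bf(1,2)] .
  have tt: "t \<in> Hom M (Cod M u) ?T" "t' \<in> Hom M (Cod M u) ?T" using p by (simp_all add: bifibrant_arr_iff)
  have uv: "u \<in> Hom M (Cod M f) (Cod M u)" "v \<in> Hom M (Cod M g) (Cod M u)" using d by (simp_all add: bifibrant_arr_iff)
  have ab: "\<alpha> \<in> cells (Cod M f) ?T" "src \<alpha> = t \<cdot> u" "tgt \<alpha> = t' \<cdot> u" "\<beta> \<in> cells (Cod M g) ?T" "src \<beta> = t \<cdot> v" "tgt \<beta> = t' \<cdot> v"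
    using p(6,7) bifibrant_cellsE(1)[of \<alpha>] bifibrant_cellsE(1)[of \<beta>] tt uv by auto
  note ra = rep[OF ab(1)] and rb = rep[OF ab(4)]
  have k: "rep \<alpha> \<cdot> f \<in> Hom M (Dom M f) (paths ?T)" "rep \<beta> \<cdot> g \<in> Hom M (Dom M f) (paths ?T)"
    using ra rb fg by simp_all
  have z: "t \<cdot> h \<in> Hom M (cyl_ob M c) ?T" "t' \<cdot> h \<in> Hom M (cyl_ob M c) ?T" using tt d(10) by simp_all
  have ends: "start ?T \<cdot> rep \<alpha> = t \<cdot> u" "finish ?T \<cdot> rep \<alpha> = t' \<cdot> u" "start ?T \<cdot> rep \<beta> = t \<cdot> v" "finish ?T \<cdot> rep \<beta> = t' \<cdot> v"
    using ab ra(2) rb(2) cell_ends by metis+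
  have ends': "start ?T \<cdot> (rep \<alpha> \<cdot> f) = t \<cdot> u \<cdot> f" "finish ?T \<cdot> (rep \<alpha> \<cdot> f) = t' \<cdot> u \<cdot> f"
     "start ?T \<cdot> (rep \<beta> \<cdot> g) = t \<cdot> v \<cdot> g" "finish ?T \<cdot> (rep \<beta> \<cdot> g) = t' \<cdot> v \<cdot> g"
    using comp_cong[OF ends(1)] comp_cong[OF ends(2)] comp_cong[OF ends(3)] comp_cong[OF ends(4)] ra rb fg tt uv bf(6) d(5) by simp_all
  have "cell ?T (rep \<alpha> \<cdot> f) = \<alpha> \<lhd> f" "cell ?T (rep \<beta> \<cdot> g) = \<beta> \<lhd> g"
    using precomp_cell[OF bf(1,5,4) ra(1) fg(1)] precomp_cell[OF bf(2,5,4) rb(1) fg(2)] ra rb by simp_all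
  moreover have "t \<rhd> cell_of c h = cell_of c (t \<cdot> h)" "t' \<rhd> cell_of c h = cell_of c (t' \<cdot> h)"
    using postcomp_cell_of[OF bf(5,7) d(9,10) tt(1) bf(4)] postcomp_cell_of[OF bf(5,7) d(9,10) tt(2) bf(4)] by simp_all
  ultimately have q: "cell ?T (rep \<beta> \<cdot> g) \<bullet> cell_of c (t \<cdot> h) = cell_of c (t' \<cdot> h) \<bullet> cell ?T (rep \<alpha> \<cdot> f)"
    using p(8) by simp
  obtain H where H: "H \<in> Hom M (cyl_ob M c) (paths ?T)" "H \<cdot> inc0 c = rep \<alpha> \<cdot> f" "H \<cdot> inc1 c = rep \<beta> \<cdot> g"
      "start ?T \<cdot> H = t \<cdot> h" "finish ?T \<cdot> H = t' \<cdot> h"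
    by (rule square_fill[OF bf(5,4) d(9) k z _ _ _ _ q]) (use ends' tt d(10-12) ca in simp_all)
  obtain N where N: "N \<in> Hom M Z (paths ?T)" "N \<cdot> zb = rep \<alpha>" "N \<cdot> zi = H" "N \<cdot> zc = rep \<beta>"
    using double_cylinder_map[OF Z fg ra(1) H(1) rb(1) H(2,3)] .
  have e0: "start ?T \<cdot> N = t \<cdot> w"
    by (rule double_cylinder_unique[OF Z d(9) fg]) (use N H ends w za tt bf(6) in simp_all)
  have e1: "finish ?T \<cdot> N = t' \<cdot> w"
    by (rule double_cylinder_unique[OF Z d(9) fg]) (use N H ends w za tt bf(6) in simp_all)
  have G: "cell ?T N \<in> cells Z ?T" using cellsI[OF cZ bf(4) N(1)] .
  obtain \<gamma> where \<gamma>: "\<gamma> \<in> cells (Cod M u) ?T" "src \<gamma> = t" "tgt \<gamma> = t'" "\<gamma> \<lhd> w = cell ?T N"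
    by (rule weq_extend_cell[OF w(1,5) bf(3) G tt]) (use e0 e1 that in simp_all)
  have "\<gamma> \<lhd> u = (\<gamma> \<lhd> w) \<lhd> zb" "\<gamma> \<lhd> v = (\<gamma> \<lhd> w) \<lhd> zc"
    using precomp_precomp[OF \<gamma>(1) cZ w(1) bf(1) za(1)] precomp_precomp[OF \<gamma>(1) cZ w(1) bf(2) za(3)] w by simp_all
  then have "\<gamma> \<lhd> u = \<alpha>" "\<gamma> \<lhd> v = \<beta>"
    unfolding \<gamma>(4) using precomp_cell[OF cZ bf(1,4) N(1) za(1)] precomp_cell[OF cZ bf(2,4) N(1) za(3)] N ra rb by simp_all
  moreover have "\<gamma> \<in> bifibrant_cells" using bifibrant_cellsI[OF \<gamma>(1)] bf(7) by simp
  ultimately show "\<exists>\<gamma>. track.two \<gamma> t t' \<and> \<gamma> \<lhd> u = \<alpha> \<and> \<gamma> \<lhd> v = \<beta>"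
    using \<gamma> by (intro exI[of _ \<gamma>]) simp
qed

lemma double_cylinder_homotopy_pushout:
  assumes fg: "f \<in> bifibrant_arr" "g \<in> bifibrant_arr" "Dom M g = Dom M f" and c: "is_cylinder M (Dom M f) c"
    and Z: "double_cylinder M c f g Z zb zi zc" and R: "bifibrant M R" "i \<in> Hom M Z R" "i \<in> Weq M"
  shows "homotopy_pushout M c f g (i \<cdot> zb) (i \<cdot> zc) (i \<cdot> zi)"
proof -
  have fg': "f \<in> Hom M (Dom M f) (Cod M f)" "g \<in> Hom M (Dom M f) (Cod M g)" using fg by (simp_all add: bifibrant_arr_iff)
  note za = double_cylinder_arr[OF Z fg'] and ca = cylinder_arr[OF c]
  have "hcomm_square M c f g (i \<cdot> zb) (i \<cdot> zc) (i \<cdot> zi)"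
    by (rule hcomm_squareI) (use fg za ca R c in \<open>simp_all add: bifibrant_arr_iff\<close>)
  moreover have "i \<in> Hom M Z (Cod M (i \<cdot> zb))" using R za by simp
  ultimately show ?thesis unfolding homotopy_pushout_def using Z R(3) by blast
qed

lemma homotopy_pushout_exists:
  assumes fg: "f \<in> bifibrant_arr" "g \<in> bifibrant_arr" "Dom M g = Dom M f" and c: "is_cylinder M (Dom M f) c"
  obtains u v h where "homotopy_pushout M c f g u v h"
proof -
  have fg': "f \<in> Hom M (Dom M f) (Cod M f)" "g \<in> Hom M (Dom M f) (Cod M g)"
    "cofibrant M (Cod M f)" "cofibrant M (Cod M g)" using fg by (simp_all add: bifibrant_arr_iff)
  obtain Z zb zi zc where Z: "double_cylinder M c f g Z zb zi zc" using double_cylinder_exists[OF fg'(1,2) c] .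
  obtain R i where R: "bifibrant M R" "i \<in> Hom M Z R" "i \<in> Weq M"
    using fibrant_replacement[OF double_cylinder_cofibrant[OF Z c fg']] by blast
  from that[OF double_cylinder_homotopy_pushout[OF fg c Z R]] show ?thesis .
qed

text \<open>Compare the corner with a fibrant replacement \<open>R\<close> of the double mapping cylinder, which is a
  homotopy pushout by construction. Both are weak pushouts of the same span, so the comparison map is a
  homotopy equivalence and hence a weak equivalence.\<close>

theorem wpo_homotopy_pushout:
  assumes P: "track.wpo f g u v \<eta>" and c: "is_cylinder M (Dom M f) c"
  obtains h where "homotopy_pushout M c f g u v h" "cell_of c h = \<eta>"
proof -
  note sq = track.wpo_square[OF P]
  note ty = track.squareD[OF sq]
  obtain h where s: "hcomm_square M c f g u v h" and h: "cell_of c h = \<eta>" using square_hcomm[OF sq c] .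
  note d = hcomm_squareD[OF s]
  have fg': "f \<in> Hom M (Dom M f) (Cod M f)" "g \<in> Hom M (Dom M f) (Cod M g)" using d by (simp_all add: bifibrant_arr_iff)
  have uv: "u \<in> Hom M (Cod M f) (Cod M u)" "v \<in> Hom M (Cod M g) (Cod M u)" using d by (simp_all add: bifibrant_arr_iff)
  have bf: "cofibrant M (Cod M f)" "cofibrant M (Cod M g)" "bifibrant M (Cod M u)" "fibrant M (Cod M u)" "cofibrant M (Dom M f)"
    using d by (simp_all add: bifibrant_arr_iff)
  obtain Z zb zi zc where Z: "double_cylinder M c f g Z zb zi zc" using double_cylinder_exists[OF fg' c] .
  note za = double_cylinder_arr[OF Z fg'] and ca = cylinder_arr[OF c]
  obtain w where w: "w \<in> Hom M Z (Cod M u)" "w \<cdot> zb = u" "w \<cdot> zi = h" "w \<cdot> zc = v"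
    using double_cylinder_map[OF Z fg' uv(1) d(10) uv(2) d(11,12)] .
  obtain R i where R: "bifibrant M R" "i \<in> Hom M Z R" "i \<in> Cof M" "i \<in> Weq M"
    using fibrant_replacement[OF double_cylinder_cofibrant[OF Z c fg' bf(1,2)]] .
  note PR = double_cylinder_homotopy_pushout[OF d(1,2,5) c Z R(1,2,4)]
  let ?\<eta> = "cell_of c (i \<cdot> zi)"
  note po = homotopy_pushout_po[OF PR]
  note wR = track.po_imp_wpo[OF po]
  note tr = track.squareD[OF track.wpo_square[OF wR]]
  obtain w' where w': "w' \<in> Hom M R (Cod M u)" "w' \<cdot> i = w" using fibrant_extend[OF bf(4) R(2-4) w(1)] .
  have w'b: "w' \<in> bifibrant_arr" using w' R bf by (simp add: bifibrant_arr_iff)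
  have w'z: "w' \<cdot> (i \<cdot> zb) = u" "w' \<cdot> (i \<cdot> zc) = v" "w' \<cdot> (i \<cdot> zi) = h"
    using comp_cong[OF w'(2)] w w' R za by simp_all
  obtain t \<alpha> \<beta> where t: "track.hom t (Cod M u) (Cod M (i \<cdot> zb))" "track.two \<alpha> (t \<cdot> u) (i \<cdot> zb)" "track.two \<beta> (t \<cdot> v) (i \<cdot> zc)"
      "?\<eta> \<bullet> (\<alpha> \<lhd> f) = (\<beta> \<lhd> g) \<bullet> (t \<rhd> \<eta>)"
    using track.wpo_exist[OF P track.wpo_square[OF wR]] .
  have t1: "t \<in> bifibrant_arr" "Dom M t = Cod M u" "Cod M t = R" using t(1) R za by simp_all
  have izi: "i \<cdot> zi \<in> Hom M (cyl_ob M c) R" using R za by simp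
  have w\<eta>: "w' \<rhd> ?\<eta> = \<eta>" using postcomp_cell_of[OF bf(5) R(1) c izi w'(1) bf(3)] w'z h by simp
  have idb: "Id M (Cod M u) \<in> bifibrant_arr" "Id M R \<in> bifibrant_arr" using bf R by (simp_all add: bifibrant_arr_iff)
  have ob: "Cod M u \<in> Ob M" "R \<in> Ob M" using bf R by simp_all
  have D: "Dom M w' = R" "Cod M w' = Cod M u" using w' by simp_all
  have zR: "Cod M (i \<cdot> zb) = R" using R za by simp
  have tr': "i \<cdot> zb \<in> bifibrant_arr" "i \<cdot> zc \<in> bifibrant_arr" "Dom M (i \<cdot> zb) = Cod M f" "Dom M (i \<cdot> zc) = Cod M g"
    "Cod M (i \<cdot> zb) = R" "Cod M (i \<cdot> zc) = R" using tr zR by simp_all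
  have "track.parallel f g u v \<eta> (w' \<cdot> t) (Id M (Cod M u)) (w' \<rhd> \<alpha>) (w' \<rhd> \<beta>)"
  proof -
    have "((w' \<rhd> \<beta>) \<lhd> g) \<bullet> ((w' \<cdot> t) \<rhd> \<eta>) = w' \<rhd> ((\<beta> \<lhd> g) \<bullet> (t \<rhd> \<eta>))"
      using ty t1 t(2,3) w'b D tr' by simp
    also have "\<dots> = (w' \<rhd> ?\<eta>) \<bullet> ((w' \<rhd> \<alpha>) \<lhd> f)"
      unfolding t(4)[symmetric] using ty tr(9-11) t1 t(2,3) w'b D tr' by simp
    finally show ?thesis unfolding w\<eta> track.parallel_def
      using ty t1 t(2,3) w'b D tr' w'z idb ob by simp
  qed
  then obtain \<gamma> where \<gamma>: "track.two \<gamma> (w' \<cdot> t) (Id M (Cod M u))" using track.wpo_unique[OF P] by blast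
  have "track.parallel f g (i \<cdot> zb) (i \<cdot> zc) ?\<eta> (t \<cdot> w') (Id M R) \<alpha> \<beta>"
  proof -
    have "(t \<cdot> w') \<rhd> ?\<eta> = t \<rhd> (w' \<rhd> ?\<eta>)" using ty tr(9-11) t1 w'b D tr' by simp
    then have "(t \<cdot> w') \<rhd> ?\<eta> = t \<rhd> \<eta>" unfolding w\<eta> .
    moreover have "(t \<cdot> w') \<cdot> (i \<cdot> zb) = t \<cdot> u" "(t \<cdot> w') \<cdot> (i \<cdot> zc) = t \<cdot> v"
      using ty t1 w'b D tr' w'z by simp_all
    moreover have "Id M R \<rhd> ?\<eta> = ?\<eta>" using ty tr(9-11) tr' by simp
    ultimately show ?thesis unfolding track.parallel_def
      using ty tr(9-11) t1 t(2-4) w'b D tr' idb ob by simp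
  qed
  then obtain \<delta> where \<delta>: "track.two \<delta> (t \<cdot> w') (Id M R)" using track.wpo_unique[OF wR] by blast
  have "w' \<in> Weq M"
    by (rule homotopy_equivalence_weq[OF R(1) bf(3) w'(1), of t \<delta> \<gamma>])
      (use \<gamma> \<delta> t1 D ob bifibrant_cellsE(1)[of \<gamma>] bifibrant_cellsE(1)[of \<delta>] w' in \<open>auto simp: bifibrant_arr_iff\<close>)
  then have "w \<in> Weq M" using weq_comp[OF R(4) _ R(2) w'(1)] w' by simp
  then have "homotopy_pushout M c f g u v h" unfolding homotopy_pushout_def using s Z w by blast
  with h that show ?thesis by blast
qed

lemma wpo_po:
  assumes P: "track.wpo f g u v \<eta>"
  shows "track.po f g u v \<eta>"
proof -
  have "Dom M f \<in> Ob M" using track.squareD(1)[OF track.wpo_square[OF P]] by (simp add: bifibrant_arr_iff)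
  then obtain c where c: "is_cylinder M (Dom M f) c" using cylinder_exists by blast
  obtain h where h: "homotopy_pushout M c f g u v h" "cell_of c h = \<eta>" using wpo_homotopy_pushout[OF P c] .
  from homotopy_pushout_po[OF h(1)] show ?thesis unfolding h(2) .
qed

end

context closed_model_category begin

lemma track_hom_iff: "track.hom f A Y \<longleftrightarrow> f \<in> Hom M A Y \<and> bifibrant M A \<and> bifibrant M Y"
  by (auto simp: bifibrant_arr_iff)

lemma homotopic_cell:
  assumes "f \<in> Hom M A Y" "g \<in> Hom M A Y" "bifibrant M A" "bifibrant M Y" "homotopic M f g"
  shows "\<exists>\<alpha>. track.two \<alpha> f g"
proof -
  have "cofibrant M A" using assms by simp
  then obtain \<alpha> where "\<alpha> \<in> cells A Y" "src \<alpha> = f" "tgt \<alpha> = g"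
    using homotopic_iff[OF _ assms(4,1,2)] assms(5) by blast
  then have "track.two \<alpha> f g" using bifibrant_cellsI assms(3) by simp
  then show ?thesis ..
qed

lemma cell_homotopic:
  assumes "track.two \<alpha> f g" "f \<in> Hom M A Y" "g \<in> Hom M A Y" "bifibrant M A" "bifibrant M Y"
  shows "homotopic M f g"
proof -
  have A: "cofibrant M A" using assms by simp
  have "\<alpha> \<in> cells A Y" "src \<alpha> = f" "tgt \<alpha> = g" using assms bifibrant_cellsE(1)[of \<alpha>] by simp_all
  then show ?thesis using homotopic_iff[OF A assms(5,2,3)] by blast
qed

section \<open>Homotopy pullbacks\<close>

text \<open>A cofibrant replacement of the double path space. Its universal property holds in a strict form: a
  homotopy commutative square is induced by a map whose composites with \<open>f\<close> and \<open>g\<close> are exactly the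
  given ones, and whose two-cell is the given one. The homotopy \<open>h\<close> has to correspond
  to the tautological path \<open>k\<close>, and is obtained by moving \<open>k\<close> to a constant path with its end fixed.\<close>

lemma homotopy_pullback_exists:
  assumes uv: "track.hom u B D" "track.hom v C D"
  obtains c f g h F where "homotopy_pullback M c f g u v h" "track.hom f F B" "track.hom g F C"
    "\<forall>T b x \<xi>. track.hom b T B \<longrightarrow> track.hom x T C \<longrightarrow> track.two \<xi> (u \<cdot> b) (v \<cdot> x) \<longrightarrow>
      (\<exists>\<zeta>. track.hom \<zeta> T F \<and> f \<cdot> \<zeta> = b \<and> g \<cdot> \<zeta> = x \<and> cell_of c h \<lhd> \<zeta> = \<xi>)"
proof -
  have u: "u \<in> Hom M B D" and v: "v \<in> Hom M C D" and bf: "bifibrant M B" "bifibrant M C" "bifibrant M D"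
    using uv unfolding track_hom_iff by blast+
  have D: "D \<in> Ob M" "fibrant M D" "fibrant M B" "fibrant M C" using bf by simp_all
  let ?p = "path_object D"
  note p = path_object[OF D(1)]
  have P: "path_space M ?p = paths D" "ev0 ?p = start D" "ev1 ?p = finish D"
    by (simp_all add: paths_def start_def finish_def)
  obtain E eb ep ec where E: "double_path_space M ?p u v E eb ep ec"
    using double_path_space_exists[OF u v p] .
  note ea = double_path_space_arr[OF E u v, unfolded P]
  note em = double_path_space_map[OF E u v, unfolded P]
  note eu = double_path_space_unique[OF E p u v]
  have fE: "fibrant M E"
  proof (rule fibrant_by_extension)
    show "E \<in> Ob M" using Hom_Ob[OF ea(1)] by simp
    fix U W i x assume i: "i \<in> Hom M U W" "i \<in> Cof M" "i \<in> Weq M" and x: "x \<in> Hom M U E"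
    have x': "eb \<cdot> x \<in> Hom M U B" "ep \<cdot> x \<in> Hom M U (paths D)" "ec \<cdot> x \<in> Hom M U C" using x ea by simp_all
    obtain b where b: "b \<in> Hom M W B" "b \<cdot> i = eb \<cdot> x" using fibrant_extend[OF D(3) i x'(1)] .
    obtain y where y: "y \<in> Hom M W C" "y \<cdot> i = ec \<cdot> x" using fibrant_extend[OF D(4) i x'(3)] .
    have uby: "u \<cdot> b \<in> Hom M W D" "v \<cdot> y \<in> Hom M W D" using b y u v by simp_all
    obtain k where k: "k \<in> Hom M W (paths D)" "k \<cdot> i = ep \<cdot> x" "start D \<cdot> k = u \<cdot> b" "finish D \<cdot> k = v \<cdot> y"
      by (rule path_lift[OF D(1) i x'(2) uby])
        (use b y u v i x ea D comp_cong[OF ea(4)] comp_cong[OF ea(5)] in simp_all)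
    obtain m where m: "m \<in> Hom M W E" "eb \<cdot> m = b" "ep \<cdot> m = k" "ec \<cdot> m = y" using em[OF b(1) k(1) y(1) k(3,4)] .
    have mi: "m \<cdot> i \<in> Hom M U E" using m i by simp
    have "m \<cdot> i = x"
      by (rule eu[OF mi x]) (use m b y k i ea comp_cong[OF m(2)] comp_cong[OF m(3)] comp_cong[OF m(4)] in simp_all)
    with m show "\<exists>l\<in>Hom M W E. l \<cdot> i = x" by blast
  qed
  obtain F q where F: "bifibrant M F" "q \<in> Hom M F E" "q \<in> Fib M" "q \<in> Weq M" using cofibrant_replacement[OF fE] .
  have cF: "cofibrant M F" "F \<in> Ob M" using F by simp_all
  obtain c where c: "is_cylinder M F c" using cylinder_exists cF by blast
  note ca = cylinder_arr[OF c]
  define f where "f = eb \<cdot> q"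
  define g where "g = ec \<cdot> q"
  define k where "k = ep \<cdot> q"
  have fgk: "f \<in> Hom M F B" "g \<in> Hom M F C" "k \<in> Hom M F (paths D)" "start D \<cdot> k = u \<cdot> f" "finish D \<cdot> k = v \<cdot> g"
    using F ea u v D comp_cong[OF ea(4)] comp_cong[OF ea(5)] by (simp_all add: f_def g_def k_def)
  have vg: "v \<cdot> g \<in> Hom M F D" using fgk v by simp
  have l: "const_path D \<cdot> (v \<cdot> g) \<in> Hom M F (paths D)" "(v \<cdot> g) \<cdot> proj c \<in> Hom M (cyl_ob M c) D" "finish D \<in> Hom M (paths D) D"
    using vg ca D by simp_all
  obtain H where H: "H \<in> Hom M (cyl_ob M c) (paths D)" "H \<cdot> inc0 c = k" "H \<cdot> inc1 c = const_path D \<cdot> (v \<cdot> g)"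
      "finish D \<cdot> H = (v \<cdot> g) \<cdot> proj c"
    by (rule cylinder_lift[OF c l(3) ev_tfib(3,4)[OF D(2)] fgk(3) l(1,2)]) (use fgk v ca D in simp_all)
  define h where "h = start D \<cdot> H"
  have h: "h \<in> Hom M (cyl_ob M c) D" "h \<cdot> inc0 c = u \<cdot> f" "h \<cdot> inc1 c = v \<cdot> g"
    using H fgk ca D v by (simp_all add: h_def)
  have sq: "hcomm_square M c f g u v h"
    by (rule hcomm_squareI) (use fgk u v bf F c h in \<open>simp_all add: bifibrant_arr_iff\<close>)
  have "corresponds M c h ?p k (v \<cdot> g)"
    unfolding corresponds_def P using H by (intro bexI[of _ H]) (simp_all add: h_def const_path_def paths_def)
  moreover have "is_path_ob M (Cod M u) ?p" "q \<in> Hom M (Dom M f) E" using p u F fgk by simp_all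
  ultimately have pb: "homotopy_pullback M c f g u v h"
    unfolding homotopy_pullback_def using sq E F(4) f_def g_def k_def by blast
  note gn = gen_cells[OF bf(3)]
  note kc = cellsI[OF cF(1) bf(3) fgk(3)]
  have "(gen D \<lhd> (H \<cdot> inc1 c)) \<bullet> cell_of c (start D \<cdot> H) = cell_of c (finish D \<cdot> H) \<bullet> (gen D \<lhd> (H \<cdot> inc0 c))"
    using interchange_homotopy[OF cF(1) c H(1) gn(1)] gn by simp
  moreover have "gen D \<lhd> (H \<cdot> inc1 c) = vid (v \<cdot> g)"
    unfolding H(3) using gen_precomp[OF bf(3) cF(1) l(1)] vg by (simp add: vid_def)
  moreover have "cell_of c (finish D \<cdot> H) = vid (v \<cdot> g)"
    unfolding H(4) using cell_of_const[OF cF(1) bf(3) c vg] .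
  moreover have "gen D \<lhd> (H \<cdot> inc0 c) = cell D k" unfolding H(2) using gen_precomp[OF bf(3) cF(1) fgk(3)] .
  ultimately have hk: "cell_of c h = cell D k"
    using vcomp_vid(1)[OF kc] vcomp_vid(1)[OF cell_of_cells(1)[OF cF(1) bf(3) c h(1)]]
      cell_of_cells[OF cF(1) bf(3) c h(1)] fgk h by (simp add: h_def)
  have "\<exists>\<zeta>. track.hom \<zeta> T F \<and> f \<cdot> \<zeta> = b \<and> g \<cdot> \<zeta> = x \<and> cell_of c h \<lhd> \<zeta> = \<xi>"
    if b: "track.hom b T B" and x: "track.hom x T C" and \<xi>: "track.two \<xi> (u \<cdot> b) (v \<cdot> x)" for T b x \<xi>
  proof -
    have bx: "b \<in> Hom M T B" "x \<in> Hom M T C" "bifibrant M T" using b x unfolding track_hom_iff by blast+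
    have cT: "cofibrant M T" using bx by simp
    have \<xi>c: "\<xi> \<in> cells T D" "src \<xi> = u \<cdot> b" "tgt \<xi> = v \<cdot> x"
      using \<xi> bifibrant_cellsE(1)[of \<xi>] bx u by auto
    obtain k' where k': "k' \<in> Hom M T (paths D)" "\<xi> = cell D k'" using cellsE[OF \<xi>c(1)] .
    have k'e: "start D \<cdot> k' = u \<cdot> b" "finish D \<cdot> k' = v \<cdot> x" using \<xi>c k' by simp_all
    obtain m where m: "m \<in> Hom M T E" "eb \<cdot> m = b" "ep \<cdot> m = k'" "ec \<cdot> m = x"
      using em[OF bx(1) k'(1) bx(2) k'e] .
    obtain \<zeta> where z: "\<zeta> \<in> Hom M T F" "q \<cdot> \<zeta> = m" using cofibrant_lift[OF cT F(2-4) m(1)] .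
    have "f \<cdot> \<zeta> = b" "g \<cdot> \<zeta> = x" "k \<cdot> \<zeta> = k'" using z m F ea by (simp_all add: f_def g_def k_def)
    moreover have "cell D k \<lhd> \<zeta> = cell D (k \<cdot> \<zeta>)" using precomp_cell[OF cF(1) cT bf(3) fgk(3) z(1)] .
    moreover have "track.hom \<zeta> T F" unfolding track_hom_iff using z bx F by simp
    ultimately show ?thesis using hk k' by auto
  qed
  then have "\<forall>T b x \<xi>. track.hom b T B \<longrightarrow> track.hom x T C \<longrightarrow> track.two \<xi> (u \<cdot> b) (v \<cdot> x) \<longrightarrow>
      (\<exists>\<zeta>. track.hom \<zeta> T F \<and> f \<cdot> \<zeta> = b \<and> g \<cdot> \<zeta> = x \<and> cell_of c h \<lhd> \<zeta> = \<xi>)" by blast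
  moreover have "track.hom f F B" "track.hom g F C" unfolding track_hom_iff using fgk F bf by simp_all
  ultimately show ?thesis using that pb by blast
qed

section \<open>Relative category\<close>

text \<open>The stages for \<open>\<iota>\<close> are arbitrary, while those for \<open>\<kappa>\<close> are chosen, with the strict homotopy pullbacks
  constructed above; so a map of homotopy pullbacks is needed only into the chosen one.\<close>

lemma ganea_comparison:
  assumes tp: "track.hom \<iota> A X" "track.hom f A B" "track.hom j X S" "track.hom \<kappa> B S" "track.two C (j \<cdot> \<iota>) (\<kappa> \<cdot> f)"
    and gan: "ganea M \<iota> n g \<alpha>"
  shows "\<exists>G G' \<phi> g' \<alpha>' \<theta> a \<mu> \<mu>'. ganea M \<kappa> n g' \<alpha>' \<and>
    track.hom g G X \<and> track.hom \<alpha> A G \<and> track.two \<mu> (g \<cdot> \<alpha>) \<iota> \<and>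
    track.hom \<phi> G G' \<and> track.hom g' G' S \<and> track.hom \<alpha>' B G' \<and> track.two \<theta> (g' \<cdot> \<phi>) (j \<cdot> g) \<and>
    track.two a (\<phi> \<cdot> \<alpha>) (\<alpha>' \<cdot> f) \<and> track.two \<mu>' (g' \<cdot> \<alpha>') \<kappa> \<and>
    C \<bullet> (j \<rhd> \<mu>) \<bullet> (\<theta> \<lhd> \<alpha>) = (\<mu>' \<lhd> f) \<bullet> (g' \<rhd> a)"
  using gan
proof (induction rule: ganea.induct)
  case base
  have d: "Dom M \<iota> = A" "Dom M \<kappa> = B" using tp by simp_all
  have i: "track.hom (Id M A) A A" "track.hom (Id M B) B B" using tp by (auto simp: bifibrant_arr_iff)
  have g0: "ganea M \<kappa> 0 \<kappa> (Id M B)" using ganea.base[of M \<kappa>] d by simp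
  show ?case
    unfolding d
    by (rule exI[of _ A], rule exI[of _ B], rule exI[of _ f], rule exI[of _ \<kappa>], rule exI[of _ "Id M B"],
        rule exI[of _ "inverse_cell C"], rule exI[of _ "vid f"], rule exI[of _ "vid \<iota>"], rule exI[of _ "vid \<kappa>"])
      (use g0 tp i in simp)
next
  case (step n g \<alpha> c \<eta> \<beta> h \<alpha>1 \<gamma> hp g1)
  from step.IH obtain G G' \<phi> g' \<alpha>' \<theta> a \<mu> \<mu>' where gan': "ganea M \<kappa> n g' \<alpha>'"
    and g: "track.hom g G X" and al: "track.hom \<alpha> A G"
    and ph: "track.hom \<phi> G G'" and g': "track.hom g' G' S" and th: "track.two \<theta> (g' \<cdot> \<phi>) (j \<cdot> g)" by blast
  have sq: "hcomm_square M c \<eta> \<beta> \<iota> g h" using step.hyps(2) by (simp add: homotopy_pullback_def)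
  note d = hcomm_squareD[OF sq]
  note sq2 = track.squareD[OF hcomm_square_cell(2)[OF sq]]
  have F: "track.hom \<eta> (Dom M \<eta>) A" "track.hom \<beta> (Dom M \<eta>) G" "track.two (cell_of c h) (\<iota> \<cdot> \<eta>) (g \<cdot> \<beta>)"
    using sq2 tp g by simp_all
  note P = homotopy_pushout_po[OF step.hyps(3)]
  note sP = track.squareD[OF track.wpo_square[OF track.po_imp_wpo[OF P]]]
  obtain \<mu>1 \<nu> where w: "track.hom g1 (Cod M \<alpha>1) (Cod M \<iota>)" "track.two \<mu>1 (g1 \<cdot> \<alpha>1) \<iota>" "track.two \<nu> (g1 \<cdot> \<gamma>) g"
      "cell_of c h \<bullet> (\<mu>1 \<lhd> \<eta>) = (\<nu> \<lhd> \<beta>) \<bullet> (g1 \<rhd> cell_of c hp)"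
    using whisker_cells[OF homotopy_pushout_square[OF step.hyps(3)] step.hyps(4)] .
  have g1: "track.hom g1 (Cod M \<alpha>1) X" using w(1) tp by simp
  obtain c' \<eta>' \<beta>' h' F' where pb: "homotopy_pullback M c' \<eta>' \<beta>' \<kappa> g' h'" "track.hom \<eta>' F' B" "track.hom \<beta>' F' G'"
    and univ: "\<forall>T b x \<xi>. track.hom b T B \<longrightarrow> track.hom x T G' \<longrightarrow> track.two \<xi> (\<kappa> \<cdot> b) (g' \<cdot> x) \<longrightarrow>
      (\<exists>\<zeta>. track.hom \<zeta> T F' \<and> \<eta>' \<cdot> \<zeta> = b \<and> \<beta>' \<cdot> \<zeta> = x \<and> cell_of c' h' \<lhd> \<zeta> = \<xi>)"
    using homotopy_pullback_exists[OF tp(4) g'] .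
  have sq': "hcomm_square M c' \<eta>' \<beta>' \<kappa> g' h'" using pb(1) by (simp add: homotopy_pullback_def)
  note d' = hcomm_squareD[OF sq']
  note sq2' = track.squareD[OF hcomm_square_cell(2)[OF sq']]
  obtain \<alpha>1' \<gamma>' hp' where P': "homotopy_pushout M c' \<eta>' \<beta>' \<alpha>1' \<gamma>' hp'"
    using homotopy_pushout_exists[OF d'(1,2,5,9)] .
  note qP' = track.po_imp_wpo[OF homotopy_pushout_po[OF P']]
  note sP' = track.squareD[OF track.wpo_square[OF qP']]
  obtain g1' where W': "is_whisker M c' \<eta>' \<beta>' \<alpha>1' \<gamma>' hp' \<kappa> g' h' g1'" using whisker_exists[OF P' sq'] .
  have gan1: "ganea M \<kappa> (Suc n) g1' \<alpha>1'" using ganea.step[OF gan' pb(1) P' W'] .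
  obtain \<mu>1' \<nu>' where w': "track.hom g1' (Cod M \<alpha>1') (Cod M \<kappa>)" "track.two \<mu>1' (g1' \<cdot> \<alpha>1') \<kappa>" "track.two \<nu>' (g1' \<cdot> \<gamma>') g'"
      "cell_of c' h' \<bullet> (\<mu>1' \<lhd> \<eta>') = (\<nu>' \<lhd> \<beta>') \<bullet> (g1' \<rhd> cell_of c' hp')"
    using whisker_cells[OF homotopy_pushout_square[OF P'] W'] .
  have g1': "track.hom g1' (Cod M \<alpha>1') S" using w'(1) tp by simp
  have h'2: "track.two (cell_of c' h') (\<kappa> \<cdot> \<eta>') (g' \<cdot> \<beta>')" using sq2' by simp
  have b: "track.hom (f \<cdot> \<eta>) (Dom M \<eta>) B" and x: "track.hom (\<phi> \<cdot> \<beta>) (Dom M \<eta>) G'"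
    and xi: "track.two ((inverse_cell \<theta> \<lhd> \<beta>) \<bullet> (j \<rhd> cell_of c h) \<bullet> (inverse_cell C \<lhd> \<eta>)) (\<kappa> \<cdot> (f \<cdot> \<eta>)) (g' \<cdot> (\<phi> \<cdot> \<beta>))"
    using tp F g ph g' th by simp_all
  obtain \<zeta> where z: "track.hom \<zeta> (Dom M \<eta>) F'" "\<eta>' \<cdot> \<zeta> = f \<cdot> \<eta>" "\<beta>' \<cdot> \<zeta> = \<phi> \<cdot> \<beta>"
      "cell_of c' h' \<lhd> \<zeta> = (inverse_cell \<theta> \<lhd> \<beta>) \<bullet> (j \<rhd> cell_of c h) \<bullet> (inverse_cell C \<lhd> \<eta>)"
    using univ[rule_format, OF b x xi] by blast
  obtain \<phi>1 \<theta>1 a1 where r: "track.hom \<phi>1 (Cod M \<alpha>1) (Cod M \<alpha>1')" "track.two \<theta>1 (g1' \<cdot> \<phi>1) (j \<cdot> g1)" "track.two a1 (\<phi>1 \<cdot> \<alpha>1) (\<alpha>1' \<cdot> f)"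
    "C \<bullet> (j \<rhd> \<mu>1) \<bullet> (\<theta>1 \<lhd> \<alpha>1) = (\<mu>1' \<lhd> f) \<bullet> (g1' \<rhd> a1)"
    using track.ganea_comparison_step[OF tp g ph g' th F P g1 w(2-4) pb(2,3) h'2 track.wpo_square[OF qP'] g1' w'(2-4) z] .
  have "track.hom \<alpha>1 A (Cod M \<alpha>1)" "track.hom \<alpha>1' B (Cod M \<alpha>1')" using sP sP' F pb by simp_all
  then show ?case using gan1 g1 w(2) r g1' w'(2) by blast
qed

theorem relcat_pushout_le:
  assumes P: "homotopy_pushout M c \<iota> f j \<kappa> h"
  shows "relcat M \<kappa> \<le> relcat M \<iota>"
proof -
  note po = track.po_imp_wpo[OF homotopy_pushout_po[OF P]]
  note s = track.squareD[OF track.wpo_square[OF po]]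
  have tp: "track.hom \<iota> (Dom M \<iota>) (Cod M \<iota>)" "track.hom f (Dom M \<iota>) (Cod M f)" "track.hom j (Cod M \<iota>) (Cod M j)"
    "track.hom \<kappa> (Cod M f) (Cod M j)" "track.two (cell_of c h) (j \<cdot> \<iota>) (\<kappa> \<cdot> f)" using s by simp_all
  have "\<exists>g \<alpha> \<sigma>. ganea M \<kappa> n g \<alpha> \<and> \<sigma> \<in> Hom M (Cod M \<kappa>) (Dom M g) \<and>
     homotopic M (g \<cdot> \<sigma>) (Id M (Cod M \<kappa>)) \<and> homotopic M (\<sigma> \<cdot> \<kappa>) \<alpha>"
    if g: "ganea M \<iota> n g \<alpha>" and \<sigma>: "\<sigma> \<in> Hom M (Cod M \<iota>) (Dom M g)"
      and H: "homotopic M (g \<cdot> \<sigma>) (Id M (Cod M \<iota>))" "homotopic M (\<sigma> \<cdot> \<iota>) \<alpha>" for n g \<alpha> \<sigma>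
  proof -
    obtain G G' \<phi> g' \<alpha>' \<theta> a \<mu> \<mu>' where g': "ganea M \<kappa> n g' \<alpha>'"
      and t: "track.hom g G (Cod M \<iota>)" "track.hom \<alpha> (Dom M \<iota>) G" "track.two \<mu> (g \<cdot> \<alpha>) \<iota>"
      and t': "track.hom \<phi> G G'" "track.hom g' G' (Cod M j)" "track.hom \<alpha>' (Cod M f) G'" "track.two \<theta> (g' \<cdot> \<phi>) (j \<cdot> g)"
        "track.two a (\<phi> \<cdot> \<alpha>) (\<alpha>' \<cdot> f)" "track.two \<mu>' (g' \<cdot> \<alpha>') \<kappa>"
      and coh: "cell_of c h \<bullet> (j \<rhd> \<mu>) \<bullet> (\<theta> \<lhd> \<alpha>) = (\<mu>' \<lhd> f) \<bullet> (g' \<rhd> a)"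
      using ganea_comparison[OF tp g] by blast
    have tt: "g \<in> Hom M G (Cod M \<iota>)" "\<alpha> \<in> Hom M (Dom M \<iota>) G" "bifibrant M G" "bifibrant M (Cod M \<iota>)" "bifibrant M (Dom M \<iota>)"
      "\<iota> \<in> Hom M (Dom M \<iota>) (Cod M \<iota>)" "Cod M \<iota> \<in> Ob M"
      using t(1,2) tp(1) unfolding track_hom_iff by simp_all
    have \<sigma>': "track.hom \<sigma> (Cod M \<iota>) G" unfolding track_hom_iff using \<sigma> tt by simp
    have "\<exists>\<epsilon>. track.two \<epsilon> (g \<cdot> \<sigma>) (Id M (Cod M \<iota>))"
      by (rule homotopic_cell[where A = "Cod M \<iota>" and Y = "Cod M \<iota>"]) (use H(1) tt \<sigma> in simp_all)
    then obtain \<epsilon> where e: "track.two \<epsilon> (g \<cdot> \<sigma>) (Id M (Cod M \<iota>))" ..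
    have "\<exists>\<delta>. track.two \<delta> (\<sigma> \<cdot> \<iota>) \<alpha>"
      by (rule homotopic_cell[where A = "Dom M \<iota>" and Y = G]) (use H(2) tt \<sigma> in simp_all)
    then obtain \<delta> where d: "track.two \<delta> (\<sigma> \<cdot> \<iota>) \<alpha>" ..
    obtain \<sigma>1 \<epsilon>1 \<delta>1 where r: "track.hom \<sigma>1 (Cod M j) G'" "track.two \<epsilon>1 (g' \<cdot> \<sigma>1) (Id M (Cod M j))" "track.two \<delta>1 (\<sigma>1 \<cdot> \<kappa>) \<alpha>'"
      using track.section_over_pushout[OF po t(1) \<sigma>' t(2) e d t(3) t' coh] .
    have u: "g' \<in> Hom M G' (Cod M j)" "\<sigma>1 \<in> Hom M (Cod M j) G'" "\<alpha>' \<in> Hom M (Cod M f) G'" "\<kappa> \<in> Hom M (Cod M f) (Cod M j)"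
        "bifibrant M G'" "bifibrant M (Cod M j)" "bifibrant M (Cod M f)" "Cod M j \<in> Ob M"
      using t'(2,3) r(1) tp(4) unfolding track_hom_iff by simp_all
    have "homotopic M (g' \<cdot> \<sigma>1) (Id M (Cod M j))"
      by (rule cell_homotopic[OF r(2), where A = "Cod M j" and Y = "Cod M j"]) (use u in simp_all)
    moreover have "homotopic M (\<sigma>1 \<cdot> \<kappa>) \<alpha>'"
      by (rule cell_homotopic[OF r(3), where A = "Cod M f" and Y = G']) (use u in simp_all)
    moreover have "Cod M \<kappa> = Cod M j" "Dom M g' = G'" using u by simp_all
    ultimately show ?thesis using g' u(2) by metis
  qed
  then show ?thesis unfolding relcat_def by (intro Inf_superset_mono) blast
qed

section \<open>Strong relative category\<close>

text \<open>The pushed forward sequence consists of homotopy pushouts of the \<open>jj i\<close> along \<open>f\<close>. They may be chosen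
  freely except for the last one, which has to be the given one, with structure map exactly \<open>\<kappa>\<close>.\<close>

lemma strong_relcat_seq_pushout:
  assumes P: "homotopy_pushout M c \<iota> f j \<kappa> h" and seq: "strong_relcat_seq M \<iota> n"
  shows "strong_relcat_seq M \<kappa> n"
proof -
  note poP = homotopy_pushout_po[OF P]
  note wP = track.po_imp_wpo[OF poP]
  note s = track.squareD[OF track.wpo_square[OF wP]]
  have bf: "bifibrant M (Dom M \<iota>)" "bifibrant M (Cod M f)" "bifibrant M (Cod M j)" "f \<in> Hom M (Dom M \<iota>) (Cod M f)" "\<iota> \<in> Arr M"
    "Dom M \<iota> \<in> Ob M" "Cod M f \<in> Ob M"
    using s by (simp_all add: bifibrant_arr_iff)
  obtain X jj where X: "X n = Cod M \<iota>" and jj0: "\<forall>i\<le>n. bifibrant M (X i) \<and> jj i \<in> Hom M (Dom M \<iota>) (X i)"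
    and inv: "has_homotopy_inverse M (jj 0)"
    and st0: "\<forall>i<n. \<exists>Z \<rho> \<tau> \<chi> \<sigma> c h. \<rho> \<in> Hom M Z (Dom M \<iota>) \<and> \<tau> \<in> Hom M Z (X i) \<and>
           homotopy_pushout M c \<rho> \<tau> (jj (Suc i)) \<chi> h \<and> \<sigma> \<in> Hom M (Dom M \<iota>) Z \<and>
           homotopic M (\<rho> \<cdot> \<sigma>) (Id M (Dom M \<iota>)) \<and> homotopic M (\<tau> \<cdot> \<sigma>) (jj i)"
    and last: "homotopic M (jj n) \<iota>"
    using seq unfolding strong_relcat_seq_def by (elim exE conjE) (rule that)
  note jj = jj0[rule_format] and st = st0[rule_format]
  have jb: "jj i \<in> bifibrant_arr" if "i \<le> n" for i using jj[OF that] bf by (simp add: bifibrant_arr_iff)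
  have cobase: "\<exists>u k \<eta>. track.po (jj i) f u k \<eta> \<and> (i = n \<longrightarrow> k = \<kappa>)" if i: "i \<le> n" for i
  proof (cases "i = n")
    case True
    have "\<exists>\<psi>. track.two \<psi> (jj n) \<iota>"
      by (rule homotopic_cell[where A = "Dom M \<iota>" and Y = "Cod M \<iota>"]) (use last jj[of n] X bf in simp_all)
    then obtain \<psi> where "track.two \<psi> (jj n) \<iota>" ..
    from wpo_po[OF track.wpo_change_leg[OF wP this]] True show ?thesis by blast
  next
    case False
    obtain c where "is_cylinder M (Dom M (jj i)) c" using cylinder_exists[OF bf(6)] jj[OF i] by auto
    moreover have "Dom M f = Dom M (jj i)" using s jj[OF i] by simp
    ultimately obtain u k h where "homotopy_pushout M c (jj i) f u k h"
      using homotopy_pushout_exists[OF jb[OF i] s(2)] by metis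
    from homotopy_pushout_po[OF this] False show ?thesis by blast
  qed
  have "\<exists>x. i \<le> n \<longrightarrow> track.po (jj i) f (fst x) (fst (snd x)) (snd (snd x)) \<and> (i = n \<longrightarrow> fst (snd x) = \<kappa>)" for i
  proof (cases "i \<le> n")
    case True
    from cobase[OF this] obtain u k \<eta> where "track.po (jj i) f u k \<eta>" "i = n \<longrightarrow> k = \<kappa>" by blast
    then show ?thesis by (intro exI[of _ "(u, k, \<eta>)"]) simp
  qed simp
  then obtain x where x: "\<And>i. i \<le> n \<longrightarrow> track.po (jj i) f (fst (x i)) (fst (snd (x i))) (snd (snd (x i))) \<and> (i = n \<longrightarrow> fst (snd (x i)) = \<kappa>)"
    using choice[of "\<lambda>i x. i \<le> n \<longrightarrow> track.po (jj i) f (fst x) (fst (snd x)) (snd (snd x)) \<and> (i = n \<longrightarrow> fst (snd x) = \<kappa>)"]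
    by blast
  define u k \<eta> where "u i = fst (x i)" and "k i = fst (snd (x i))" and "\<eta> i = snd (snd (x i))" for i
  have po: "track.po (jj i) f (u i) (k i) (\<eta> i)" if "i \<le> n" for i
    using x[of i] that unfolding u_def k_def \<eta>_def by blast
  have kn: "k n = \<kappa>" using x[of n] unfolding k_def by blast
  have ks: "track.hom (k i) (Cod M f) (Cod M (k i))" "Cod M (u i) = Cod M (k i)" if "i \<le> n" for i
    using track.squareD[OF track.wpo_square[OF track.po_imp_wpo[OF po[OF that]]]] by simp_all
  have kh: "k i \<in> Hom M (Cod M f) (Cod M (k i))" "bifibrant M (Cod M (k i))" if "i \<le> n" for i
    using ks(1)[OF that] unfolding track_hom_iff by blast+
  have Dk: "Dom M \<kappa> = Cod M f" using kh(1)[of n] kn by simp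
  have "has_homotopy_inverse M (k 0)"
  proof -
    have j0: "jj 0 \<in> Hom M (Dom M \<iota>) (X 0)" "bifibrant M (X 0)" "X 0 \<in> Ob M" using jj[of 0] by simp_all
    obtain r where r: "r \<in> Hom M (X 0) (Dom M \<iota>)" "homotopic M (r \<cdot> jj 0) (Id M (Dom M \<iota>))" "homotopic M (jj 0 \<cdot> r) (Id M (X 0))"
      using inv j0 unfolding has_homotopy_inverse_def by auto
    have "\<exists>e1. track.two e1 (r \<cdot> jj 0) (Id M (Dom M (jj 0)))"
      by (rule homotopic_cell[where A = "Dom M \<iota>" and Y = "Dom M \<iota>"]) (use r j0 bf in simp_all)
    then obtain e1 where e1: "track.two e1 (r \<cdot> jj 0) (Id M (Dom M (jj 0)))" ..
    have "\<exists>e2. track.two e2 (jj 0 \<cdot> r) (Id M (Cod M (jj 0)))"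
      by (rule homotopic_cell[where A = "X 0" and Y = "X 0"]) (use r j0 bf in simp_all)
    then obtain e2 where e2: "track.two e2 (jj 0 \<cdot> r) (Id M (Cod M (jj 0)))" ..
    have rh: "track.hom r (Cod M (jj 0)) (Dom M (jj 0))" unfolding track_hom_iff using r j0 bf by simp
    obtain r' z1 z2 where r': "track.hom r' (Cod M (k 0)) (Dom M (k 0))" "track.two z1 (r' \<cdot> k 0) (Id M (Dom M (k 0)))"
        "track.two z2 (k 0 \<cdot> r') (Id M (Cod M (k 0)))"
      using track.wpo_equivalence[OF track.po_imp_wpo[OF po[of 0]] rh e1 e2] by blast
    have rr: "r' \<in> Hom M (Cod M (k 0)) (Dom M (k 0))" "k 0 \<in> Hom M (Dom M (k 0)) (Cod M (k 0))"
       "bifibrant M (Dom M (k 0))" "bifibrant M (Cod M (k 0))" "Dom M (k 0) \<in> Ob M" "Cod M (k 0) \<in> Ob M"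
      using r'(1) kh[of 0] bf by (simp_all add: bifibrant_arr_iff)
    have "homotopic M (r' \<cdot> k 0) (Id M (Dom M (k 0)))"
      by (rule cell_homotopic[OF r'(2), where A = "Dom M (k 0)" and Y = "Dom M (k 0)"]) (use rr in simp_all)
    moreover have "homotopic M (k 0 \<cdot> r') (Id M (Cod M (k 0)))"
      by (rule cell_homotopic[OF r'(3), where A = "Cod M (k 0)" and Y = "Cod M (k 0)"]) (use rr in simp_all)
    ultimately show ?thesis unfolding has_homotopy_inverse_def using rr(1) by blast
  qed
  moreover have "\<exists>Z \<rho> \<tau> \<chi> \<sigma> c h. \<rho> \<in> Hom M Z (Dom M \<kappa>) \<and> \<tau> \<in> Hom M Z (Cod M (k i)) \<and>
           homotopy_pushout M c \<rho> \<tau> (k (Suc i)) \<chi> h \<and> \<sigma> \<in> Hom M (Dom M \<kappa>) Z \<and>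
           homotopic M (\<rho> \<cdot> \<sigma>) (Id M (Dom M \<kappa>)) \<and> homotopic M (\<tau> \<cdot> \<sigma>) (k i)" if i: "i < n" for i
  proof -
    obtain Z \<rho> \<tau> \<chi> \<sigma> c h where r: "\<rho> \<in> Hom M Z (Dom M \<iota>)" "\<tau> \<in> Hom M Z (X i)"
           "homotopy_pushout M c \<rho> \<tau> (jj (Suc i)) \<chi> h" "\<sigma> \<in> Hom M (Dom M \<iota>) Z"
           "homotopic M (\<rho> \<cdot> \<sigma>) (Id M (Dom M \<iota>))" "homotopic M (\<tau> \<cdot> \<sigma>) (jj i)" using st[OF i] by blast
    note Q = homotopy_pushout_po[OF r(3)]
    note sQ = track.squareD[OF track.wpo_square[OF track.po_imp_wpo[OF Q]]]
    have bZ: "bifibrant M Z" using sQ r by (simp add: bifibrant_arr_iff)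
    have ji: "jj i \<in> Hom M (Dom M \<iota>) (X i)" "bifibrant M (X i)" using jj[of i] i by simp_all
    have \<sigma>: "track.hom \<sigma> (Cod M \<rho>) (Dom M \<rho>)" unfolding track_hom_iff using r bZ bf by simp
    have "\<exists>a. track.two a (\<rho> \<cdot> \<sigma>) (Id M (Cod M \<rho>))"
      by (rule homotopic_cell[where A = "Dom M \<iota>" and Y = "Dom M \<iota>"]) (use r bf in simp_all)
    then obtain a where a: "track.two a (\<rho> \<cdot> \<sigma>) (Id M (Cod M \<rho>))" ..
    have "\<exists>b. track.two b (\<tau> \<cdot> \<sigma>) (jj i)"
      by (rule homotopic_cell[where A = "Dom M \<iota>" and Y = "X i"]) (use r bf ji in simp_all)
    then obtain b where b: "track.two b (\<tau> \<cdot> \<sigma>) (jj i)" ..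
    have sb: "\<sigma> \<in> bifibrant_arr" "Dom M f = Dom M \<sigma>" using \<sigma> s r by simp_all
    obtain cc where "is_cylinder M (Dom M \<sigma>) cc" using cylinder_exists bf(6) r by auto
    then obtain p q l where W: "homotopy_pushout M cc \<sigma> f p q l"
      using homotopy_pushout_exists[OF sb(1) s(2) sb(2)] by blast
    note W' = homotopy_pushout_po[OF W]
    note sW = track.squareD[OF track.wpo_square[OF track.po_imp_wpo[OF W']]]
    have i': "i \<le> n" "Suc i \<le> n" using i by simp_all
    obtain \<rho>' \<tau>' \<chi>' h' a' b' where R: "track.po \<rho>' \<tau>' (k (Suc i)) \<chi>' h'" "track.hom \<rho>' (Cod M q) (Cod M f)" "track.hom \<tau>' (Cod M q) (Cod M (u i))"
      "track.two a' (\<rho>' \<cdot> q) (Id M (Cod M f))" "track.two b' (\<tau>' \<cdot> q) (k i)"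
      using track.pushout_of_step[OF wpo_po Q \<sigma> a b po[OF i'(1)] po[OF i'(2)] W'] .
    have t: "\<rho>' \<in> Hom M (Cod M q) (Cod M f)" "\<tau>' \<in> Hom M (Cod M q) (Cod M (k i))" "q \<in> Hom M (Cod M f) (Cod M q)"
      "bifibrant M (Cod M q)" "Cod M q \<in> Ob M"
      using R(2,3) sW ks(2)[OF i'(1)] by (simp_all add: bifibrant_arr_iff)
    have "Dom M \<rho>' \<in> Ob M" using t by simp
    then obtain c' where c': "is_cylinder M (Dom M \<rho>') c'" using cylinder_exists by blast
    obtain h'' where "homotopy_pushout M c' \<rho>' \<tau>' (k (Suc i)) \<chi>' h''"
      using wpo_homotopy_pushout[OF track.po_imp_wpo[OF R(1)] c'] .
    moreover have "homotopic M (\<rho>' \<cdot> q) (Id M (Cod M f))"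
      by (rule cell_homotopic[OF R(4), where A = "Cod M f" and Y = "Cod M f"]) (use t bf in simp_all)
    moreover have "homotopic M (\<tau>' \<cdot> q) (k i)"
      by (rule cell_homotopic[OF R(5), where A = "Cod M f" and Y = "Cod M (k i)"]) (use t bf kh[OF i'(1)] in simp_all)
    ultimately show ?thesis unfolding Dk using t by blast
  qed
  moreover have "homotopic M (k n) \<kappa>"
  proof (rule cell_homotopic[where \<alpha> = "vid \<kappa>" and A = "Cod M f" and Y = "Cod M (k n)"])
    show "track.two (vid \<kappa>) (k n) \<kappa>" using s kn by simp
  qed (use kh[of n] kn bf in simp_all)
  ultimately show ?thesis unfolding strong_relcat_seq_def
    by (intro exI[of _ "\<lambda>i. Cod M (k i)"] exI[of _ k]) (use kn kh Dk in auto)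
qed

theorem strong_relcat_pushout_le:
  assumes "homotopy_pushout M c \<iota> f j \<kappa> h"
  shows "strong_relcat M \<kappa> \<le> strong_relcat M \<iota>"
  unfolding strong_relcat_def
  using strong_relcat_seq_pushout[OF assms] by (intro Inf_superset_mono) blast

end

theorem lemma11:
  fixes M :: "('o, 'm) model_cat"
    and A B X S :: 'o
    and \<iota>\<^sub>X f j \<kappa>\<^sub>S h :: 'm
    and c :: "'m cylinder"
  assumes "closed_model_category M" and "cube_axiom M"
    and "bifibrant M A" and "bifibrant M B" and "bifibrant M X" and "bifibrant M S"
    and "\<iota>\<^sub>X \<in> Hom M A X" and "f \<in> Hom M A B"
    and "j \<in> Hom M X S" and "\<kappa>\<^sub>S \<in> Hom M B S"
    and "homotopy_pushout M c \<iota>\<^sub>X f j \<kappa>\<^sub>S h"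
  shows "strong_relcat M \<kappa>\<^sub>S \<le> strong_relcat M \<iota>\<^sub>X \<and> relcat M \<kappa>\<^sub>S \<le> relcat M \<iota>\<^sub>X"
proof -
  interpret closed_model_category M by fact
  show ?thesis
    using strong_relcat_pushout_le relcat_pushout_le assms(11) by blast
qed

end
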